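(* For every $n\ge 6$ the family $\mathcal{T}_n$ is generic in the variety of all $n$-dimensional complex anticommutative nilpotent algebras. Moreover, for every $n\ge 2$ this variety is irreducible and has dimension $\frac{(n-2)(n^2+2n+3)}{6}$.
   Context: All algebras are over $\mathbb{C}$, not necessarily associative. Fix an $n$-dimensional vector space with basis $e_1,\dots,e_n$; algebra structures are identified with points $(c_{ij}^k)\in\mathbb{C}^{n^3}$ of structure constants, $e_ie_j=\sum_kc_{ij}^ke_k$, with Zariski topology; $\mathrm{GL}_n(\mathbb{C})$ acts by change of basis, $O(\mathcal{A})$ denotes an orbit. An algebra is anticommutative if $xy=-yx$ for all $x,y$. $N$ is nilpotent if $N^k=0$ for some $k$, where $N^1=N$, $N^{k+1}=\sum_{i=1}^kN^iN^{k+1-i}$. A family $\mathcal{R}$ in an irreducible variety $\mathfrak{V}$ is generic if $\overline{\bigcup_{\mathcal{A}\in\mathcal{R}}O(\mathcal{A})}=\mathfrak{V}$. Condition ( * ): $c_{ij}^k=0$ whenever $k\le\max\{i,j\}$. For $n\ge6$, $\mathcal{T}_n$ is the family of anticommutative algebra structures satisfying ( * ) such that: $e_ie_{i+1}=e_{i+2}$ for $1\le i\le n-2$; $c_{1i}^{i+2}=c_{2i}^{i+2}=0$ for $4\le i\le n-2$; $c_{13}^4=c_{14}^5=c_{24}^5=c_{15}^6=c_{25}^6=c_{13}^6=0$; $c_{13}^5\neq0$; $c_{35}^6=1$ and (only when $n\ge7$) $c_{46}^7=1$; all other structure constants arbitrary subject only to ( * ) and anticommutativity. *)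

theory Defs
  imports Complex_Main
begin

text \<open>Structure constants: a point is a function c :: nat \<times> nat \<times> nat \<Rightarrow> complex,
  c (i,j,k) = c_ij^k, required to vanish outside the box {1..n}^3 (so the ambient
  space is a copy of C^(n^3)). Vectors of the n-dimensional space are functions
  nat \<Rightarrow> complex supported on {1..n} (coordinates w.r.t. e_1..e_n).\<close>

type_synonym cpoint = "nat \<times> nat \<times> nat \<Rightarrow> complex"
type_synonym cvec = "nat \<Rightarrow> complex"

definition box :: "nat \<Rightarrow> (nat \<times> nat \<times> nat) set" where
  "box n = {1..n} \<times> {1..n} \<times> {1..n}"

definition ambient :: "nat \<Rightarrow> cpoint set" where
  "ambient n = {c. \<forall>t. t \<notin> box n \<longrightarrow> c t = 0}"

definition vspace :: "nat \<Rightarrow> cvec set" where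
  "vspace n = {x. \<forall>k. k \<notin> {1..n} \<longrightarrow> x k = 0}"

definition amul :: "nat \<Rightarrow> cpoint \<Rightarrow> cvec \<Rightarrow> cvec \<Rightarrow> cvec" where
  "amul n c x y = (\<lambda>k. \<Sum>i=1..n. \<Sum>j=1..n. x i * y j * c (i,j,k))"

inductive_set polyfun :: "nat \<Rightarrow> (cpoint \<Rightarrow> complex) set" for n where
  pconst: "(\<lambda>_. a) \<in> polyfun n"
| pvar: "t \<in> box n \<Longrightarrow> (\<lambda>c. c t) \<in> polyfun n"
| padd: "p \<in> polyfun n \<Longrightarrow> q \<in> polyfun n \<Longrightarrow> (\<lambda>c. p c + q c) \<in> polyfun n"
| pmul: "p \<in> polyfun n \<Longrightarrow> q \<in> polyfun n \<Longrightarrow> (\<lambda>c. p c * q c) \<in> polyfun n"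

definition zclosed :: "nat \<Rightarrow> cpoint set \<Rightarrow> bool" where
  "zclosed n S \<longleftrightarrow> (\<exists>P \<subseteq> polyfun n. S = {c \<in> ambient n. \<forall>p\<in>P. p c = 0})"

definition zclosure :: "nat \<Rightarrow> cpoint set \<Rightarrow> cpoint set" where
  "zclosure n S = \<Inter>{C. zclosed n C \<and> S \<subseteq> C}"

definition zirreducible :: "nat \<Rightarrow> cpoint set \<Rightarrow> bool" where
  "zirreducible n X \<longleftrightarrow> X \<noteq> {} \<and>
     (\<forall>C1 C2. zclosed n C1 \<and> zclosed n C2 \<and> X \<subseteq> C1 \<union> C2 \<longrightarrow> X \<subseteq> C1 \<or> X \<subseteq> C2)"

definition irr_chain :: "nat \<Rightarrow> cpoint set \<Rightarrow> nat \<Rightarrow> (nat \<Rightarrow> cpoint set) \<Rightarrow> bool" where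
  "irr_chain n X d Z \<longleftrightarrow>
     (\<forall>i\<le>d. (\<exists>C. zclosed n C \<and> Z i = X \<inter> C) \<and> zirreducible n (Z i)) \<and>
     (\<forall>i<d. Z i \<subset> Z (Suc i))"

definition has_dim :: "nat \<Rightarrow> cpoint set \<Rightarrow> nat \<Rightarrow> bool" where
  "has_dim n X d \<longleftrightarrow> (\<exists>Z. irr_chain n X d Z) \<and> (\<forall>e Z. irr_chain n X e Z \<longrightarrow> e \<le> d)"

text \<open>c' is the structure-constant tensor of the algebra c in the new basis
  f_i = \<Sum>_l g_li e_l, for an invertible matrix g.\<close>
definition orbit :: "nat \<Rightarrow> cpoint \<Rightarrow> cpoint set" where
  "orbit n c = {c' \<in> ambient n. \<exists>g h :: nat \<Rightarrow> nat \<Rightarrow> complex.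
      (\<forall>i\<in>{1..n}. \<forall>j\<in>{1..n}. (\<Sum>l=1..n. g i l * h l j) = (if i = j then 1 else 0)) \<and>
      (\<forall>i\<in>{1..n}. \<forall>j\<in>{1..n}. (\<Sum>l=1..n. h i l * g l j) = (if i = j then 1 else 0)) \<and>
      (\<forall>i\<in>{1..n}. \<forall>j\<in>{1..n}. \<forall>m\<in>{1..n}.
         (\<Sum>k=1..n. c' (i,j,k) * g m k) = (\<Sum>l=1..n. \<Sum>p=1..n. g l i * g p j * c (l,p,m)))}"

definition anticomm :: "nat \<Rightarrow> cpoint \<Rightarrow> bool" where
  "anticomm n c \<longleftrightarrow> (\<forall>x\<in>vspace n. \<forall>y\<in>vspace n. amul n c x y = (\<lambda>k. - amul n c y x k))"

text \<open>powset n c contains the pairs (k, v) with v \<in> N^k: the smallest family of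
  subspaces with N^1 = N and N^i N^j \<subseteq> N^(i+j), i.e. N^(k+1) = \<Sum>_{i=1..k} N^i N^(k+1-i).\<close>
inductive_set powset :: "nat \<Rightarrow> cpoint \<Rightarrow> (nat \<times> cvec) set" for n c where
  base: "x \<in> vspace n \<Longrightarrow> (1, x) \<in> powset n c"
| zero: "k \<ge> 1 \<Longrightarrow> (k, \<lambda>_. 0) \<in> powset n c"
| prod: "(i, x) \<in> powset n c \<Longrightarrow> (j, y) \<in> powset n c \<Longrightarrow> i \<ge> 1 \<Longrightarrow> j \<ge> 1 \<Longrightarrow>
         (i + j, amul n c x y) \<in> powset n c"
| lin: "(k, x) \<in> powset n c \<Longrightarrow> (k, y) \<in> powset n c \<Longrightarrow>
         (k, \<lambda>m. a * x m + y m) \<in> powset n c"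

definition apow :: "nat \<Rightarrow> cpoint \<Rightarrow> nat \<Rightarrow> cvec set" where
  "apow n c k = {x. (k, x) \<in> powset n c}"

definition nilpotent_alg :: "nat \<Rightarrow> cpoint \<Rightarrow> bool" where
  "nilpotent_alg n c \<longleftrightarrow> (\<exists>k\<ge>1. apow n c k = {\<lambda>_. 0})"

definition AN :: "nat \<Rightarrow> cpoint set" where
  "AN n = {c \<in> ambient n. anticomm n c \<and> nilpotent_alg n c}"

definition Tfam :: "nat \<Rightarrow> cpoint set" where
  "Tfam n = {c \<in> ambient n. anticomm n c \<and>
     (\<forall>i j k. k \<le> max i j \<longrightarrow> c (i,j,k) = 0) \<and>
     (\<forall>i k. 1 \<le> i \<and> i \<le> n - 2 \<longrightarrow> c (i, i+1, k) = (if k = i + 2 then 1 else 0)) \<and>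
     (\<forall>i. 4 \<le> i \<and> i \<le> n - 2 \<longrightarrow> c (1, i, i+2) = 0 \<and> c (2, i, i+2) = 0) \<and>
     c (1,3,4) = 0 \<and> c (1,4,5) = 0 \<and> c (2,4,5) = 0 \<and> c (1,5,6) = 0 \<and> c (2,5,6) = 0 \<and>
     c (1,3,6) = 0 \<and> c (1,3,5) \<noteq> 0 \<and> c (3,5,6) = 1 \<and>
     (n \<ge> 7 \<longrightarrow> c (4,6,7) = 1)}"

end

theory Submission
  imports Defs "Jordan_Normal_Form.Determinant" "HOL-Library.Function_Algebras"
begin

text \<open>An anticommutative algebra is nilpotent iff in a suitable basis its structure constants are
  strictly triangular (condition (*)), and this is in turn equivalent to the vanishing of all
  \<open>n\<close>-fold left products, a polynomial condition. Hence the variety is the closed set obtained by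
  moving the linear space \<open>tri n\<close> of triangular structures around by \<open>GL_n\<close>. Any two of its points
  lie on a rational curve contained in it, so it is irreducible.

  The stabilizer of the flag \<open>V_1 > V_3 > V_4 > ... > V_n\<close> (without \<open>V_2\<close>) preserves \<open>tri n\<close>, so
  unipotent matrices whose entry (1,2) vanishes, acting on \<open>tri n\<close>, already give a dense subset,
  parametrized by an affine space of dimension \<open>binom(n+1,3) - 1\<close>. A chain of irreducible closed
  sets of length \<open>e\<close> yields \<open>e\<close> algebraically independent functions, and counting monomials bounds
  \<open>e\<close> by the number of parameters. Conversely the parametrization is an immersion at the origin,
  so the closures of the images of the coordinate subspaces form a strict chain.

  For genericity, \<open>f_1, f_2\<close> together with \<open>f_(i+2) = f_i f_(i+1)\<close> form a basis for generic
  \<open>f_1, f_2\<close>; successive changes of \<open>f_1, f_2\<close> then bring a generic structure into \<open>Tfam n\<close>.\<close>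

section \<open>Matrices indexed by 1..n\<close>

text \<open>The -1 in the count is the lost entry (1,2): \<open>tri n\<close> has binom(n,3) free
  constants and the unipotent part binom(n,2) - 1, together (n^3 - n - 6)/6, which factors as in the
  theorem. V_2 may be left out because anticommutativity alone puts every product into V_3. The
  parametrization is centred at the algebra with e_i e_(i+1) = e_(i+2). Around the zero algebra,
  which every base change fixes, the unipotent parameters would be invisible to first order; here
  e_(m-2) e_(m-1) = e_m displays the whole column m of the matrix. The obstacle to genericity is
  that some normalizations need certain constants not to vanish, and such open conditions would have
  to be followed through all later substitutions. The argument therefore runs backwards on an
  arbitrary closed set C that contains the family and is stable under base change: C is shown to
  contain ever larger sets of triangular structures. An isomorphism transports membership in C, and
  a non-vanishing condition is dropped by moving along a line that keeps the equations secured so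
  far.\<close>

definition ginv :: "nat \<Rightarrow> (nat \<Rightarrow> nat \<Rightarrow> complex) \<Rightarrow> (nat \<Rightarrow> nat \<Rightarrow> complex) \<Rightarrow> bool" where
  "ginv n g h \<longleftrightarrow>
     (\<forall>i\<in>{1..n}. \<forall>j\<in>{1..n}. (\<Sum>l=1..n. g i l * h l j) = (if i = j then 1 else 0)) \<and>
     (\<forall>i\<in>{1..n}. \<forall>j\<in>{1..n}. (\<Sum>l=1..n. h i l * g l j) = (if i = j then 1 else 0))"

definition to_mat :: "nat \<Rightarrow> (nat \<Rightarrow> nat \<Rightarrow> 'a) \<Rightarrow> 'a mat" where
  "to_mat n A = mat n n (\<lambda>(i,j). A (Suc i) (Suc j))"

lemma to_mat_carrier [simp]: "to_mat n A \<in> carrier_mat n n"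
  by (simp add: to_mat_def)

lemma to_mat_times:
  fixes A B :: "nat \<Rightarrow> nat \<Rightarrow> 'a::comm_ring_1"
  assumes "i < n" "j < n"
  shows "(to_mat n A * to_mat n B) $$ (i,j) = (\<Sum>l=1..n. A (Suc i) l * B l (Suc j))"
  using assms
  by (simp add: to_mat_def scalar_prod_def sum.atLeast1_atMost_eq atLeast0LessThan)

lemma to_mat_times_eq_one_iff:
  fixes A B :: "nat \<Rightarrow> nat \<Rightarrow> 'a::comm_ring_1"
  shows "to_mat n A * to_mat n B = 1\<^sub>m n \<longleftrightarrow>
    (\<forall>i\<in>{1..n}. \<forall>j\<in>{1..n}. (\<Sum>l=1..n. A i l * B l j) = (if i = j then 1 else 0))"
    (is "?L \<longleftrightarrow> ?R")
proof
  assume L: ?L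
  show ?R
  proof (intro ballI)
    fix i j assume "i \<in> {1..n}" "j \<in> {1..n}"
    then obtain i' j' where "i = Suc i'" "j = Suc j'" "i' < n" "j' < n"
      by (cases i; cases j) auto
    then show "(\<Sum>l=1..n. A i l * B l j) = (if i = j then 1 else 0)"
      using to_mat_times[of i' n j' A B] L by simp
  qed
next
  assume R: ?R
  show ?L
  proof (rule eq_matI)
    fix i j assume "i < dim_row (1\<^sub>m n :: 'a mat)" "j < dim_col (1\<^sub>m n :: 'a mat)"
    then have ij: "i < n" "j < n" by auto
    then have "Suc i \<in> {1..n}" "Suc j \<in> {1..n}" by auto
    with R have "(\<Sum>l=1..n. A (Suc i) l * B l (Suc j)) = (if i = j then 1 else 0)"
      by auto
    then show "(to_mat n A * to_mat n B) $$ (i,j) = 1\<^sub>m n $$ (i,j)"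
      using to_mat_times[OF ij, of A B] ij by auto
  qed (auto simp: to_mat_def)
qed

lemma right_inverse_imp_ginv:
  assumes "\<forall>i\<in>{1..n}. \<forall>j\<in>{1..n}. (\<Sum>l=1..n. g i l * h l j) = (if i = j then 1 else 0)"
  shows "ginv n g h"
proof -
  have "to_mat n g * to_mat n h = 1\<^sub>m n"
    using assms by (simp add: to_mat_times_eq_one_iff)
  then have "to_mat n h * to_mat n g = 1\<^sub>m n"
    by (rule mat_mult_left_right_inverse[OF to_mat_carrier to_mat_carrier])
  then show ?thesis
    using assms unfolding ginv_def to_mat_times_eq_one_iff by blast
qed

lemma ginv_sym: "ginv n g h \<Longrightarrow> ginv n h g"
  by (simp add: ginv_def)

text \<open>Here \<open>d\<close> is the determinant and \<open>B\<close> the adjugate, both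
  polynomial in s. The statement hides determinants: all that is used later is that the inverse is
  B/d and that d is nonzero wherever an inverse exists.\<close>

lemma poly_matrix_adjugate:
  fixes A :: "nat \<Rightarrow> nat \<Rightarrow> complex poly"
  shows "\<exists>d B. (\<forall>s. \<forall>i\<in>{1..n}. \<forall>j\<in>{1..n}.
       (\<Sum>l=1..n. poly (A i l) s * poly (B l j) s) = (if i = j then poly d s else 0)) \<and>
    (\<forall>s C. (\<forall>i\<in>{1..n}. \<forall>j\<in>{1..n}. (\<Sum>l=1..n. poly (A i l) s * C l j) = (if i = j then 1 else 0)) \<longrightarrow>
       poly d s \<noteq> 0)"
proof -
  define M where "M = to_mat n A"
  have M: "M \<in> carrier_mat n n" by (simp add: M_def)
  define B where "B = (\<lambda>i j. adj_mat M $$ (i - 1, j - 1))"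
  define d where "d = det M"
  have aM: "adj_mat M \<in> carrier_mat n n" by (rule adj_mat(1)[OF M])
  have tB: "to_mat n B = adj_mat M"
    by (rule eq_matI) (use aM in \<open>auto simp: to_mat_def B_def\<close>)
  show ?thesis
  proof (rule exI[of _ d], rule exI[of _ B], intro conjI allI ballI impI)
    fix s i j assume ij: "i \<in> {1..n}" "j \<in> {1..n}"
    then obtain i' j' where i': "i = Suc i'" "j = Suc j'" "i' < n" "j' < n"
      by (cases i; cases j) auto
    have "(\<Sum>l=1..n. A i l * B l j) = (to_mat n A * to_mat n B) $$ (i', j')"
      using to_mat_times[of i' n j' A B] i' by simp
    also have "\<dots> = (if i = j then d else 0)"
      using adj_mat(2)[OF M] i' unfolding tB by (auto simp: M_def d_def)
    finally have "poly (\<Sum>l=1..n. A i l * B l j) s = poly (if i = j then d else 0) s" by simp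
    then show "(\<Sum>l=1..n. poly (A i l) s * poly (B l j) s) = (if i = j then poly d s else 0)"
      by (auto simp: poly_sum split: if_splits)
  next
    fix s C
    assume C: "\<forall>i\<in>{1..n}. \<forall>j\<in>{1..n}. (\<Sum>l=1..n. poly (A i l) s * C l j) = (if i = j then 1 else 0)"
    \<comment> \<open>Evaluation at s is a ring homomorphism, so it commutes with the
      determinant.\<close>
    interpret h: comm_ring_hom "\<lambda>p :: complex poly. poly p s"
      by unfold_locales auto
    have mm: "map_mat (\<lambda>p. poly p s) M = to_mat n (\<lambda>i j. poly (A i j) s)"
      by (rule eq_matI) (auto simp: M_def to_mat_def)
    have "to_mat n (\<lambda>i j. poly (A i j) s) * to_mat n C = 1\<^sub>m n"
      using C by (simp add: to_mat_times_eq_one_iff)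
    then have "det (to_mat n (\<lambda>i j. poly (A i j) s)) * det (to_mat n C) = 1"
      by (metis det_mult det_one to_mat_carrier)
    moreover have "det (map_mat (\<lambda>p. poly p s) M) = poly d s"
      unfolding d_def by (rule h.hom_det)
    ultimately show "poly d s \<noteq> 0"
      unfolding mm by auto
  qed
qed

lemma trivial_kernel_imp_ginv:
  fixes g :: "nat \<Rightarrow> nat \<Rightarrow> complex"
  assumes ker: "\<And>v. (\<forall>l\<in>{1..n}. (\<Sum>i=1..n. g l i * v i) = 0) \<Longrightarrow> \<forall>i\<in>{1..n}. v i = 0"
  obtains h where "ginv n g h"
proof -
  define M where "M = to_mat n g"
  have M: "M \<in> carrier_mat n n" by (simp add: M_def)
  have "det M \<noteq> 0"
  proof
    assume "det M = 0"
    then obtain v where v: "v \<in> carrier_vec n" "v \<noteq> 0\<^sub>v n" "M *\<^sub>v v = 0\<^sub>v n"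
      using det_0_iff_vec_prod_zero[OF M] by auto
    have "\<forall>l\<in>{1..n}. (\<Sum>i=1..n. g l i * v $ (i - 1)) = 0"
    proof
      fix l assume "l \<in> {1..n}"
      then obtain l' where l': "l = Suc l'" "l' < n" by (cases l) auto
      have "(M *\<^sub>v v) $ l' = 0" using v(3) l' by simp
      then show "(\<Sum>i=1..n. g l i * v $ (i - 1)) = 0"
        using l' v(1) by (simp add: M_def to_mat_def scalar_prod_def sum.atLeast1_atMost_eq atLeast0LessThan)
    qed
    from ker[OF this] have "v $ i = 0" if "i < n" for i
      using that by (auto dest: bspec[of _ _ "Suc i"])
    then have "v = 0\<^sub>v n" using v(1) by auto
    then show False using v(2) by simp
  qed
  define h where "h = (\<lambda>i j. adj_mat M $$ (i - 1, j - 1) / det M)"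
  have aM: "adj_mat M \<in> carrier_mat n n" by (rule adj_mat(1)[OF M])
  have "to_mat n h = inverse (det M) \<cdot>\<^sub>m adj_mat M"
    by (rule eq_matI) (use aM in \<open>auto simp: to_mat_def h_def divide_inverse\<close>)
  moreover have "M * (inverse (det M) \<cdot>\<^sub>m adj_mat M) = 1\<^sub>m n"
    using adj_mat(2)[OF M] \<open>det M \<noteq> 0\<close> mult_smult_distrib[OF M aM]
    by (auto intro!: eq_matI)
  ultimately have "ginv n g h"
    using right_inverse_imp_ginv[of n g h] unfolding M_def to_mat_times_eq_one_iff[symmetric] by simp
  then show thesis by (rule that)
qed

section \<open>Change of basis\<close>

definition mv :: "nat \<Rightarrow> (nat \<Rightarrow> nat \<Rightarrow> complex) \<Rightarrow> cvec \<Rightarrow> cvec" where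
  "mv n g x = (\<lambda>l. if l \<in> {1..n} then \<Sum>i=1..n. g l i * x i else 0)"

text \<open>\<open>act n c g h\<close> with \<open>h\<close> inverse to \<open>g\<close> is \<open>c\<close> in the basis \<open>f_i = sum_l g_li e_l\<close>;
  this is a right action.\<close>

definition act :: "nat \<Rightarrow> cpoint \<Rightarrow> (nat \<Rightarrow> nat \<Rightarrow> complex) \<Rightarrow> (nat \<Rightarrow> nat \<Rightarrow> complex) \<Rightarrow> cpoint" where
  "act n c g h = (\<lambda>(i,j,k). if (i,j,k) \<in> box n
     then \<Sum>m=1..n. h k m * (\<Sum>l=1..n. \<Sum>p=1..n. g l i * g p j * c (l,p,m)) else 0)"

definition mm :: "nat \<Rightarrow> (nat \<Rightarrow> nat \<Rightarrow> complex) \<Rightarrow> (nat \<Rightarrow> nat \<Rightarrow> complex) \<Rightarrow> nat \<Rightarrow> nat \<Rightarrow> complex" where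
  "mm n a b = (\<lambda>i j. \<Sum>l=1..n. a i l * b l j)"

definition ev :: "nat \<Rightarrow> cvec" where
  "ev i = (\<lambda>k. if k = i then 1 else 0)"

lemma mv_vspace [simp]: "mv n g x \<in> vspace n"
  by (simp add: mv_def vspace_def)

lemma vspace_zero [simp]: "(\<lambda>_. 0) \<in> vspace n"
  by (simp add: vspace_def)

lemma ev_vspace: "i \<in> {1..n} \<Longrightarrow> ev i \<in> vspace n"
  by (auto simp: ev_def vspace_def)

lemma amul_vspace: "c \<in> ambient n \<Longrightarrow> amul n c x y \<in> vspace n"
  by (auto simp: amul_def vspace_def ambient_def box_def)

lemma vspace_eqI: "x \<in> vspace n \<Longrightarrow> y \<in> vspace n \<Longrightarrow> (\<And>k. k \<in> {1..n} \<Longrightarrow> x k = y k) \<Longrightarrow> x = y"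
  by (rule ext) (metis (mono_tags, lifting) mem_Collect_eq vspace_def)

lemma mv_mv: "mv n a (mv n b x) = mv n (mm n a b) x"
proof -
  have "(\<Sum>i=1..n. a l i * (\<Sum>k=1..n. b i k * x k)) = (\<Sum>i=1..n. (\<Sum>k=1..n. a l k * b k i) * x i)" for l
    unfolding sum_distrib_left sum_distrib_right
    by (subst sum.swap) (simp add: mult.assoc)
  then show ?thesis by (auto simp: mv_def mm_def intro!: ext)
qed

lemma mv_id:
  assumes "\<forall>i\<in>{1..n}. \<forall>j\<in>{1..n}. a i j = (if i = j then 1 else 0)" "x \<in> vspace n"
  shows "mv n a x = x"
proof (rule vspace_eqI[OF mv_vspace assms(2)])
  fix k assume k: "k \<in> {1..n}"
  have "(\<Sum>i=1..n. a k i * x i) = (\<Sum>i=1..n. if k = i then x i else 0)"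
    by (rule sum.cong) (use assms(1) k in auto)
  also have "\<dots> = x k" using k by simp
  finally show "mv n a x k = x k" using k by (simp add: mv_def)
qed

lemma ginv_mv:
  assumes "ginv n g h" "x \<in> vspace n"
  shows "mv n g (mv n h x) = x" "mv n h (mv n g x) = x"
  using assms unfolding mv_mv by (auto intro!: mv_id simp: ginv_def mm_def)

lemma mv_ev: "i \<in> {1..n} \<Longrightarrow> mv n g (ev i) = (\<lambda>l. if l \<in> {1..n} then g l i else 0)"
proof (rule ext)
  fix l assume i: "i \<in> {1..n}"
  have "(\<Sum>j=1..n. g l j * ev i j) = (\<Sum>j=1..n. if j = i then g l j else 0)"
    by (rule sum.cong) (auto simp: ev_def)
  then show "mv n g (ev i) l = (if l \<in> {1..n} then g l i else 0)" using i by (simp add: mv_def)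
qed

lemma ginv_mm: "ginv n g h \<Longrightarrow> ginv n g' h' \<Longrightarrow> ginv n (mm n g g') (mm n h' h)"
proof (rule right_inverse_imp_ginv, intro ballI)
  fix i j assume gh: "ginv n g h" "ginv n g' h'" and ij: "i \<in> {1..n}" "j \<in> {1..n}"
  have "(\<Sum>l=1..n. mm n g g' i l * mm n h' h l j) = mv n (mm n (mm n g g') (mm n h' h)) (ev j) i"
    using ij by (simp add: mv_ev mm_def[of n "mm n g g'"])
  also have "\<dots> = ev j i"
    using gh ij by (simp add: mv_mv[symmetric] ginv_mv(1)[OF gh(1)] ginv_mv(1)[OF gh(2)] ev_vspace)
  finally show "(\<Sum>l=1..n. mm n g g' i l * mm n h' h l j) = (if i = j then 1 else 0)"
    by (simp add: ev_def)
qed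

section \<open>The action on structure tensors\<close>

lemma act_ambient [simp]: "act n c g h \<in> ambient n"
  by (auto simp: ambient_def act_def)

lemma amul_ev:
  assumes "i \<in> {1..n}" "j \<in> {1..n}"
  shows "amul n c (ev i) (ev j) k = c (i,j,k)"
proof -
  have "amul n c (ev i) (ev j) k = (\<Sum>a=1..n. \<Sum>b=1..n. if a = i then (if b = j then c (i,j,k) else 0) else 0)"
    unfolding amul_def by (intro sum.cong refl) (auto simp: ev_def)
  also have "\<dots> = (\<Sum>a=1..n. if a = i then \<Sum>b=1..n. (if b = j then c (i,j,k) else 0) else 0)"
    by (intro sum.cong refl) auto
  also have "\<dots> = c (i,j,k)" using assms by simp
  finally show ?thesis .
qed

lemma swap3:
  "(\<Sum>p\<in>A. \<Sum>i\<in>B. \<Sum>j\<in>C. F i j p) = (\<Sum>i\<in>B. \<Sum>j\<in>C. \<Sum>p\<in>A. F i j p :: complex)"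
  by (subst sum.swap, rule sum.cong[OF refl], rule sum.swap)

text \<open>The coordinate-free form of a base change. Together with \<open>ambient_amul_eqI\<close>
  it reduces the composition and inversion laws of \<open>act\<close> to those of matrices acting on
  vectors, so that the multiple sums are rearranged only here.\<close>

lemma amul_act:
  "amul n (act n c g h) x y = mv n h (amul n c (mv n g x) (mv n g y))"
proof (rule ext)
  fix k
  show "amul n (act n c g h) x y k = mv n h (amul n c (mv n g x) (mv n g y)) k"
  proof (cases "k \<in> {1..n}")
    case False
    then show ?thesis by (auto simp: amul_def act_def mv_def box_def)
  next
    case k: True
    have 0: "(\<Sum>i=1..n. g l i * x i) * (\<Sum>j=1..n. g p j * y j) * a =
        (\<Sum>i=1..n. \<Sum>j=1..n. x i * (y j * (g l i * (g p j * a))))" for l p a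
      by (subst sum_product, simp only: sum_distrib_right) (simp add: mult_ac)
    have "mv n h (amul n c (mv n g x) (mv n g y)) k =
      (\<Sum>m=1..n. h k m * (\<Sum>l=1..n. \<Sum>p=1..n. (\<Sum>i=1..n. g l i * x i) * (\<Sum>j=1..n. g p j * y j) * c (l,p,m)))"
      using k by (simp add: mv_def amul_def)
    also have "\<dots> = (\<Sum>m=1..n. \<Sum>l=1..n. \<Sum>p=1..n. \<Sum>i=1..n. \<Sum>j=1..n.
        x i * y j * (h k m * (g l i * g p j * c (l,p,m))))"
      by (intro sum.cong refl, simp only: 0, simp only: sum_distrib_left, simp only: mult_ac)
    also have "\<dots> = (\<Sum>m=1..n. \<Sum>l=1..n. \<Sum>i=1..n. \<Sum>j=1..n. \<Sum>p=1..n.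
        x i * y j * (h k m * (g l i * g p j * c (l,p,m))))"
      by (intro sum.cong refl swap3)
    also have "\<dots> = (\<Sum>m=1..n. \<Sum>i=1..n. \<Sum>j=1..n. \<Sum>l=1..n. \<Sum>p=1..n.
        x i * y j * (h k m * (g l i * g p j * c (l,p,m))))"
      by (intro sum.cong refl swap3)
    also have "\<dots> = (\<Sum>i=1..n. \<Sum>j=1..n. \<Sum>m=1..n. \<Sum>l=1..n. \<Sum>p=1..n.
        x i * y j * (h k m * (g l i * g p j * c (l,p,m))))"
      by (rule swap3)
    also have "\<dots> = amul n (act n c g h) x y k"
      unfolding amul_def act_def using k
      by (intro sum.cong refl) (simp add: box_def sum_distrib_left)
    finally show ?thesis by simp
  qed
qed

lemma ambient_amul_eqI:
  assumes "c \<in> ambient n" "c' \<in> ambient n"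
    "\<And>x y. x \<in> vspace n \<Longrightarrow> y \<in> vspace n \<Longrightarrow> amul n c x y = amul n c' x y"
  shows "c = c'"
proof (rule ext)
  fix t :: "nat \<times> nat \<times> nat"
  obtain i j k where t: "t = (i,j,k)" by (cases t)
  show "c t = c' t"
  proof (cases "i \<in> {1..n} \<and> j \<in> {1..n}")
    case True
    then show ?thesis
      using assms(3)[of "ev i" "ev j"] by (metis amul_ev ev_vspace t)
  next
    case False
    then show ?thesis using assms(1,2) t by (auto simp: ambient_def box_def)
  qed
qed

lemma act_act: "act n (act n c g h) g' h' = act n c (mm n g g') (mm n h' h)"
  by (rule ambient_amul_eqI[where n = n]) (simp_all add: amul_act mv_mv)

lemma act_inverse:
  assumes "c \<in> ambient n" "ginv n g h"
  shows "act n (act n c g h) h g = c"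
proof (rule ambient_amul_eqI[where n = n])
  fix x y assume "x \<in> vspace n" "y \<in> vspace n"
  then show "amul n (act n (act n c g h) h g) x y = amul n c x y"
    by (simp add: amul_act ginv_mv[OF assms(2)] amul_vspace[OF assms(1)])
qed (use assms in auto)

lemma act_id:
  assumes "c \<in> ambient n" "\<forall>i\<in>{1..n}. \<forall>j\<in>{1..n}. a i j = (if i = j then 1 else 0)"
    "\<forall>i\<in>{1..n}. \<forall>j\<in>{1..n}. b i j = (if i = j then 1 else 0)"
  shows "act n c a b = c"
  by (rule ambient_amul_eqI[where n = n])
     (use assms in \<open>auto simp: amul_act mv_id amul_vspace\<close>)

lemma orbit_iff:
  "c' \<in> orbit n c \<longleftrightarrow> c' \<in> ambient n \<and> (\<exists>g h. ginv n g h \<and>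
     (\<forall>i\<in>{1..n}. \<forall>j\<in>{1..n}. \<forall>m\<in>{1..n}.
       (\<Sum>k=1..n. c' (i,j,k) * g m k) = (\<Sum>l=1..n. \<Sum>p=1..n. g l i * g p j * c (l,p,m))))"
  unfolding orbit_def ginv_def mem_Collect_eq conj_assoc by (rule refl)

text \<open>The defining relation of \<open>orbit\<close> keeps \<open>g\<close> on the output side;
  applying the inverse solves it for the new constants.\<close>

lemma orbit_eq: "orbit n c = {act n c g h | g h. ginv n g h}"
proof (intro Set.set_eqI iffI)
  fix c' assume "c' \<in> orbit n c"
  then obtain g h where c': "c' \<in> ambient n" and gh: "ginv n g h"
    and eq: "\<forall>i\<in>{1..n}. \<forall>j\<in>{1..n}. \<forall>m\<in>{1..n}.
         (\<Sum>k=1..n. c' (i,j,k) * g m k) = (\<Sum>l=1..n. \<Sum>p=1..n. g l i * g p j * c (l,p,m))"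
    unfolding orbit_iff by blast
  have "c' = act n c g h"
  proof (rule ext)
    fix t :: "nat \<times> nat \<times> nat"
    obtain i j k where t: "t = (i,j,k)" by (cases t)
    show "c' t = act n c g h t"
    proof (cases "t \<in> box n")
      case True
      then have ijk: "i \<in> {1..n}" "j \<in> {1..n}" "k \<in> {1..n}" by (auto simp: t box_def)
      have "act n c g h t = (\<Sum>m=1..n. h k m * (\<Sum>r=1..n. c' (i,j,r) * g m r))"
        using True ijk eq by (simp add: act_def t)
      also have "\<dots> = mv n h (mv n g (\<lambda>r. c' (i,j,r))) k"
        using ijk by (simp add: mv_def mult.commute)
      also have "mv n h (mv n g (\<lambda>r. c' (i,j,r))) = (\<lambda>r. c' (i,j,r))"
        using c' by (intro ginv_mv(2)[OF gh]) (auto simp: vspace_def ambient_def box_def)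
      finally show ?thesis by (simp add: t)
    qed (use c' in \<open>auto simp: ambient_def act_def t\<close>)
  qed
  then show "c' \<in> {act n c g h | g h. ginv n g h}" using gh by blast
next
  fix c' assume "c' \<in> {act n c g h | g h. ginv n g h}"
  then obtain g h where gh: "ginv n g h" and c': "c' = act n c g h" by blast
  have eq: "\<forall>i\<in>{1..n}. \<forall>j\<in>{1..n}. \<forall>m\<in>{1..n}.
      (\<Sum>k=1..n. c' (i,j,k) * g m k) = (\<Sum>l=1..n. \<Sum>p=1..n. g l i * g p j * c (l,p,m))"
  proof (intro ballI)
    fix i j m assume ijm: "i \<in> {1..n}" "j \<in> {1..n}" "m \<in> {1..n}"
    define y where "y = (\<lambda>m. if m \<in> {1..n} then \<Sum>l=1..n. \<Sum>p=1..n. g l i * g p j * c (l,p,m) else 0)"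
    have y: "y \<in> vspace n" by (auto simp: y_def vspace_def)
    have "(\<Sum>k=1..n. c' (i,j,k) * g m k) = (\<Sum>k=1..n. g m k * mv n h y k)"
      using ijm by (intro sum.cong refl) (simp add: c' act_def box_def mv_def y_def mult.commute)
    also have "\<dots> = mv n g (mv n h y) m" using ijm by (simp add: mv_def[of n g])
    also have "\<dots> = y m" by (simp add: ginv_mv(1)[OF gh y])
    finally show "(\<Sum>k=1..n. c' (i,j,k) * g m k) = (\<Sum>l=1..n. \<Sum>p=1..n. g l i * g p j * c (l,p,m))"
      using ijm by (simp add: y_def)
  qed
  show "c' \<in> orbit n c"
    unfolding orbit_iff using c' gh eq by auto
qed

section \<open>Flags and strictly triangular structures\<close>

text \<open>This is V_k, the span of e_k, ..., e_n. Since indices start at 1, both k = 0 and k = 1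
  give the whole space.\<close>

definition vfl :: "nat \<Rightarrow> nat \<Rightarrow> cvec set" where
  "vfl n k = {x \<in> vspace n. \<forall>i<k. x i = 0}"

definition tri :: "nat \<Rightarrow> cpoint set" where
  "tri n = {c \<in> ambient n. (\<forall>i j k. c (i,j,k) = - c (j,i,k)) \<and> (\<forall>i j k. k \<le> max i j \<longrightarrow> c (i,j,k) = 0)}"

text \<open>Linear algebra of functions is needed twice: for vectors, in the construction of a
  triangular basis, and for spaces of polynomial functions, in the monomial count.\<close>

interpretation fv: vector_space "\<lambda>(a::complex) (f :: 'a \<Rightarrow> complex). (\<lambda>x. a * f x)"
  by unfold_locales (auto simp: fun_eq_iff algebra_simps)

lemma tri_ambient: "c \<in> tri n \<Longrightarrow> c \<in> ambient n"
  by (simp add: tri_def)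

lemma tri_anti: "c \<in> tri n \<Longrightarrow> c (i,j,k) = - c (j,i,k)"
  unfolding tri_def by blast

lemma tri_zero: "c \<in> tri n \<Longrightarrow> k \<le> i \<or> k \<le> j \<Longrightarrow> c (i,j,k) = 0"
  unfolding tri_def using le_max_iff_disj by blast

lemma tri_diag: "c \<in> tri n \<Longrightarrow> c (i,i,k) = 0"
  using tri_anti[of c n i i k] by (simp add: equal_neg_zero)

lemma ambient_zero: "c \<in> ambient n \<Longrightarrow> t \<notin> box n \<Longrightarrow> c t = 0"
  unfolding ambient_def by blast

lemma vfl_vspace: "x \<in> vfl n k \<Longrightarrow> x \<in> vspace n"
  by (simp add: vfl_def)

lemma vfl_zero: "x \<in> vfl n k \<Longrightarrow> i < k \<Longrightarrow> x i = 0"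
  by (simp add: vfl_def)

lemma vfl_mono: "k \<le> l \<Longrightarrow> vfl n l \<subseteq> vfl n k"
  by (auto simp: vfl_def)

lemma vspace_eq_vfl: "vspace n = vfl n (Suc 0)"
  by (auto simp: vfl_def vspace_def)

lemma vfl_trivial: "n < k \<Longrightarrow> x \<in> vfl n k \<Longrightarrow> x = (\<lambda>_. 0)"
  unfolding vfl_def vspace_def by (rule ext) (metis (mono_tags, lifting) atLeastAtMost_iff linorder_not_less mem_Collect_eq order_less_le_trans)

lemma ev_vfl: "i \<in> {1..n} \<Longrightarrow> k \<le> i \<Longrightarrow> ev i \<in> vfl n k"
  using ev_vspace by (auto simp: vfl_def ev_def)

lemma vspace_comb: "x \<in> vspace n \<Longrightarrow> y \<in> vspace n \<Longrightarrow> (\<lambda>m. a * x m + y m) \<in> vspace n"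
  by (auto simp: vspace_def)

lemma vfl_comb: "x \<in> vfl n k \<Longrightarrow> y \<in> vfl n k \<Longrightarrow> (\<lambda>m. a * x m + y m) \<in> vfl n k"
  by (auto simp: vfl_def vspace_def)

lemma mv_zero [simp]: "mv n g (\<lambda>_. 0) = (\<lambda>_. 0)"
  by (auto simp: mv_def)

lemma mv_comb: "mv n g (\<lambda>m. a * x m + y m) = (\<lambda>m. a * mv n g x m + mv n g y m)"
  by (auto simp: mv_def sum.distrib sum_distrib_left algebra_simps intro!: ext)

lemma subspace_mv_vfl: "fv.subspace {v. mv n h v \<in> vfl n k}"
proof (rule fv.subspaceI)
  fix x y assume "x \<in> {v. mv n h v \<in> vfl n k}" "y \<in> {v. mv n h v \<in> vfl n k}"
  then show "x + y \<in> {v. mv n h v \<in> vfl n k}"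
    using vfl_comb[of "mv n h x" n k "mv n h y" 1] mv_comb[of n h 1 x y] by (simp add: plus_fun_def)
next
  fix a x assume "x \<in> {v. mv n h v \<in> vfl n k}"
  then show "(\<lambda>m. a * x m) \<in> {v. mv n h v \<in> vfl n k}"
    using vfl_comb[of "mv n h x" n k "\<lambda>_. 0" a] mv_comb[of n h a x "\<lambda>_. 0"] by (simp add: vfl_def)
qed (simp add: zero_fun_def vfl_def)

lemma amul_comb_left: "amul n c (\<lambda>m. a * x m + y m) z = (\<lambda>m. a * amul n c x z m + amul n c y z m)"
  by (auto simp: amul_def sum.distrib sum_distrib_left algebra_simps intro!: ext)

lemma amul_comb_right: "amul n c z (\<lambda>m. a * x m + y m) = (\<lambda>m. a * amul n c z x m + amul n c z y m)"
  by (auto simp: amul_def sum.distrib sum_distrib_left algebra_simps intro!: ext)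

lemma amul_anti:
  assumes "\<And>i j k. c (i,j,k) = - c (j,i,k)"
  shows "amul n c x y = (\<lambda>k. - amul n c y x k)"
proof (rule ext)
  fix k
  have "amul n c x y k = (\<Sum>j=1..n. \<Sum>i=1..n. x i * y j * c (i,j,k))"
    unfolding amul_def by (rule sum.swap)
  also have "\<dots> = (\<Sum>j=1..n. \<Sum>i=1..n. - (y j * x i * c (j,i,k)))"
    by (intro sum.cong refl) (subst assms, simp)
  finally show "amul n c x y k = - amul n c y x k"
    by (simp add: amul_def sum_negf)
qed

lemma anticomm_iff:
  assumes "c \<in> ambient n"
  shows "anticomm n c \<longleftrightarrow> (\<forall>i j k. c (i,j,k) = - c (j,i,k))"
proof
  assume a: "anticomm n c"
  show "\<forall>i j k. c (i,j,k) = - c (j,i,k)"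
  proof (intro allI)
    fix i j k
    show "c (i,j,k) = - c (j,i,k)"
    proof (cases "i \<in> {1..n} \<and> j \<in> {1..n}")
      case True
      then have "amul n c (ev i) (ev j) = (\<lambda>k. - amul n c (ev j) (ev i) k)"
        using a ev_vspace unfolding anticomm_def by blast
      then have "amul n c (ev i) (ev j) k = - amul n c (ev j) (ev i) k" by (rule fun_cong)
      then show ?thesis using True by (simp add: amul_ev)
    next
      case False
      then have "(i,j,k) \<notin> box n" "(j,i,k) \<notin> box n" by (auto simp: box_def)
      then show ?thesis using ambient_zero[OF assms] by simp
    qed
  qed
next
  assume "\<forall>i j k. c (i,j,k) = - c (j,i,k)"
  then show "anticomm n c" unfolding anticomm_def by (intro ballI amul_anti) blast
qed

lemma tri_iff: "c \<in> tri n \<longleftrightarrow> c \<in> ambient n \<and> anticomm n c \<and> (\<forall>i j k. k \<le> max i j \<longrightarrow> c (i,j,k) = 0)"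
  using anticomm_iff[of c n] unfolding tri_def by blast

lemma tri_amul_anti: "c \<in> tri n \<Longrightarrow> amul n c x y = (\<lambda>k. - amul n c y x k)"
  by (rule amul_anti) (rule tri_anti)

section \<open>Products along the flag\<close>

lemma tri_mul_right:
  assumes c: "c \<in> tri n" and y: "y \<in> vfl n k"
  shows "amul n c x y \<in> vfl n (Suc k)"
  unfolding vfl_def
proof (intro CollectI conjI allI impI)
  fix r assume r: "r < Suc k"
  show "amul n c x y r = 0"
    unfolding amul_def
  proof (intro sum.neutral ballI)
    fix i j
    show "x i * y j * c (i,j,r) = 0"
      using vfl_zero[OF y, of j] tri_zero[OF c, of r i j] r by (cases "j < k") auto
  qed
qed (rule amul_vspace[OF tri_ambient[OF c]])

lemma tri_mul_left: "c \<in> tri n \<Longrightarrow> x \<in> vfl n k \<Longrightarrow> amul n c x y \<in> vfl n (Suc k)"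
  using tri_mul_right[of c n x k y] tri_amul_anti[of c n x y] by (auto simp: vfl_def vspace_def)

text \<open>A coefficient at e_2 would need i = j = 1, which anticommutativity excludes. This is why
  V_2 need not be preserved by a base change.\<close>

lemma tri_mul_3:
  assumes c: "c \<in> tri n"
  shows "amul n c x y \<in> vfl n 3"
  unfolding vfl_def
proof (intro CollectI conjI allI impI)
  fix r :: nat assume r: "r < 3"
  show "amul n c x y r = 0"
    unfolding amul_def
  proof (intro sum.neutral ballI)
    fix i j assume "i \<in> {1..n}" "j \<in> {1..n}"
    then show "x i * y j * c (i,j,r) = 0"
      using tri_zero[OF c, of r i j] tri_diag[OF c, of i r] r
      by (cases "i = j"; cases "r \<le> i \<or> r \<le> j") auto
  qed
qed (rule amul_vspace[OF tri_ambient[OF c]])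

lemma triI:
  assumes c: "c \<in> ambient n" "anticomm n c"
    and "\<And>i j. i \<in> {1..n} \<Longrightarrow> j \<in> {1..n} \<Longrightarrow> i < j \<Longrightarrow> amul n c (ev i) (ev j) \<in> vfl n (Suc j)"
  shows "c \<in> tri n"
proof -
  have anti: "c (i,j,k) = - c (j,i,k)" for i j k
    using c anticomm_iff by blast
  have lt: "c (i,j,k) = 0" if "k \<le> j" "i < j" for i j k
  proof (cases "i \<in> {1..n} \<and> j \<in> {1..n}")
    case True
    then have "amul n c (ev i) (ev j) k = 0"
      using vfl_zero[OF assms(3)[of i j], of k] that by simp
    then show ?thesis using True by (metis amul_ev)
  qed (use c in \<open>auto simp: ambient_def box_def\<close>)
  have "c (i,j,k) = 0" if "k \<le> max i j" for i j k
  proof (cases i j rule: linorder_cases)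
    case less then show ?thesis using lt that by simp
  next
    case equal then show ?thesis using anti[of i i k] by (simp add: equal_neg_zero)
  next
    case greater then show ?thesis using lt[of k i j] that anti[of i j k] by simp
  qed
  then show ?thesis using c tri_iff by blast
qed

section \<open>Base changes preserving the flag\<close>

lemma anticomm_act: "anticomm n c \<Longrightarrow> anticomm n (act n c g h)"
  unfolding anticomm_def amul_act
  by (metis (no_types, lifting) ext mv_comb[of n h "-1" _ "\<lambda>_. 0"] mv_vspace mult_minus1 add.right_neutral mv_zero)

text \<open>A bijection preserving the flag has an inverse preserving it: the leading block of the
  inverse is a one-sided, hence two-sided, inverse of the leading block.\<close>

lemma ginv_vfl:
  assumes gh: "ginv n g h" and k: "k \<ge> 1"
    and g: "\<And>l i. l \<in> {1..n} \<Longrightarrow> i \<in> {1..n} \<Longrightarrow> l < k \<Longrightarrow> k \<le> i \<Longrightarrow> g l i = 0"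
    and x: "x \<in> vfl n k"
  shows "mv n h x \<in> vfl n k"
proof -
  \<comment> \<open>The leading block has size k - 1, capped at n because k may exceed n.\<close>
  define m where "m = min n (k - 1)"
  have mn: "{1..m} \<subseteq> {1..n}" by (auto simp: m_def)
  have cut: "(\<Sum>i=1..n. g l i * z i) = (\<Sum>i=1..m. g l i * z i)" if "l \<in> {1..m}" for l z
    by (rule sum.mono_neutral_right) (use that g[of l] k in \<open>auto simp: m_def\<close>)
  have "ginv m g h"
  proof (rule right_inverse_imp_ginv, intro ballI)
    fix i j assume ij: "i \<in> {1..m}" "j \<in> {1..m}"
    then show "(\<Sum>l=1..m. g i l * h l j) = (if i = j then 1 else 0)"
      using cut[of i "\<lambda>l. h l j"] gh mn unfolding ginv_def by auto
  qed
  define y where "y = mv n h x"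
  have gy: "mv n g y = x" unfolding y_def by (rule ginv_mv(1)[OF gh vfl_vspace[OF x]])
  define y' where "y' = (\<lambda>i. if i \<in> {1..m} then y i else 0)"
  have "mv m g y' = (\<lambda>_. 0)"
  proof (rule ext)
    fix l
    show "mv m g y' l = 0"
    proof (cases "l \<in> {1..m}")
      case True
      then have "mv m g y' l = (\<Sum>i=1..n. g l i * y i)"
        using cut[of l y] by (simp add: mv_def y'_def)
      also have "\<dots> = x l" using True mn unfolding gy[symmetric] by (auto simp: mv_def)
      also have "\<dots> = 0" using True vfl_zero[OF x] by (auto simp: m_def)
      finally show ?thesis .
    next
      case False
      then show ?thesis by (auto simp: mv_def)
    qed
  qed
  moreover have "y' \<in> vspace m" by (auto simp: y'_def vspace_def)
  ultimately have "y' = (\<lambda>_. 0)"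
    using ginv_mv(2)[OF \<open>ginv m g h\<close>, of y'] by simp
  then have "y i = 0" if "i \<in> {1..m}" for i
    using that by (metis y'_def)
  moreover have "y i = 0" if "i \<notin> {1..n}" for i
    using that by (auto simp: y_def mv_def)
  ultimately have "y i = 0" if "i < k" for i
    using that by (cases "i \<in> {1..n}") (auto simp: m_def)
  then show ?thesis by (simp add: vfl_def y_def)
qed

lemma mv_vfl:
  assumes "\<And>l i. l \<in> {1..n} \<Longrightarrow> i \<in> {1..n} \<Longrightarrow> l < k \<Longrightarrow> k \<le> i \<Longrightarrow> g l i = 0" "x \<in> vfl n k"
  shows "mv n g x \<in> vfl n k"
  unfolding vfl_def
proof (intro CollectI conjI allI impI)
  fix l assume "l < k"
  then show "mv n g x l = 0"
    using assms vfl_zero[OF assms(2)] by (auto simp: mv_def intro!: sum.neutral) (meson not_le)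
qed simp

text \<open>For j >= 3 the new vector f_j still lies in V_j. For j = 2 the product lies in V_3
  whatever f_1 and f_2 are, so the entry (1,2) of \<open>g\<close> is unrestricted.\<close>

lemma act_tri:
  assumes c: "c \<in> tri n" and gh: "ginv n g h"
    and g: "\<And>l i. l \<in> {1..n} \<Longrightarrow> i \<in> {1..n} \<Longrightarrow> l < i \<Longrightarrow> 3 \<le> i \<Longrightarrow> g l i = 0"
  shows "act n c g h \<in> tri n"
proof (rule triI)
  show "anticomm n (act n c g h)" using c anticomm_act tri_iff by blast
  fix i j assume ij: "i \<in> {1..n}" "j \<in> {1..n}" "i < j"
  have "amul n c (mv n g (ev i)) (mv n g (ev j)) \<in> vfl n (Suc j)"
  proof (cases "j \<ge> 3")
    case True
    then have "mv n g (ev j) \<in> vfl n j"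
      using ij g by (intro mv_vfl ev_vfl) auto
    then show ?thesis by (rule tri_mul_right[OF c])
  next
    case False
    then show ?thesis using tri_mul_3[OF c] vfl_mono[of "Suc j" 3 n] by auto
  qed
  then have "mv n h (amul n c (mv n g (ev i)) (mv n g (ev j))) \<in> vfl n (Suc j)"
    by (rule ginv_vfl[OF gh, rotated 2]) (use ij g in auto)
  then show "amul n (act n c g h) (ev i) (ev j) \<in> vfl n (Suc j)"
    by (simp add: amul_act)
qed simp

section \<open>Nilpotent algebras are strictly triangular in a suitable basis\<close>

lemma sum_fun_apply: "(\<Sum>i\<in>A. f i) x = (\<Sum>i\<in>A. f i x :: 'b::comm_monoid_add)"
  by (induction A rule: infinite_finite_induct) auto

lemma ev_independent: "\<not> fv.dependent (ev ` {1..n})" and card_ev: "card (ev ` {1..n}) = n"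
proof -
  have inj: "inj_on ev {1..n}"
    by (rule inj_onI) (metis ev_def zero_neq_one)
  then show "card (ev ` {1..n}) = n" by (simp add: card_image)
  show "\<not> fv.dependent (ev ` {1..n})"
  proof
    assume "fv.dependent (ev ` {1..n})"
    then obtain u v where v: "v \<in> ev ` {1..n}" "u v \<noteq> 0"
      and s: "(\<Sum>v\<in>ev ` {1..n}. (\<lambda>x. u v * v x)) = 0"
      using fv.dependent_finite[of "ev ` {1..n}"] by auto
    from v obtain i where i: "i \<in> {1..n}" "v = ev i" by auto
    have "(\<Sum>v\<in>ev ` {1..n}. (\<lambda>x. u v * v x)) = (\<Sum>j\<in>{1..n}. (\<lambda>x. u (ev j) * ev j x))"
      using inj by (simp add: sum.reindex)
    then have "(\<Sum>j\<in>{1..n}. (\<lambda>x. u (ev j) * ev j x)) i = 0"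
      using s by (metis zero_fun_apply)
    then have "(\<Sum>j\<in>{1..n}. u (ev j) * ev j i) = 0" by (simp only: sum_fun_apply)
    moreover have "(\<Sum>j\<in>{1..n}. u (ev j) * ev j i) = (\<Sum>j\<in>{1..n}. if j = i then u (ev j) else 0)"
      by (rule sum.cong) (auto simp: ev_def)
    ultimately show False using i v by simp
  qed
qed

lemma foldr_amul_vspace:
  "c \<in> ambient n \<Longrightarrow> x \<in> vspace n \<Longrightarrow> foldr (amul n c) as x \<in> vspace n"
  by (cases as) (auto intro: amul_vspace)

text \<open>The basis is grown backwards from its last vector. Among left products of a length m
  that escape the current span, where those of length m + 1 no longer do, any one can be prepended:
  each multiple of it lies in the span of its successors. Only a bound on the length of nonzero left
  products is assumed, so the lemma serves both for nilpotent algebras and for the closed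
  condition.\<close>

lemma triangular_basis:
  assumes c: "c \<in> ambient n" "anticomm n c"
    and nil: "\<And>as x. length as = k \<Longrightarrow> set as \<subseteq> vspace n \<Longrightarrow> x \<in> vspace n \<Longrightarrow>
      foldr (amul n c) as x = (\<lambda>_. 0)"
  obtains w g h where "w \<in> tri n" "ginv n g h" "c = act n w g h"
proof -
  have "\<exists>fs. length fs = j \<and> distinct fs \<and> set fs \<subseteq> vspace n \<and> \<not> fv.dependent (set fs) \<and>
     (\<forall>pre a rest. fs = pre @ a # rest \<longrightarrow> (\<forall>z\<in>vspace n. amul n c z a \<in> fv.span (set rest)))"
    if "j \<le> n" for j
    using that
  proof (induction j)
    case 0
    then show ?case by (auto simp: fv.dependent_def)
  next
    case (Suc j)
    then obtain fs where fs: "length fs = j" "distinct fs" "set fs \<subseteq> vspace n" "\<not> fv.dependent (set fs)"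
      and span: "\<And>pre a rest z. fs = pre @ a # rest \<Longrightarrow> z \<in> vspace n \<Longrightarrow> amul n c z a \<in> fv.span (set rest)"
      by (metis Suc_leD)
    define P where "P m \<longleftrightarrow> (\<exists>as x. length as = m \<and> set as \<subseteq> vspace n \<and> x \<in> vspace n \<and>
       foldr (amul n c) as x \<notin> fv.span (set fs))" for m
    have "\<not> ev ` {1..n} \<subseteq> fv.span (set fs)"
    proof
      assume "ev ` {1..n} \<subseteq> fv.span (set fs)"
      then have "card (ev ` {1..n}) \<le> card (set fs)"
        using fv.independent_span_bound[OF _ ev_independent] by blast
      then show False using fs Suc.prems card_ev card_length[of fs] by simp
    qed
    \<comment> \<open>Fewer than n vectors cannot span, so some e_i escapes; between this success at
      0 and the failure at k lies a last success.\<close>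
    then have "P 0" unfolding P_def using ev_vspace by fastforce
    moreover have "\<not> P k"
      unfolding P_def using nil fv.span_zero[of "set fs"] by (auto simp: zero_fun_def)
    ultimately obtain m where m: "P m" "\<not> P (Suc m)"
      by (induction k) auto
    then obtain as x where as: "length as = m" "set as \<subseteq> vspace n" "x \<in> vspace n"
      and notin: "foldr (amul n c) as x \<notin> fv.span (set fs)"
      unfolding P_def by blast
    define a where "a = foldr (amul n c) as x"
    have aV: "a \<in> vspace n" unfolding a_def by (rule foldr_amul_vspace[OF c(1) as(3)])
    have za: "amul n c z a \<in> fv.span (set fs)" if "z \<in> vspace n" for z
    proof (rule ccontr)
      assume "amul n c z a \<notin> fv.span (set fs)"
      then have "P (Suc m)"
        unfolding P_def a_def using as that by (intro exI[of _ "z # as"] exI[of _ x]) auto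
      then show False using m by simp
    qed
    have "a \<notin> set fs" using notin fv.span_base a_def by blast
    moreover have "\<not> fv.dependent (set (a # fs))"
      using fv.independent_insertI[of a "set fs"] notin fs a_def by simp
    moreover have "amul n c z b \<in> fv.span (set rest)"
      if "a # fs = pre @ b # rest" "z \<in> vspace n" for pre b rest z
      using that za span by (cases pre) auto
    ultimately show ?case
      using fs aV by (intro exI[of _ "a # fs"]) auto
  qed
  then obtain fs where fs: "length fs = n" "distinct fs" "set fs \<subseteq> vspace n" "\<not> fv.dependent (set fs)"
    and span: "\<And>pre a rest z. fs = pre @ a # rest \<Longrightarrow> z \<in> vspace n \<Longrightarrow> amul n c z a \<in> fv.span (set rest)"
    by (metis order_refl)
  define g where "g = (\<lambda>l i. (fs ! (i - 1)) l)"
  have bij: "bij_betw ((!) fs) {..<n} (set fs)"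
    using bij_betw_nth[of fs] fs by auto
  have "\<exists>h. ginv n g h"
  proof (rule trivial_kernel_imp_ginv)
    fix v assume v: "\<forall>l\<in>{1..n}. (\<Sum>i=1..n. g l i * v i) = 0"
    \<comment> \<open>Linear dependence indexes coefficients by vectors rather than by positions;
      distinctness of \<open>fs\<close> lets v be carried over.\<close>
    define u where "u = (\<lambda>f. v (Suc (the_inv_into {..<n} ((!) fs) f)))"
    have u: "u (fs ! i) = v (Suc i)" if "i < n" for i
      unfolding u_def using the_inv_into_f_f[OF bij_betw_imp_inj_on[OF bij]] that by simp
    have "(\<Sum>f\<in>set fs. (\<lambda>x. u f * f x)) = 0"
    proof (rule ext)
      fix l
      have "(\<Sum>f\<in>set fs. (\<lambda>x. u f * f x)) l = (\<Sum>f\<in>set fs. u f * f l)"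
        by (simp only: sum_fun_apply)
      also have "\<dots> = (\<Sum>i<n. u (fs ! i) * (fs ! i) l)"
        by (rule sum.reindex_bij_betw[OF bij, symmetric])
      also have "\<dots> = (\<Sum>i<n. g l (Suc i) * v (Suc i))"
        by (rule sum.cong) (auto simp: u g_def)
      also have "\<dots> = (\<Sum>i=1..n. g l i * v i)" by (simp add: sum.atLeast1_atMost_eq)
      also have "\<dots> = 0"
      proof (cases "l \<in> {1..n}")
        case False
        then have "g l i = 0" if "i \<in> {1..n}" for i
          using fs(1,3) that nth_mem[of "i - 1" fs] unfolding g_def vspace_def by fastforce
        then show ?thesis by simp
      qed (use v in auto)
      finally show "(\<Sum>f\<in>set fs. (\<lambda>x. u f * f x)) l = 0 l" by simp
    qed
    then have z: "u f = 0" if "f \<in> set fs" for f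
      using fv.dependent_finite[of "set fs"] fs(4) that by blast
    show "\<forall>i\<in>{1..n}. v i = 0"
    proof
      fix i assume "i \<in> {1..n}"
      then show "v i = 0" using u[of "i - 1"] z[of "fs ! (i - 1)"] fs(1) by auto
    qed
  qed blast
  then obtain h where gh: "ginv n g h" by blast
  have gev: "mv n g (ev i) = fs ! (i - 1)" if "i \<in> {1..n}" for i
  proof -
    have "fs ! (i - 1) \<in> vspace n" using that fs nth_mem[of "i - 1" fs] by auto
    then show ?thesis unfolding mv_ev[OF that] g_def by (auto simp: vspace_def)
  qed
  define w where "w = act n c g h"
  have "w \<in> tri n"
    unfolding w_def
  proof (rule triI)
    show "anticomm n (act n c g h)" by (rule anticomm_act[OF c(2)])
    fix i j assume ij: "i \<in> {1..n}" "j \<in> {1..n}" "i < j"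
    have "fs = take (j - 1) fs @ fs ! (j - 1) # drop j fs"
      using id_take_nth_drop[of "j - 1" fs] ij fs(1) by auto
    moreover have "fs ! (i - 1) \<in> vspace n" using ij fs nth_mem[of "i - 1" fs] by auto
    ultimately have "amul n c (fs ! (i - 1)) (fs ! (j - 1)) \<in> fv.span (set (drop j fs))"
      using span by blast
    moreover have "fv.span (set (drop j fs)) \<subseteq> {v. mv n h v \<in> vfl n (Suc j)}"
    proof (rule fv.span_minimal[OF _ subspace_mv_vfl], rule subsetI)
      fix f assume "f \<in> set (drop j fs)"
      then obtain l where "l < n - j" "f = fs ! (j + l)"
        using fs(1) by (auto simp: in_set_conv_nth)
      then have f: "f = mv n g (ev (Suc (j + l)))" "Suc (j + l) \<in> {1..n}"
        using gev[of "Suc (j + l)"] by auto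
      then have "mv n h f = ev (Suc (j + l))" using ginv_mv(2)[OF gh ev_vspace] by simp
      then show "f \<in> {v. mv n h v \<in> vfl n (Suc j)}"
        using f(2) by (simp add: ev_vfl)
    qed
    ultimately have "mv n h (amul n c (fs ! (i - 1)) (fs ! (j - 1))) \<in> vfl n (Suc j)" by blast
    then show "amul n (act n c g h) (ev i) (ev j) \<in> vfl n (Suc j)"
      using ij by (simp add: amul_act gev)
  qed simp
  moreover have "c = act n w h g"
    unfolding w_def using act_inverse[OF c(1) gh] by simp
  ultimately show thesis using that gh ginv_sym by blast
qed

section \<open>Long products vanish in triangular algebras\<close>

lemma left_products_act_tri:
  assumes w: "w \<in> tri n" and gh: "ginv n g h" and x: "x \<in> vspace n"
  shows "mv n g (foldr (amul n (act n w g h)) as x) \<in> vfl n (Suc (length as))"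
proof (induction as)
  case Nil
  then show ?case by (simp add: vspace_eq_vfl[symmetric])
next
  case (Cons a as)
  then show ?case
    by (simp add: amul_act ginv_mv(1)[OF gh] amul_vspace tri_ambient[OF w] tri_mul_right[OF w])
qed

lemma left_products_vanish:
  assumes w: "w \<in> tri n" and gh: "ginv n g h" and x: "x \<in> vspace n" and "length as = n"
  shows "foldr (amul n (act n w g h)) as x = (\<lambda>_. 0)"
proof -
  have "mv n g (foldr (amul n (act n w g h)) as x) = (\<lambda>_. 0)"
    using left_products_act_tri[OF w gh x, of as] assms(4) vfl_trivial by blast
  then show ?thesis
    using ginv_mv(2)[OF gh foldr_amul_vspace[OF act_ambient x]] by (metis mv_zero)
qed

text \<open>Elements of N^k come from arbitrary bracketings, hence the doubling: if i + j >=
  2^(r+1), one factor has index at least 2^r, and multiplying it on either side moves one step down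
  the flag.\<close>

lemma powset_act_tri:
  assumes w: "w \<in> tri n" and gh: "ginv n g h"
    and "(k, x) \<in> powset n (act n w g h)" "2 ^ r \<le> k"
  shows "x \<in> vspace n \<and> mv n g x \<in> vfl n (Suc r)"
  using assms(3,4)
proof (induction k x arbitrary: r rule: powset.induct)
  case (base x)
  then have "r = 0" by (metis one_less_numeral_iff semiring_norm(76) linorder_not_less one_less_power gr0I)
  then show ?case using base by (simp add: vspace_eq_vfl[symmetric])
next
  case (zero k)
  then show ?case by (simp add: vfl_def)
next
  case (prod i x j y)
  have v: "amul n (act n w g h) x y \<in> vspace n" by (simp add: amul_vspace)
  have eq: "mv n g (amul n (act n w g h) x y) = amul n w (mv n g x) (mv n g y)"
    by (simp add: amul_act ginv_mv(1)[OF gh] amul_vspace tri_ambient[OF w])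
  show ?case
  proof (cases r)
    case 0
    then show ?thesis using v by (simp add: vspace_eq_vfl[symmetric])
  next
    case (Suc r')
    then have "2 ^ r' \<le> i \<or> 2 ^ r' \<le> j" using prod.prems by auto
    then have "mv n g x \<in> vfl n r \<or> mv n g y \<in> vfl n r" using prod.IH Suc by auto
    then show ?thesis using v eq tri_mul_left[OF w] tri_mul_right[OF w] by auto
  qed
next
  case (lin k x y a)
  then show ?case by (auto simp: mv_comb intro!: vfl_comb vspace_comb)
qed

lemma nilpotent_act_tri:
  assumes w: "w \<in> tri n" and gh: "ginv n g h"
  shows "nilpotent_alg n (act n w g h)"
  unfolding nilpotent_alg_def
proof (intro exI[of _ "2 ^ n"] conjI)
  have "x = (\<lambda>_. 0)" if "(2 ^ n, x) \<in> powset n (act n w g h)" for x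
    using powset_act_tri[OF w gh that, of n] vfl_trivial[of n "Suc n" "mv n g x"] ginv_mv(2)[OF gh, of x]
    by auto
  then show "apow n (act n w g h) (2 ^ n) = {\<lambda>_. 0}"
    by (auto simp: apow_def intro: powset.zero)
qed simp

lemma nilpotent_left_products:
  assumes "nilpotent_alg n c"
  obtains k where "\<And>as x. length as = k \<Longrightarrow> set as \<subseteq> vspace n \<Longrightarrow> x \<in> vspace n \<Longrightarrow>
      foldr (amul n c) as x = (\<lambda>_. 0)"
proof -
  obtain k where k: "k \<ge> 1" "apow n c k = {\<lambda>_. 0}"
    using assms by (auto simp: nilpotent_alg_def)
  have "(Suc (length as), foldr (amul n c) as x) \<in> powset n c"
    if "set as \<subseteq> vspace n" "x \<in> vspace n" for as x
    using that
  proof (induction as)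
    case Nil
    then show ?case using powset.base[of x n c] by simp
  next
    case (Cons a as)
    then show ?case
      using powset.prod[OF powset.base[of a n c], of "Suc (length as)"] by simp
  qed
  then have "foldr (amul n c) as x = (\<lambda>_. 0)"
    if "length as = k - 1" "set as \<subseteq> vspace n" "x \<in> vspace n" for as x
    using that k unfolding apow_def by force
  from that[OF this] show thesis .
qed

lemma AN_eq: "AN n = {act n w g h | w g h. w \<in> tri n \<and> ginv n g h}"
proof (intro Set.set_eqI iffI)
  fix c assume "c \<in> AN n"
  then have c: "c \<in> ambient n" "anticomm n c" "nilpotent_alg n c" by (auto simp: AN_def)
  obtain k where "\<And>as x. length as = k \<Longrightarrow> set as \<subseteq> vspace n \<Longrightarrow> x \<in> vspace n \<Longrightarrow>
      foldr (amul n c) as x = (\<lambda>_. 0)"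
    using nilpotent_left_products[OF c(3)] by blast
  from triangular_basis[OF c(1,2) this]
  show "c \<in> {act n w g h | w g h. w \<in> tri n \<and> ginv n g h}" by blast
next
  fix c assume "c \<in> {act n w g h | w g h. w \<in> tri n \<and> ginv n g h}"
  then show "c \<in> AN n"
    unfolding AN_def using nilpotent_act_tri anticomm_act tri_iff by auto
qed

lemma ginv_id: "ginv n (\<lambda>i j. if i = j then 1 else 0) (\<lambda>i j. if i = j then 1 else 0)"
proof (rule right_inverse_imp_ginv, intro ballI)
  let ?d = "\<lambda>i j. (if i = j then 1 else 0) :: complex"
  fix i j assume "i \<in> {1..n}" "j \<in> {1..n}"
  have "(\<Sum>l=1..n. ?d i l * ?d l j) = (\<Sum>l=1..n. if l = i then ?d i j else 0)"
    by (rule sum.cong) auto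
  then show "(\<Sum>l=1..n. ?d i l * ?d l j) = ?d i j" using \<open>i \<in> {1..n}\<close> by simp
qed

lemma tri_subset_AN: "tri n \<subseteq> AN n"
proof
  fix c assume c: "c \<in> tri n"
  let ?d = "\<lambda>i j. (if i = j then 1 else 0) :: complex"
  have "ginv n ?d ?d" by (rule ginv_id)
  moreover have "act n c ?d ?d = c" by (rule act_id[OF tri_ambient[OF c]]) auto
  ultimately show "c \<in> AN n" unfolding AN_eq using c by (auto intro!: exI[of _ c] exI[of _ ?d])
qed

lemma AN_act: "c \<in> AN n \<Longrightarrow> ginv n g h \<Longrightarrow> act n c g h \<in> AN n"
  unfolding AN_eq using ginv_mm act_act by (smt (verit) mem_Collect_eq)

text \<open>The flag has n steps and each left multiplication descends one, so the length n works
  for all nilpotent algebras at once. This replaces an unbounded nilpotency index by fixed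
  polynomial equations.\<close>

lemma AN_iff_left_products:
  "c \<in> AN n \<longleftrightarrow> c \<in> ambient n \<and> anticomm n c \<and>
    (\<forall>as x. length as = n \<and> set as \<subseteq> vspace n \<and> x \<in> vspace n \<longrightarrow> foldr (amul n c) as x = (\<lambda>_. 0))"
proof
  assume c: "c \<in> AN n"
  then obtain w g h where "w \<in> tri n" "ginv n g h" "c = act n w g h"
    unfolding AN_eq by blast
  then show "c \<in> ambient n \<and> anticomm n c \<and>
    (\<forall>as x. length as = n \<and> set as \<subseteq> vspace n \<and> x \<in> vspace n \<longrightarrow> foldr (amul n c) as x = (\<lambda>_. 0))"
    using c left_products_vanish by (auto simp: AN_def)
next
  assume a: "c \<in> ambient n \<and> anticomm n c \<and>
    (\<forall>as x. length as = n \<and> set as \<subseteq> vspace n \<and> x \<in> vspace n \<longrightarrow> foldr (amul n c) as x = (\<lambda>_. 0))"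
  then have c: "c \<in> ambient n" "anticomm n c" by auto
  have "foldr (amul n c) as x = (\<lambda>_. 0)" if "length as = n" "set as \<subseteq> vspace n" "x \<in> vspace n" for as x
    using a that by simp
  from triangular_basis[OF c this] show "c \<in> AN n"
    unfolding AN_eq by blast
qed

section \<open>Polynomial functions and closed sets\<close>

lemma polyfun_sum: "(\<And>i. i \<in> A \<Longrightarrow> (\<lambda>c. p i c) \<in> polyfun n) \<Longrightarrow> (\<lambda>c. \<Sum>i\<in>A. p i c) \<in> polyfun n"
  by (induction A rule: infinite_finite_induct) (auto intro: polyfun.intros)

lemma polyfun_amul:
  assumes "\<And>i. i \<in> {1..n} \<Longrightarrow> (\<lambda>c. X c i) \<in> polyfun n" "\<And>i. i \<in> {1..n} \<Longrightarrow> (\<lambda>c. Y c i) \<in> polyfun n"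
    "k \<in> {1..n}"
  shows "(\<lambda>c. amul n c (X c) (Y c) k) \<in> polyfun n"
  unfolding amul_def using assms
  by (intro polyfun_sum polyfun.pmul polyfun.pvar) (auto simp: box_def)

lemma polyfun_foldr_amul:
  assumes "k \<in> {1..n}"
  shows "(\<lambda>c. foldr (amul n c) as x k) \<in> polyfun n"
  using assms
proof (induction as arbitrary: k)
  case Nil
  then show ?case by (simp add: polyfun.pconst)
next
  case (Cons a as)
  show ?case
    using polyfun_amul[of n "\<lambda>_. a" "\<lambda>c. foldr (amul n c) as x" k] Cons
    by (simp add: polyfun.pconst)
qed

lemma zclosedI:
  assumes "S \<subseteq> ambient n" "\<And>c. c \<in> ambient n \<Longrightarrow> c \<notin> S \<Longrightarrow> \<exists>p\<in>polyfun n. (\<forall>x\<in>S. p x = 0) \<and> p c \<noteq> 0"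
  shows "zclosed n S"
  unfolding zclosed_def
proof (intro exI[of _ "{p \<in> polyfun n. \<forall>x\<in>S. p x = 0}"] conjI)
  show "S = {c \<in> ambient n. \<forall>p\<in>{p \<in> polyfun n. \<forall>x\<in>S. p x = 0}. p c = 0}"
    using assms by blast
qed auto

lemma zclosed_separate:
  assumes "zclosed n C" "c \<in> ambient n" "c \<notin> C"
  obtains p where "p \<in> polyfun n" "\<And>x. x \<in> C \<Longrightarrow> p x = 0" "p c \<noteq> 0"
proof -
  obtain P where P: "P \<subseteq> polyfun n" "C = {c \<in> ambient n. \<forall>p\<in>P. p c = 0}"
    using assms(1) unfolding zclosed_def by blast
  then obtain p where "p \<in> P" "p c \<noteq> 0" using assms by blast
  then show thesis using P by (intro that[of p]) auto
qed

lemma zclosed_AN: "zclosed n (AN n)"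
proof (rule zclosedI)
  show "AN n \<subseteq> ambient n" by (auto simp: AN_def)
  fix c assume c: "c \<in> ambient n" "c \<notin> AN n"
  then consider "\<not> anticomm n c"
    | as x where "length as = n" "set as \<subseteq> vspace n" "x \<in> vspace n" "foldr (amul n c) as x \<noteq> (\<lambda>_. 0)"
    unfolding AN_iff_left_products by blast
  then show "\<exists>p\<in>polyfun n. (\<forall>x\<in>AN n. p x = 0) \<and> p c \<noteq> 0"
  proof cases
    case 1
    then obtain i j k where ijk: "c (i,j,k) \<noteq> - c (j,i,k)" using anticomm_iff[OF c(1)] by blast
    then have b: "(i,j,k) \<in> box n" "(j,i,k) \<in> box n"
    proof -
      have "(j,i,k) \<in> box n \<longleftrightarrow> (i,j,k) \<in> box n" by (auto simp: box_def)
      then show "(i,j,k) \<in> box n" "(j,i,k) \<in> box n"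
        using ijk ambient_zero[OF c(1), of "(i,j,k)"] ambient_zero[OF c(1), of "(j,i,k)"] by auto
    qed
    have "(\<lambda>c. c (i,j,k) + c (j,i,k)) \<in> polyfun n" by (intro polyfun.intros b)
    moreover have "x (i,j,k) + x (j,i,k) = 0" if "x \<in> AN n" for x
      using that anticomm_iff[of x n] by (metis (no_types, lifting) AN_def ab_left_minus mem_Collect_eq)
    ultimately show ?thesis using ijk by (intro bexI[of _ "\<lambda>c. c (i,j,k) + c (j,i,k)"]) (auto simp: eq_neg_iff_add_eq_0)
  next
    case 2
    have "foldr (amul n c) as x \<in> vspace n" by (rule foldr_amul_vspace[OF c(1) 2(3)])
    then obtain k where k: "k \<in> {1..n}" "foldr (amul n c) as x k \<noteq> 0"
      using 2(4) vspace_eqI[OF _ vspace_zero] by blast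
    have "foldr (amul n y) as x k = 0" if "y \<in> AN n" for y
      using that 2 unfolding AN_iff_left_products by (metis (no_types, lifting))
    then show ?thesis using polyfun_foldr_amul[OF k(1)] k(2)
      by (intro bexI[of _ "\<lambda>c. foldr (amul n c) as x k"]) auto
  qed
qed

lemma zclosure_iff:
  assumes "S \<subseteq> ambient n"
  shows "c \<in> zclosure n S \<longleftrightarrow> c \<in> ambient n \<and> (\<forall>q\<in>polyfun n. (\<forall>x\<in>S. q x = 0) \<longrightarrow> q c = 0)"
proof
  assume c: "c \<in> zclosure n S"
  have "zclosed n {c \<in> ambient n. \<forall>q\<in>{q \<in> polyfun n. \<forall>x\<in>S. q x = 0}. q c = 0}"
    unfolding zclosed_def by blast
  moreover have "S \<subseteq> {c \<in> ambient n. \<forall>q\<in>{q \<in> polyfun n. \<forall>x\<in>S. q x = 0}. q c = 0}"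
    using assms by blast
  ultimately show "c \<in> ambient n \<and> (\<forall>q\<in>polyfun n. (\<forall>x\<in>S. q x = 0) \<longrightarrow> q c = 0)"
    using c unfolding zclosure_def by blast
next
  assume c: "c \<in> ambient n \<and> (\<forall>q\<in>polyfun n. (\<forall>x\<in>S. q x = 0) \<longrightarrow> q c = 0)"
  have "c \<in> C" if C: "zclosed n C" "S \<subseteq> C" for C
  proof (rule ccontr)
    assume "c \<notin> C"
    then obtain p where "p \<in> polyfun n" "\<And>x. x \<in> C \<Longrightarrow> p x = 0" "p c \<noteq> 0"
      using zclosed_separate[OF C(1)] c by metis
    then show False using c C(2) by blast
  qed
  then show "c \<in> zclosure n S" unfolding zclosure_def by blast
qed

lemma zclosure_superset: "S \<subseteq> zclosure n S"
  by (auto simp: zclosure_def)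

lemma zclosure_minimal: "zclosed n C \<Longrightarrow> S \<subseteq> C \<Longrightarrow> zclosure n S \<subseteq> C"
  by (auto simp: zclosure_def)

lemma zclosed_zclosure:
  assumes "S \<subseteq> ambient n"
  shows "zclosed n (zclosure n S)"
proof (rule zclosedI)
  show "zclosure n S \<subseteq> ambient n" using zclosure_iff[OF assms] by blast
  fix c assume "c \<in> ambient n" "c \<notin> zclosure n S"
  then show "\<exists>p\<in>polyfun n. (\<forall>x\<in>zclosure n S. p x = 0) \<and> p c \<noteq> 0"
    using zclosure_iff[OF assms] by blast
qed

lemma zclosure_mono: "S \<subseteq> T \<Longrightarrow> zclosure n S \<subseteq> zclosure n T"
  by (auto simp: zclosure_def)

lemma zirreducible_zclosure:
  assumes "zirreducible n S"
  shows "zirreducible n (zclosure n S)"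
  unfolding zirreducible_def
proof (intro conjI allI impI)
  show "zclosure n S \<noteq> {}" using assms zclosure_superset[of S n] by (auto simp: zirreducible_def)
  fix C1 C2 assume C: "zclosed n C1 \<and> zclosed n C2 \<and> zclosure n S \<subseteq> C1 \<union> C2"
  then have "S \<subseteq> C1 \<or> S \<subseteq> C2"
    using assms zclosure_superset[of S n] unfolding zirreducible_def by blast
  then show "zclosure n S \<subseteq> C1 \<or> zclosure n S \<subseteq> C2" using C zclosure_minimal by blast
qed

section \<open>Closures of stable sets\<close>

lemma polyfun_act:
  assumes "q \<in> polyfun n"
  shows "(\<lambda>c. q (act n c g h)) \<in> polyfun n"
  using assms
proof induction
  case (pvar t)
  obtain i j k where "t = (i,j,k)" by (cases t)
  then have "(\<lambda>c. act n c g h t) =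
      (\<lambda>c. \<Sum>m=1..n. h k m * (\<Sum>l=1..n. \<Sum>p=1..n. g l i * g p j * c (l,p,m)))"
    using pvar by (simp add: act_def)
  moreover have "\<dots> \<in> polyfun n"
    by (intro polyfun_sum polyfun.pmul polyfun.pconst polyfun.pvar) (auto simp: box_def)
  ultimately show ?case by simp
qed (auto intro: polyfun.intros)

text \<open>For fixed \<open>g\<close> and \<open>h\<close> the action is linear in c, so a
  polynomial vanishing on S pulls back to another one.\<close>

lemma zclosure_act:
  assumes "S \<subseteq> ambient n" "\<And>x. x \<in> S \<Longrightarrow> act n x g h \<in> S" "c \<in> zclosure n S"
  shows "act n c g h \<in> zclosure n S"
  unfolding zclosure_iff[OF assms(1)]
proof (intro conjI ballI impI)
  fix q assume q: "q \<in> polyfun n" "\<forall>x\<in>S. q x = 0"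
  have "\<forall>q\<in>polyfun n. (\<forall>x\<in>S. q x = 0) \<longrightarrow> q c = 0"
    using assms(3) unfolding zclosure_iff[OF assms(1)] by (rule conjunct2)
  from bspec[OF this polyfun_act[OF q(1), of g h]] show "q (act n c g h) = 0"
    using q(2) assms(2) by simp
qed simp

section \<open>Rational curves\<close>

text \<open>A rational curve with one denominator \<open>d\<close> for all coordinates. At the
  finitely many parameters in \<open>B\<close> its value is arbitrary.\<close>

definition rcurve :: "nat \<Rightarrow> (complex \<Rightarrow> cpoint) \<Rightarrow> complex set \<Rightarrow> bool" where
  "rcurve n \<gamma> B \<longleftrightarrow> finite B \<and> (\<exists>d. (\<forall>s. s \<notin> B \<longrightarrow> poly d s \<noteq> 0) \<and>
     (\<forall>t\<in>box n. \<exists>P. \<forall>s. s \<notin> B \<longrightarrow> \<gamma> s t * poly d s = poly P s))"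

lemma rcurveI:
  assumes "finite B" "\<And>s. s \<notin> B \<Longrightarrow> poly d s \<noteq> 0"
    "\<And>t. t \<in> box n \<Longrightarrow> \<exists>P. \<forall>s. s \<notin> B \<longrightarrow> \<gamma> s t * poly d s = poly P s"
  shows "rcurve n \<gamma> B"
  using assms unfolding rcurve_def by blast

lemma rcurve_polyfun:
  assumes "rcurve n \<gamma> B" "q \<in> polyfun n"
  obtains Q d where "\<And>s. s \<notin> B \<Longrightarrow> poly d s \<noteq> 0" "\<And>s. s \<notin> B \<Longrightarrow> q (\<gamma> s) * poly d s = poly Q s"
proof -
  have "\<exists>Q d. \<forall>s. s \<notin> B \<longrightarrow> poly d s \<noteq> 0 \<and> q (\<gamma> s) * poly d s = poly Q s"
    using assms(2)
  proof induction
    case (pconst a)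
    show ?case by (rule exI[of _ "[:a:]"], rule exI[of _ 1]) simp
  next
    case (pvar t)
    then show ?case using assms(1) unfolding rcurve_def by blast
  next
    case (padd p q)
    then obtain P Q d e where "\<forall>s. s \<notin> B \<longrightarrow> poly d s \<noteq> 0 \<and> p (\<gamma> s) * poly d s = poly P s"
      "\<forall>s. s \<notin> B \<longrightarrow> poly e s \<noteq> 0 \<and> q (\<gamma> s) * poly e s = poly Q s" by blast
    then show ?case
      by (intro exI[of _ "P * e + Q * d"] exI[of _ "d * e"]) (auto simp: algebra_simps)
  next
    case (pmul p q)
    then obtain P Q d e where "\<forall>s. s \<notin> B \<longrightarrow> poly d s \<noteq> 0 \<and> p (\<gamma> s) * poly d s = poly P s"
      "\<forall>s. s \<notin> B \<longrightarrow> poly e s \<noteq> 0 \<and> q (\<gamma> s) * poly e s = poly Q s" by blast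
    then have "\<forall>s. s \<notin> B \<longrightarrow> poly (d * e) s \<noteq> 0 \<and> p (\<gamma> s) * q (\<gamma> s) * poly (d * e) s = poly (P * Q) s"
      by (simp add: mult_ac)
    then show ?case by blast
  qed
  then show thesis using that by blast
qed

lemma poly_zero_if_cofinite:
  assumes "finite B" "\<And>s. s \<notin> B \<Longrightarrow> poly Q s = 0"
  shows "Q = (0 :: complex poly)"
proof (rule ccontr)
  assume "Q \<noteq> 0"
  then have "finite {s. poly Q s = 0}" by (rule poly_roots_finite)
  moreover have "UNIV \<subseteq> B \<union> {s. poly Q s = 0}" using assms(2) by auto
  ultimately have "finite (UNIV :: complex set)" using assms(1) finite_subset by blast
  then show False using infinite_UNIV_char_0 by blast
qed

text \<open>After clearing the denominator this is the fact that a polynomial in one variable with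
  cofinitely many zeros is zero.\<close>

lemma rcurve_vanish:
  assumes r: "rcurve n \<gamma> B" and q: "q \<in> polyfun n" and B': "finite B'"
    and z: "\<And>s. s \<notin> B' \<Longrightarrow> s \<notin> B \<Longrightarrow> q (\<gamma> s) = 0" and s: "s \<notin> B"
  shows "q (\<gamma> s) = 0"
proof -
  obtain Q d where d: "\<And>s. s \<notin> B \<Longrightarrow> poly d s \<noteq> 0"
    and Q: "\<And>s. s \<notin> B \<Longrightarrow> q (\<gamma> s) * poly d s = poly Q s"
    by (rule rcurve_polyfun[OF r q]) blast
  have "Q = 0"
  proof (rule poly_zero_if_cofinite)
    show "finite (B \<union> B')" using r B' by (simp add: rcurve_def)
    fix s assume "s \<notin> B \<union> B'"
    then show "poly Q s = 0" using Q[of s] z[of s] by simp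
  qed
  then show ?thesis using Q[OF s] d[OF s] by simp
qed

text \<open>If p vanishes on C1 but not at x, and q on C2 but not at y, then pq vanishes along a
  curve from x to y. One-variable polynomials have no zero divisors, so p or q vanishes along the
  whole curve, against its value at an endpoint.\<close>

lemma zirreducible_if_connected_by_rcurves:
  assumes X: "X \<noteq> {}" "X \<subseteq> ambient n"
    and conn: "\<And>x y. x \<in> X \<Longrightarrow> y \<in> X \<Longrightarrow>
      \<exists>\<gamma> B. rcurve n \<gamma> B \<and> 0 \<notin> B \<and> 1 \<notin> B \<and> \<gamma> 0 = x \<and> \<gamma> 1 = y \<and> (\<forall>s. s \<notin> B \<longrightarrow> \<gamma> s \<in> X)"
  shows "zirreducible n X"
  unfolding zirreducible_def
proof (intro conjI allI impI)
  fix C1 C2 assume C: "zclosed n C1 \<and> zclosed n C2 \<and> X \<subseteq> C1 \<union> C2"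
  show "X \<subseteq> C1 \<or> X \<subseteq> C2"
  proof (rule ccontr)
    assume "\<not> (X \<subseteq> C1 \<or> X \<subseteq> C2)"
    then obtain x y where x: "x \<in> X" "x \<notin> C1" and y: "y \<in> X" "y \<notin> C2" by blast
    obtain p where p: "p \<in> polyfun n" "\<And>x. x \<in> C1 \<Longrightarrow> p x = 0" "p x \<noteq> 0"
      using zclosed_separate[of n C1 x] C x X by blast
    obtain q where q: "q \<in> polyfun n" "\<And>x. x \<in> C2 \<Longrightarrow> q x = 0" "q y \<noteq> 0"
      using zclosed_separate[of n C2 y] C y X by blast
    obtain \<gamma> B where \<gamma>: "rcurve n \<gamma> B" "0 \<notin> B" "1 \<notin> B" "\<gamma> 0 = x" "\<gamma> 1 = y"
      "\<And>s. s \<notin> B \<Longrightarrow> \<gamma> s \<in> X"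
      using conn[OF x(1) y(1)] by blast
    obtain P d where d: "\<And>s. s \<notin> B \<Longrightarrow> poly d s \<noteq> 0"
      and P: "\<And>s. s \<notin> B \<Longrightarrow> p (\<gamma> s) * poly d s = poly P s"
      by (rule rcurve_polyfun[OF \<gamma>(1) p(1)]) blast
    obtain Q e where e: "\<And>s. s \<notin> B \<Longrightarrow> poly e s \<noteq> 0"
      and Q: "\<And>s. s \<notin> B \<Longrightarrow> q (\<gamma> s) * poly e s = poly Q s"
      by (rule rcurve_polyfun[OF \<gamma>(1) q(1)]) blast
    have "P * Q = 0"
    proof (rule poly_zero_if_cofinite)
      show "finite B" using \<gamma>(1) by (simp add: rcurve_def)
      fix s assume s: "s \<notin> B"
      then have "p (\<gamma> s) = 0 \<or> q (\<gamma> s) = 0" using \<gamma>(6)[OF s] C p(2) q(2) by blast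
      then show "poly (P * Q) s = 0" using P[OF s] Q[OF s] by auto
    qed
    moreover have "P \<noteq> 0" using P[OF \<gamma>(2)] d[OF \<gamma>(2)] p(3) \<gamma>(4) by auto
    moreover have "Q \<noteq> 0" using Q[OF \<gamma>(3)] e[OF \<gamma>(3)] q(3) \<gamma>(5) by auto
    ultimately show False by simp
  qed
qed (rule X)

lemma rcurve_line: "rcurve n (\<lambda>s t. c t + s * v t) {}"
proof (rule rcurveI[where d = 1])
  fix t
  show "\<exists>P. \<forall>s. s \<notin> {} \<longrightarrow> (c t + s * v t) * poly 1 s = poly P s"
    by (rule exI[of _ "[:c t, v t:]"]) simp
qed auto

text \<open>The limit device of the genericity proof: a condition that holds at almost all points of
  a line through c may be assumed when showing that c lies in a closed set.\<close>

lemma zclosed_line: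
  assumes C: "zclosed n C" and c: "c \<in> ambient n" and B: "finite B"
    and l: "\<And>s. s \<notin> B \<Longrightarrow> (\<lambda>t. c t + s * v t) \<in> C"
  shows "c \<in> C"
proof (rule ccontr)
  assume "c \<notin> C"
  then obtain p where p: "p \<in> polyfun n" "\<And>x. x \<in> C \<Longrightarrow> p x = 0" "p c \<noteq> 0"
    using zclosed_separate[OF C c] by blast
  have "p (\<lambda>t. c t + 0 * v t) = 0"
    by (rule rcurve_vanish[OF rcurve_line p(1) B]) (use l p(2) in auto)
  then show False using p(3) by simp
qed

section \<open>Curves of algebras with a moving basis\<close>

lemma act_inverse_unique:
  assumes "c \<in> ambient n" "ginv n g h" "ginv n g h'"
  shows "act n c g h = act n c g h'"
proof (rule ambient_amul_eqI[where n = n])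
  fix x y
  let ?z = "amul n c (mv n g x) (mv n g y)"
  have z: "?z \<in> vspace n" by (rule amul_vspace[OF assms(1)])
  have "mv n h ?z = mv n h' (mv n g (mv n h ?z))" by (simp add: ginv_mv(2)[OF assms(3)])
  also have "\<dots> = mv n h' ?z" by (simp add: ginv_mv(1)[OF assms(2) z])
  finally show "amul n (act n c g h) x y = amul n (act n c g h') x y" by (simp add: amul_act)
qed simp_all

text \<open>Matrices and algebras are joined by straight lines with the same parameter. The
  determinant is nonzero at both ends, so it has finitely many zeros, and it is a common denominator
  because the inverse matrix enters the action linearly.\<close>

lemma act_rcurve:
  assumes w: "w0 \<in> ambient n" "w1 \<in> ambient n" and gh: "ginv n g0 h0" "ginv n g1 h1"
  obtains \<gamma> B where "rcurve n \<gamma> B" "0 \<notin> B" "1 \<notin> B" "\<gamma> 0 = act n w0 g0 h0" "\<gamma> 1 = act n w1 g1 h1"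
    "\<And>s. s \<notin> B \<Longrightarrow> \<exists>H. ginv n (\<lambda>i j. g0 i j + s * (g1 i j - g0 i j)) H \<and>
       \<gamma> s = act n (\<lambda>t. w0 t + s * (w1 t - w0 t)) (\<lambda>i j. g0 i j + s * (g1 i j - g0 i j)) H"
proof -
  define A where "A i j = [:g0 i j, g1 i j - g0 i j:]" for i j
  define G where "G s = (\<lambda>i j. g0 i j + s * (g1 i j - g0 i j))" for s
  define w where "w s = (\<lambda>t. w0 t + s * (w1 t - w0 t))" for s
  define Wp where "Wp t = [:w0 t, w1 t - w0 t:]" for t
  have Wp: "poly (Wp t) s = w s t" for t s by (simp add: Wp_def w_def)
  have A: "poly (A i j) s = G s i j" for i j s by (simp add: A_def G_def)
  obtain d B where
    AB: "\<forall>s. \<forall>i\<in>{1..n}. \<forall>j\<in>{1..n}.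
       (\<Sum>l=1..n. poly (A i l) s * poly (B l j) s) = (if i = j then poly d s else 0)"
    and d: "\<forall>s C. (\<forall>i\<in>{1..n}. \<forall>j\<in>{1..n}. (\<Sum>l=1..n. poly (A i l) s * C l j) = (if i = j then 1 else 0)) \<longrightarrow>
       poly d s \<noteq> 0"
    using poly_matrix_adjugate[of n A] by (elim exE conjE)
  define H where "H s = (\<lambda>i j. poly (B i j) s / poly d s)" for s
  define Bad where "Bad = {s. poly d s = 0}"
  define \<gamma> where "\<gamma> s = act n (w s) (G s) (H s)" for s
  have G01: "G 0 = g0" "G 1 = g1" by (auto simp: G_def)
  have w01: "w 0 = w0" "w 1 = w1" by (auto simp: w_def)
  have d0: "poly d 0 \<noteq> 0" using d[rule_format, of 0 h0] gh(1) by (simp add: A G01 ginv_def)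
  have d1: "poly d 1 \<noteq> 0" using d[rule_format, of 1 h1] gh(2) by (simp add: A G01 ginv_def)
  have GH: "ginv n (G s) (H s)" if "s \<notin> Bad" for s
  proof (rule right_inverse_imp_ginv, intro ballI)
    fix i j assume ij: "i \<in> {1..n}" "j \<in> {1..n}"
    have "(\<Sum>l=1..n. G s i l * H s l j) = (\<Sum>l=1..n. poly (A i l) s * poly (B l j) s) / poly d s"
      by (simp add: H_def A sum_divide_distrib)
    then show "(\<Sum>l=1..n. G s i l * H s l j) = (if i = j then 1 else 0)"
      using AB[rule_format, OF ij, of s] that by (simp add: Bad_def)
  qed
  show thesis
  proof (rule that[of \<gamma> Bad])
    show "rcurve n \<gamma> Bad"
    proof (rule rcurveI)
      show "finite Bad" unfolding Bad_def using d0 by (intro poly_roots_finite) auto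
      show "poly d s \<noteq> 0" if "s \<notin> Bad" for s using that by (simp add: Bad_def)
      fix t assume t: "t \<in> box n"
      obtain i j k where ijk: "t = (i,j,k)" by (cases t)
      have "\<gamma> s t * poly d s = poly (\<Sum>m=1..n. B k m * (\<Sum>l=1..n. \<Sum>p=1..n. A l i * A p j * Wp (l,p,m))) s" if "s \<notin> Bad" for s
      proof -
        have "\<gamma> s t * poly d s = (\<Sum>m=1..n. poly d s * H s k m *
            (\<Sum>l=1..n. \<Sum>p=1..n. G s l i * G s p j * w s (l,p,m)))"
          using t by (simp add: \<gamma>_def act_def ijk mult.commute[of _ "poly d s"] mult.assoc
            sum_distrib_left[of "poly d s"])
        also have "\<dots> = (\<Sum>m=1..n. poly (B k m) s *
            (\<Sum>l=1..n. \<Sum>p=1..n. G s l i * G s p j * w s (l,p,m)))"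
          using that by (simp add: H_def Bad_def)
        finally show ?thesis by (simp add: poly_sum A Wp)
      qed
      then show "\<exists>P. \<forall>s. s \<notin> Bad \<longrightarrow> \<gamma> s t * poly d s = poly P s" by blast
    qed
    show "0 \<notin> Bad" "1 \<notin> Bad" using d0 d1 by (auto simp: Bad_def)
    \<comment> \<open>\<open>H 0\<close> and \<open>h0\<close> both invert \<open>g0\<close> on the
      index range but may differ off it; the action does not see the difference.\<close>
    then show "\<gamma> 0 = act n w0 g0 h0" "\<gamma> 1 = act n w1 g1 h1"
      using act_inverse_unique[OF w(1) _ gh(1)] act_inverse_unique[OF w(2) _ gh(2)] GH[of 0] GH[of 1]
      by (auto simp: \<gamma>_def G01 w01)
    fix s assume "s \<notin> Bad"
    then show "\<exists>H. ginv n (\<lambda>i j. g0 i j + s * (g1 i j - g0 i j)) H \<and>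
       \<gamma> s = act n (\<lambda>t. w0 t + s * (w1 t - w0 t)) (\<lambda>i j. g0 i j + s * (g1 i j - g0 i j)) H"
      using GH by (auto simp: \<gamma>_def G_def w_def)
  qed
qed

lemma tri_comb:
  assumes "c \<in> tri n" "v \<in> tri n"
  shows "(\<lambda>t. c t + s * v t) \<in> tri n"
proof -
  have "c (i,j,k) + s * v (i,j,k) = - (c (j,i,k) + s * v (j,i,k))" for i j k
    using tri_anti[OF assms(1), of i j k] tri_anti[OF assms(2), of i j k] by (simp add: algebra_simps)
  moreover have "c (i,j,k) + s * v (i,j,k) = 0" if "k \<le> max i j" for i j k
    using that tri_zero[OF assms(1), of k i j] tri_zero[OF assms(2), of k i j] by (simp add: le_max_iff_disj)
  moreover have "(\<lambda>t. c t + s * v t) \<in> ambient n"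
    using assms[THEN tri_ambient] unfolding ambient_def by simp
  ultimately show ?thesis unfolding tri_def by blast
qed

lemma tri_line:
  assumes "w0 \<in> tri n" "w1 \<in> tri n"
  shows "(\<lambda>t. w0 t + s * (w1 t - w0 t)) \<in> tri n"
  using tri_comb[OF assms(1) tri_comb[OF assms(2,1), of "-1"], of s] by simp

lemma zirreducible_AN: "zirreducible n (AN n)"
proof (rule zirreducible_if_connected_by_rcurves)
  have "(\<lambda>_. 0) \<in> tri n" by (simp add: tri_def ambient_def)
  then show "AN n \<noteq> {}" using tri_subset_AN by blast
  show "AN n \<subseteq> ambient n" by (auto simp: AN_def)
  fix x y assume "x \<in> AN n" "y \<in> AN n"
  then obtain w0 g0 h0 w1 g1 h1 where w: "w0 \<in> tri n" "w1 \<in> tri n"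
    and gh: "ginv n g0 h0" "ginv n g1 h1" and xy: "x = act n w0 g0 h0" "y = act n w1 g1 h1"
    unfolding AN_eq by blast
  obtain \<gamma> B where \<gamma>: "rcurve n \<gamma> B" "0 \<notin> B" "1 \<notin> B" "\<gamma> 0 = x" "\<gamma> 1 = y"
    and s: "\<And>s. s \<notin> B \<Longrightarrow> \<exists>H. ginv n (\<lambda>i j. g0 i j + s * (g1 i j - g0 i j)) H \<and>
       \<gamma> s = act n (\<lambda>t. w0 t + s * (w1 t - w0 t)) (\<lambda>i j. g0 i j + s * (g1 i j - g0 i j)) H"
    unfolding xy by (rule act_rcurve[OF tri_ambient[OF w(1)] tri_ambient[OF w(2)] gh]) blast
  have "\<gamma> s \<in> AN n" if "s \<notin> B" for s
    using s[OF that] tri_line[OF w] unfolding AN_eq by blast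
  then show "\<exists>\<gamma> B. rcurve n \<gamma> B \<and> 0 \<notin> B \<and> 1 \<notin> B \<and> \<gamma> 0 = x \<and> \<gamma> 1 = y \<and> (\<forall>s. s \<notin> B \<longrightarrow> \<gamma> s \<in> AN n)"
    using \<gamma> by blast
qed

section \<open>A dominant parametrization\<close>

text \<open>The parameter \<open>t (m-2, m-1, k)\<close> with \<open>k < m\<close> is the matrix entry \<open>X_km\<close> of a unipotent
  matrix \<open>uH = 1 + X\<close>, and \<open>t (i,j,k)\<close> with \<open>i < j < k\<close> moves the triangular structure away from
  \<open>super\<close>, the algebra with \<open>e_i e_(i+1) = e_(i+2)\<close>. A parameter thus carries the index of the
  structure constant that detects it to first order.\<close>

definition par :: "nat \<Rightarrow> (nat \<times> nat \<times> nat) set" where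
  "par n = {(i,j,k). 1 \<le> i \<and> i < j \<and> j \<le> n \<and> 1 \<le> k \<and> k \<le> n \<and> (j < k \<or> (j = Suc i \<and> k \<le> j \<and> j < n))}"

definition uX :: "cpoint \<Rightarrow> nat \<Rightarrow> nat \<Rightarrow> complex" where
  "uX t k m = (if k < m \<and> 3 \<le> m then t (m - 2, m - 1, k) else 0)"

definition uH :: "cpoint \<Rightarrow> nat \<Rightarrow> nat \<Rightarrow> complex" where
  "uH t k m = (if k = m then 1 else 0) + uX t k m"

primrec upow :: "nat \<Rightarrow> cpoint \<Rightarrow> nat \<Rightarrow> nat \<Rightarrow> nat \<Rightarrow> complex" where
  "upow n t 0 = (\<lambda>k m. if k = m then 1 else 0)"
| "upow n t (Suc r) = mm n (uX t) (upow n t r)"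

text \<open>The Neumann series of (1 + X)^(-1), finite because X is strictly upper triangular; so
  the inverse is polynomial in the parameters. In \<open>phi\<close> it takes the place of
  \<open>g\<close>, and 1 + X that of the inverse, so X enters with a plus sign on the output
  side.\<close>

definition uG :: "nat \<Rightarrow> cpoint \<Rightarrow> nat \<Rightarrow> nat \<Rightarrow> complex" where
  "uG n t k m = (\<Sum>r<n. (-1) ^ r * upow n t r k m)"

definition super :: cpoint where
  "super = (\<lambda>(i,j,k). if j = Suc i \<and> k = Suc j then 1 else 0)"

text \<open>Only the entries with i < j < k are read, so the unipotent parameters stored in the same
  function, which have k <= j, do not interfere.\<close>

definition skew :: "nat \<Rightarrow> cpoint \<Rightarrow> cpoint" where
  "skew n t = (\<lambda>(i,j,k). if 1 \<le> i \<and> i < j \<and> j < k \<and> k \<le> n then t (i,j,k)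
     else if 1 \<le> j \<and> j < i \<and> i < k \<and> k \<le> n then - t (j,i,k) else 0)"

definition phi :: "nat \<Rightarrow> cpoint \<Rightarrow> cpoint" where
  "phi n t = act n (skew n (\<lambda>p. super p + t p)) (uG n t) (uH t)"

lemma skew_tri [simp]: "skew n t \<in> tri n"
  unfolding tri_def
proof (intro CollectI conjI allI impI)
  show "skew n t \<in> ambient n" by (auto simp: skew_def ambient_def box_def)
qed (auto simp: skew_def)

lemma skew_of_tri:
  assumes c: "c \<in> tri n" and t: "\<And>i j k. 1 \<le> i \<Longrightarrow> i < j \<Longrightarrow> j < k \<Longrightarrow> k \<le> n \<Longrightarrow> t (i,j,k) = c (i,j,k)"
  shows "skew n t = c"
proof (rule ext)
  fix p :: "nat \<times> nat \<times> nat"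
  obtain i j k where p: "p = (i,j,k)" by (cases p)
  show "skew n t p = c p"
  proof (cases "(i,j,k) \<in> box n \<and> i < k \<and> j < k \<and> i \<noteq> j")
    case True
    then show ?thesis using t[of i j k] t[of j i k] tri_anti[OF c, of i j k]
      by (cases i j rule: linorder_cases) (auto simp: p skew_def box_def)
  next
    case False
    then have "c p = 0"
      using tri_zero[OF c, of k i j] tri_diag[OF c, of i k] ambient_zero[OF tri_ambient[OF c], of p] p
      by (cases "i = j"; cases "i < k \<and> j < k") auto
    then show ?thesis using False by (auto simp: p skew_def box_def)
  qed
qed

lemma upow_zero: "l < k + r \<Longrightarrow> upow n t r k l = 0"
proof (induction r arbitrary: k)
  case (Suc r)
  have "uX t k m * upow n t r m l = 0" for m
    using Suc.IH[of m] Suc.prems by (cases "k < m") (auto simp: uX_def)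
  then show ?case unfolding upow.simps mm_def by (intro sum.neutral ballI)
qed simp

lemma ginv_uG_uH: "ginv n (uG n t) (uH t)"
proof (rule ginv_sym, rule right_inverse_imp_ginv, intro ballI)
  fix k l assume kl: "k \<in> {1..n}" "l \<in> {1..n}"
  define a where "a r = (-1) ^ r * upow n t r k l" for r
  have "(\<Sum>m=1..n. uH t k m * uG n t m l) =
      (\<Sum>m=1..n. (if m = k then uG n t k l else 0) + uX t k m * uG n t m l)"
    by (rule sum.cong) (auto simp: uH_def algebra_simps)
  also have "\<dots> = uG n t k l + (\<Sum>m=1..n. uX t k m * uG n t m l)"
    using kl by (simp add: sum.distrib)
  also have "(\<Sum>m=1..n. uX t k m * uG n t m l) = (\<Sum>r<n. - a (Suc r))"
    unfolding uG_def a_def by (simp add: mm_def sum_distrib_left sum.swap[of _ "{..<n}"] mult_ac)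
  also have "uG n t k l + \<dots> = (\<Sum>r<n. a r - a (Suc r))"
    by (simp add: uG_def a_def sum.distrib)
  also have "\<dots> = a 0 - a n" by (rule sum_lessThan_telescope')
  also have "a n = 0" using upow_zero[of l k n n t] kl by (simp add: a_def)
  finally show "(\<Sum>m=1..n. uH t k m * uG n t m l) = (if k = l then 1 else 0)"
    by (simp add: a_def)
qed

lemma phi_AN: "phi n t \<in> AN n"
  unfolding AN_eq phi_def using ginv_uG_uH by fastforce

text \<open>Solving for the columns of the unipotent factor: the leading minors of
  \<open>1 + s (g - 1)\<close> are polynomials in \<open>s\<close> with value 1 at 0.\<close>

lemma leading_minor_solve:
  fixes g :: "nat \<Rightarrow> nat \<Rightarrow> complex" and m :: nat
  defines "G \<equiv> \<lambda>s i j. (if i = j then 1 else 0) + s * (g i j - (if i = j then 1 else 0))"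
  obtains B where "finite B"
    "\<And>s. s \<notin> B \<Longrightarrow> \<exists>x. \<forall>l\<in>{1..m}. (\<Sum>k=1..m. G s l k * x k) = - G s l (Suc m)"
proof -
  define A where "A i j = [:if i = j then 1 else 0, g i j - (if i = j then 1 else 0):]" for i j
  have A: "poly (A i j) s = G s i j" for i j s by (simp add: A_def G_def)
  obtain d D where
    AD: "\<forall>s. \<forall>i\<in>{1..m}. \<forall>j\<in>{1..m}.
       (\<Sum>l=1..m. poly (A i l) s * poly (D l j) s) = (if i = j then poly d s else 0)"
    and d: "\<forall>s C. (\<forall>i\<in>{1..m}. \<forall>j\<in>{1..m}. (\<Sum>l=1..m. poly (A i l) s * C l j) = (if i = j then 1 else 0)) \<longrightarrow>
       poly d s \<noteq> 0"
    using poly_matrix_adjugate[of m A] by (elim exE conjE)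
  have "poly d 0 \<noteq> 0"
  proof (rule d[rule_format, of 0 "\<lambda>i j. if i = j then 1 else 0"])
    fix i j assume "i \<in> {1..m}" "j \<in> {1..m}"
    have "(\<Sum>l=1..m. poly (A i l) 0 * (if l = j then 1 else 0)) = (\<Sum>l=1..m. if l = j then G 0 i j else 0)"
      by (rule sum.cong) (auto simp: A)
    then show "(\<Sum>l=1..m. poly (A i l) 0 * (if l = j then 1 else 0)) = (if i = j then 1 else 0)"
      using \<open>j \<in> {1..m}\<close> by (simp add: G_def)
  qed
  show thesis
  proof (rule that[of "{s. poly d s = 0}"])
    show "finite {s. poly d s = 0}" using \<open>poly d 0 \<noteq> 0\<close> by (intro poly_roots_finite) auto
    fix s assume "s \<notin> {s. poly d s = 0}"
    then have ds: "poly d s \<noteq> 0" by simp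
    define x where "x k = (\<Sum>l=1..m. poly (D k l) s * (- G s l (Suc m) / poly d s))" for k
    have "(\<Sum>k=1..m. G s l k * x k) = - G s l (Suc m)" if l: "l \<in> {1..m}" for l
    proof -
      have "(\<Sum>k=1..m. G s l k * x k) =
          (\<Sum>k=1..m. \<Sum>l'=1..m. (poly (A l k) s * poly (D k l') s) * (- G s l' (Suc m) / poly d s))"
        by (simp only: x_def sum_distrib_left A mult.assoc)
      also have "\<dots> = (\<Sum>l'=1..m. (\<Sum>k=1..m. poly (A l k) s * poly (D k l') s) * (- G s l' (Suc m) / poly d s))"
        unfolding sum_distrib_right by (rule sum.swap)
      also have "\<dots> = (\<Sum>l'=1..m. if l' = l then - G s l (Suc m) else 0)"
        by (rule sum.cong) (use AD[rule_format, OF l, of _ s] ds in auto)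
      finally show ?thesis using l by simp
    qed
    then show "\<exists>x. \<forall>l\<in>{1..m}. (\<Sum>k=1..m. G s l k * x k) = - G s l (Suc m)" by blast
  qed
qed

text \<open>Matrices are functions on all pairs of naturals; cancelling a matrix against its inverse
  is valid only for the effect on vectors, which is all that the action depends on.\<close>

lemma act_mv_cong:
  assumes "\<And>x. x \<in> vspace n \<Longrightarrow> mv n g x = mv n g' x" "\<And>x. x \<in> vspace n \<Longrightarrow> mv n h x = mv n h' x"
    "c \<in> ambient n"
  shows "act n c g h = act n c g' h'"
  by (rule ambient_amul_eqI[where n = n]) (use assms in \<open>auto simp: amul_act amul_vspace\<close>)

text \<open>The matrix \<open>G\<close> splits as (a matrix preserving the flag) times \<open>uG\<close>, and the first
  factor is absorbed into the strictly triangular structure.\<close>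

lemma act_eq_phi:
  assumes w: "w \<in> tri n" and GH: "ginv n G H"
    and sol: "\<And>m. m \<in> {2..<n} \<Longrightarrow> \<exists>x. \<forall>l\<in>{1..m}. (\<Sum>k=1..m. G l k * x k) = - G l (Suc m)"
  shows "\<exists>t. (\<forall>p. p \<notin> par n \<longrightarrow> t p = 0) \<and> act n w G H = phi n t"
proof -
  obtain x where x: "\<And>m l. m \<in> {2..<n} \<Longrightarrow> l \<in> {1..m} \<Longrightarrow> (\<Sum>k=1..m. G l k * x m k) = - G l (Suc m)"
    using sol by metis
  \<comment> \<open>The entry X_km is stored at (m-2, m-1, k), so column m of X is the solution
    \<open>x (m - 1)\<close>. The linear system says precisely that column m of G (1 + X) vanishes
    above the diagonal.\<close>
  define t1 :: cpoint where "t1 = (\<lambda>(i,j,k). if (i,j,k) \<in> par n \<and> k \<le> j then x j k else 0)"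
  define P where "P = mm n G (uH t1)"
  define P' where "P' = mm n (uG n t1) H"
  have PP: "ginv n P P'" unfolding P_def P'_def by (rule ginv_mm[OF GH ginv_sym[OF ginv_uG_uH]])
  have Pz: "P l m = 0" if l: "l \<in> {1..n}" "m \<in> {1..n}" "l < m" "3 \<le> m" for l m
  proof -
    have m: "m - 1 \<in> {2..<n}" "l \<in> {1..m - 1}" using that by auto
    have "P l m = (\<Sum>k=1..n. (if k = m then G l m else 0) + G l k * uX t1 k m)"
      unfolding P_def mm_def by (rule sum.cong) (auto simp: uH_def algebra_simps)
    also have "\<dots> = G l m + (\<Sum>k=1..n. G l k * uX t1 k m)"
      using that by (simp add: sum.distrib)
    also have "(\<Sum>k=1..n. G l k * uX t1 k m) = (\<Sum>k=1..m-1. G l k * uX t1 k m)"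
      by (rule sum.mono_neutral_right) (use that in \<open>auto simp: uX_def\<close>)
    also have "\<dots> = (\<Sum>k=1..m-1. G l k * x (m - 1) k)"
      by (rule sum.cong) (use that in \<open>auto simp: uX_def t1_def par_def\<close>)
    also have "\<dots> = - G l m" using x[OF m] that by simp
    finally show ?thesis by simp
  qed
  define w' where "w' = act n w P P'"
  have w': "w' \<in> tri n" unfolding w'_def by (rule act_tri[OF w PP Pz])
  define t :: cpoint where
    "t = (\<lambda>(i,j,k). t1 (i,j,k) + (if (i,j,k) \<in> par n \<and> j < k then w' (i,j,k) - super (i,j,k) else 0))"
  have "uX t = uX t1" by (intro ext) (auto simp: uX_def t_def)
  then have uH: "uH t = uH t1" and uG: "uG n t = uG n t1"
  proof -
    show "uH t = uH t1" using \<open>uX t = uX t1\<close> by (intro ext) (simp add: uH_def)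
    have "upow n t r = upow n t1 r" for r
      by (induction r) (simp_all add: \<open>uX t = uX t1\<close>)
    then show "uG n t = uG n t1" by (intro ext) (simp add: uG_def)
  qed
  have "skew n (\<lambda>p. super p + t p) = w'"
    by (rule skew_of_tri[OF w']) (auto simp: t_def t1_def par_def)
  then have "phi n t = act n w (mm n P (uG n t1)) (mm n (uH t1) P')"
    by (simp add: phi_def uH uG w'_def act_act)
  also have "\<dots> = act n w G H"
  proof (rule act_mv_cong[OF _ _ tri_ambient[OF w]])
    fix z assume z: "z \<in> vspace n"
    show "mv n (mm n P (uG n t1)) z = mv n G z"
      by (simp add: mv_mv[symmetric] P_def ginv_mv(2)[OF ginv_uG_uH z])
    show "mv n (mm n (uH t1) P') z = mv n H z"
      by (simp add: mv_mv[symmetric] P'_def ginv_mv(2)[OF ginv_uG_uH])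
  qed
  finally show ?thesis
    by (intro exI[of _ t]) (auto simp: t_def t1_def)
qed

text \<open>This is the density of the image of \<open>phi\<close>. The matrix g is joined to the
  identity by a line while w stays fixed; almost all matrices on the line have invertible leading
  blocks and so give points of the image, and vanishing there propagates to s = 1.\<close>

lemma polyfun_vanish_AN:
  assumes q: "q \<in> polyfun n" and z: "\<And>t. (\<forall>p. p \<notin> par n \<longrightarrow> t p = 0) \<Longrightarrow> q (phi n t) = 0"
    and c: "c \<in> AN n"
  shows "q c = 0"
proof -
  obtain w g h where w: "w \<in> tri n" and gh: "ginv n g h" and c: "c = act n w g h"
    using c unfolding AN_eq by blast
  let ?d = "\<lambda>i j. (if i = j then 1 else 0) :: complex"
  define G where "G s = (\<lambda>i j. ?d i j + s * (g i j - ?d i j))" for s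
  have dd: "ginv n ?d ?d" by (rule ginv_id)
  obtain \<gamma> B where \<gamma>: "rcurve n \<gamma> B" "1 \<notin> B" "\<gamma> 1 = c"
    and s: "\<And>s. s \<notin> B \<Longrightarrow> \<exists>H. ginv n (G s) H \<and> \<gamma> s = act n (\<lambda>t. w t + s * (w t - w t)) (G s) H"
    unfolding c G_def by (rule act_rcurve[OF tri_ambient[OF w] tri_ambient[OF w] dd gh]) blast
  have "\<exists>B. finite B \<and> (\<forall>s. s \<notin> B \<longrightarrow> (\<exists>x. \<forall>l\<in>{1..m}. (\<Sum>k=1..m. G s l k * x k) = - G s l (Suc m)))" for m
    unfolding G_def by (rule leading_minor_solve[of m g]) blast
  then obtain Bm where Bm: "\<And>m. finite (Bm m)"
    and sol: "\<And>m s. s \<notin> Bm m \<Longrightarrow> \<exists>x. \<forall>l\<in>{1..m}. (\<Sum>k=1..m. G s l k * x k) = - G s l (Suc m)"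
    by metis
  have "q (\<gamma> 1) = 0"
  proof (rule rcurve_vanish[OF \<gamma>(1) q, of "\<Union>m<n. Bm m"])
    show "finite (\<Union>m<n. Bm m)" using Bm by blast
    show "1 \<notin> B" by (rule \<gamma>(2))
    fix r assume r: "r \<notin> (\<Union>m<n. Bm m)" "r \<notin> B"
    obtain H where H: "ginv n (G r) H" "\<gamma> r = act n w (G r) H" using s[OF r(2)] by auto
    have "\<exists>x. \<forall>l\<in>{1..m}. (\<Sum>k=1..m. G r l k * x k) = - G r l (Suc m)" if "m \<in> {2..<n}" for m
      using sol[of r m] r(1) that by auto
    from act_eq_phi[OF w H(1) this] obtain t where "\<forall>p. p \<notin> par n \<longrightarrow> t p = 0" "\<gamma> r = phi n t"
      using H(2) by auto
    then show "q (\<gamma> r) = 0" using z by simp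
  qed
  then show ?thesis by (simp add: \<gamma>(3))
qed

text \<open>The coordinates of \<open>phi\<close> are polynomials in the parameters. The class F is
  left abstract because the fact is needed both with control of degrees, for the spaces
  \<open>Sp\<close>, and for one-variable polynomials along a line of parameters.\<close>

lemma phi_closed:
  fixes F :: "('a \<Rightarrow> complex) set"
  assumes const: "\<And>a. (\<lambda>_. a) \<in> F"
    and add: "\<And>f g. f \<in> F \<Longrightarrow> g \<in> F \<Longrightarrow> (\<lambda>x. f x + g x) \<in> F"
    and mul: "\<And>f g. f \<in> F \<Longrightarrow> g \<in> F \<Longrightarrow> (\<lambda>x. f x * g x) \<in> F"
    and var: "\<And>p. (\<lambda>x. r x p) \<in> F"
  shows "(\<lambda>x. phi n (r x) p) \<in> F"
proof -
  have sum: "(\<lambda>x. \<Sum>i\<in>A. f i x) \<in> F" if "\<And>i. (\<lambda>x. f i x) \<in> F" for A :: "nat set" and f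
    by (induction A rule: infinite_finite_induct) (auto intro: const add that)
  have neg: "(\<lambda>x. - f x) \<in> F" if "f \<in> F" for f
    using mul[OF const[of "-1"] that] by simp
  have X: "(\<lambda>x. uX (r x) k m) \<in> F" for k m
    by (cases "k < m \<and> 3 \<le> m") (auto simp: uX_def intro: const var)
  have H: "(\<lambda>x. uH (r x) k m) \<in> F" for k m
    unfolding uH_def by (intro add const X)
  have "(\<lambda>x. upow n (r x) a k m) \<in> F" for a k m
    by (induction a arbitrary: k) (auto simp: mm_def intro!: sum mul X const)
  then have G: "(\<lambda>x. uG n (r x) k m) \<in> F" for k m
    unfolding uG_def by (intro sum mul const)
  have var': "(\<lambda>x. super p + r x p) \<in> F" for p by (intro add const var)
  have W: "(\<lambda>x. skew n (\<lambda>p. super p + r x p) (i,j,k)) \<in> F" for i j k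
    by (cases "1 \<le> i \<and> i < j \<and> j < k \<and> k \<le> n"; cases "1 \<le> j \<and> j < i \<and> i < k \<and> k \<le> n")
       (use var'[of "(i,j,k)"] neg[OF var'[of "(j,i,k)"]] const[of 0] in \<open>auto simp: skew_def\<close>)
  obtain i j k where p: "p = (i,j,k)" by (cases p)
  show ?thesis
  proof (cases "p \<in> box n")
    case True
    then show ?thesis unfolding phi_def act_def p by (simp add: sum mul G H W)
  next
    case False
    then show ?thesis using const[of 0] by (simp add: phi_def act_def p)
  qed
qed

section \<open>The differential of the parametrization at the origin\<close>

lemma upow_scale: "upow n (\<lambda>p. s * t p) r k l = s ^ r * upow n t r k l"
proof (induction r arbitrary: k)
  case (Suc r)
  have "uX (\<lambda>p. s * t p) k m = s * uX t k m" for m by (simp add: uX_def)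
  then show ?case by (simp add: mm_def Suc sum_distrib_left mult_ac)
qed simp

lemma uG_deriv:
  assumes "k \<in> {1..n}" "l \<in> {1..n}"
  shows "((\<lambda>s. uG n (\<lambda>p. s * t p) k l) has_field_derivative - uX t k l) (at 0)"
proof -
  have "((\<lambda>s. \<Sum>r<n. (-1) ^ r * (s ^ r * upow n t r k l)) has_field_derivative
      (\<Sum>r<n. (-1) ^ r * (of_nat r * 0 ^ (r - 1) * upow n t r k l))) (at 0)"
    by (intro DERIV_sum DERIV_cmult DERIV_cmult_right) (auto intro!: derivative_eq_intros)
  moreover have "(\<Sum>r<n. (-1) ^ r * (of_nat r * 0 ^ (r - 1) * upow n t r k l)) =
      (\<Sum>r<n. if r = 1 then - upow n t 1 k l else 0)"
    by (rule sum.cong) (auto simp: power_0_left)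
  moreover have "upow n t 1 k l = (\<Sum>m=1..n. if m = l then uX t k l else 0)"
    unfolding One_nat_def upow.simps mm_def by (rule sum.cong) auto
  then have "upow n t 1 k l = uX t k l" using assms by simp
  moreover have "uX t k l = 0" if "\<not> 1 < n" using that assms by (auto simp: uX_def)
  ultimately show ?thesis unfolding uG_def upow_scale by (cases "1 < n") (simp_all add: not_less)
qed

lemma sum_delta2:
  fixes F :: "nat \<Rightarrow> nat \<Rightarrow> complex"
  assumes "i \<in> A" "j \<in> B" "finite A" "finite B"
  shows "(\<Sum>l\<in>A. \<Sum>p\<in>B. (if l = i then 1 else 0) * (if p = j then 1 else 0) * F l p) = F i j"
proof -
  have "(\<Sum>l\<in>A. \<Sum>p\<in>B. (if l = i then 1 else 0) * (if p = j then 1 else 0) * F l p) =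
      (\<Sum>l\<in>A. if l = i then (\<Sum>p\<in>B. if p = j then F i j else 0) else 0)"
    by (intro sum.cong refl) (auto intro!: sum.cong)
  then show ?thesis using assms by simp
qed

text \<open>At s = 0 both matrices are the identity, with velocity -X for g and X for its inverse.
  The first three sums are therefore the infinitesimal base change applied to \<open>super\<close>,
  and the last term is the variation of the triangular structure itself.\<close>

lemma phi_deriv_sum:
  assumes ijk: "i \<in> {1..n}" "j \<in> {1..n}" "k \<in> {1..n}"
  shows "((\<lambda>s. phi n (\<lambda>p. s * t p) (i,j,k)) has_field_derivative
    (\<Sum>m=1..n. uX t k m * skew n super (i,j,m)) - (\<Sum>l=1..n. uX t l i * skew n super (l,j,k))
      - (\<Sum>p=1..n. uX t p j * skew n super (i,p,k)) + skew n t (i,j,k)) (at 0)"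
proof -
  let ?d = "\<lambda>i j. (if i = j then 1 else 0) :: complex"
  define H where "H s k m = ?d k m + s * uX t k m" for s k m
  have H: "uH (\<lambda>p. s * t p) k m = H s k m" for s k m by (simp add: uH_def H_def uX_def)
  define W where "W s p = skew n super p + s * skew n t p" for s p
  have W: "skew n (\<lambda>p. super p + s * t p) p = W s p" for s p
    by (cases p) (auto simp: skew_def W_def)
  define G where "G s = uG n (\<lambda>p. s * t p)" for s
  have G0: "G 0 k l = ?d k l" if "k \<in> {1..n}" for k l
  proof -
    have "G 0 k l = (\<Sum>r<n. if r = 0 then ?d k l else 0)"
      unfolding G_def uG_def upow_scale by (rule sum.cong) auto
    then show ?thesis using that by simp
  qed
  have dH: "((\<lambda>s. H s k m) has_field_derivative uX t k m) (at 0)" for k m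
    unfolding H_def by (auto intro!: derivative_eq_intros)
  have dW: "((\<lambda>s. W s p) has_field_derivative skew n t p) (at 0)" for p
    unfolding W_def by (auto intro!: derivative_eq_intros)
  have dG: "((\<lambda>s. G s k l) has_field_derivative - uX t k l) (at 0)" if "k \<in> {1..n}" "l \<in> {1..n}" for k l
    unfolding G_def by (rule uG_deriv[OF that])
  have "((\<lambda>s. \<Sum>m=1..n. H s k m * (\<Sum>l=1..n. \<Sum>p=1..n. G s l i * G s p j * W s (l,p,m)))
    has_field_derivative
     (\<Sum>m=1..n. uX t k m * (\<Sum>l=1..n. \<Sum>p=1..n. G 0 l i * G 0 p j * W 0 (l,p,m)) +
       (\<Sum>l=1..n. \<Sum>p=1..n. ((- uX t l i) * G 0 p j + (- uX t p j) * G 0 l i) * W 0 (l,p,m) +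
          skew n t (l,p,m) * (G 0 l i * G 0 p j)) * H 0 k m)) (at 0)"
    by (intro DERIV_sum DERIV_mult dH dW dG) (use ijk in auto)
  moreover have "(\<Sum>l=1..n. \<Sum>p=1..n. G 0 l i * G 0 p j * W 0 (l,p,m)) = skew n super (i,j,m)" for m
  proof -
    have "(\<Sum>l=1..n. \<Sum>p=1..n. G 0 l i * G 0 p j * W 0 (l,p,m)) =
        (\<Sum>l=1..n. \<Sum>p=1..n. ?d l i * ?d p j * W 0 (l,p,m))"
      by (intro sum.cong refl) (simp add: G0)
    then show ?thesis using ijk by (simp add: sum_delta2 W_def)
  qed
  moreover have "(\<Sum>l=1..n. \<Sum>p=1..n. ((- uX t l i) * G 0 p j + (- uX t p j) * G 0 l i) * W 0 (l,p,m) +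
          skew n t (l,p,m) * (G 0 l i * G 0 p j)) =
     - (\<Sum>l=1..n. uX t l i * skew n super (l,j,m)) - (\<Sum>p=1..n. uX t p j * skew n super (i,p,m)) + skew n t (i,j,m)"
    (is "?L = _") for m
  proof -
    have "?L = (\<Sum>l=1..n. \<Sum>p=1..n. (if p = j then - uX t l i * skew n super (l,j,m) else 0) +
        (if l = i then - uX t p j * skew n super (i,p,m) else 0) + ?d l i * ?d p j * skew n t (l,p,m))"
      by (intro sum.cong refl) (auto simp: G0 W_def algebra_simps)
    also have "\<dots> = (\<Sum>l=1..n. - uX t l i * skew n super (l,j,m)) +
        (\<Sum>l=1..n. \<Sum>p=1..n. (if l = i then - uX t p j * skew n super (i,p,m) else 0)) + skew n t (i,j,m)"
      using ijk by (simp add: sum.distrib sum_delta2 sum_subtractf sum_negf)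
    also have "(\<Sum>l=1..n. \<Sum>p=1..n. (if l = i then - uX t p j * skew n super (i,p,m) else 0)) =
        (\<Sum>p=1..n. - uX t p j * skew n super (i,p,m))"
      by (subst sum.swap) (use ijk in simp)
    finally show ?thesis by (simp add: sum_negf)
  qed
  moreover have "(\<Sum>m=1..n. f m * H 0 k m) = f k" for f
  proof -
    have "(\<Sum>m=1..n. f m * H 0 k m) = (\<Sum>m=1..n. if m = k then f k else 0)"
      by (rule sum.cong) (auto simp: H_def)
    then show ?thesis using ijk by simp
  qed
  moreover have "phi n (\<lambda>p. s * t p) (i,j,k) =
      (\<Sum>m=1..n. H s k m * (\<Sum>l=1..n. \<Sum>p=1..n. G s l i * G s p j * W s (l,p,m)))" for s
    using ijk by (simp add: phi_def act_def box_def H W G_def)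
  ultimately have "((\<lambda>s. phi n (\<lambda>p. s * t p) (i,j,k)) has_field_derivative
    (\<Sum>m=1..n. uX t k m * skew n super (i,j,m)) + (- (\<Sum>l=1..n. uX t l i * skew n super (l,j,k))
      - (\<Sum>p=1..n. uX t p j * skew n super (i,p,k)) + skew n t (i,j,k))) (at 0)"
    by (simp add: sum.distrib)
  then show ?thesis by (simp add: algebra_simps)
qed

text \<open>The first and the last term of the product rule together give t(i,j,k), and the second
  vanishes. The third contributes only at (i, i+1, i+1), through e_i e_(i-1) = -e_(i+1). The
  parameter (i-1, i, i-1) entering there is not itself of that form, so the differential is
  triangular and invertible.\<close>

lemma phi_deriv:
  assumes "(i,j,k) \<in> par n"
  shows "((\<lambda>s. phi n (\<lambda>p. s * t p) (i,j,k)) has_field_derivative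
    t (i,j,k) + (if j = Suc i \<and> k = j \<and> 2 \<le> i then t (i - 1, i, i - 1) else 0)) (at 0)"
proof -
  have ijk: "i \<in> {1..n}" "j \<in> {1..n}" "k \<in> {1..n}" "i < j" and c: "j < k \<or> (j = Suc i \<and> k \<le> j \<and> j < n)"
    using assms by (auto simp: par_def)
  have sk: "skew n super (a,b,m) = (if b = Suc a \<and> m = Suc b \<and> 1 \<le> a \<and> m \<le> n then 1
      else if a = Suc b \<and> m = Suc a \<and> 1 \<le> b \<and> m \<le> n then -1 else 0)" for a b m
    by (auto simp: skew_def super_def)
  have 1: "(\<Sum>m=1..n. uX t k m * skew n super (i,j,m)) = (if j = Suc i \<and> k \<le> j then t (i,j,k) else 0)"
  proof -
    have "(\<Sum>m=1..n. uX t k m * skew n super (i,j,m)) =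
        (\<Sum>m=1..n. if m = Suc j then (if j = Suc i \<and> k \<le> j then t (i,j,k) else 0) else 0)"
      by (rule sum.cong) (use ijk in \<open>auto simp: sk uX_def\<close>)
    then show ?thesis using ijk c by auto
  qed
  have 2: "(\<Sum>l=1..n. uX t l i * skew n super (l,j,k)) = 0"
    by (rule sum.neutral) (use ijk in \<open>auto simp: sk uX_def\<close>)
  have 3: "(\<Sum>p=1..n. uX t p j * skew n super (i,p,k)) =
      - (if j = Suc i \<and> k = j \<and> 2 \<le> i then t (i - 1, i, i - 1) else 0)"
  proof -
    define R where "R = - (if j = Suc i \<and> k = j \<and> 2 \<le> i then t (i - 1, i, i - 1) else 0)"
    have "uX t p j * skew n super (i,p,k) = (if p = i - 1 then R else 0)" if p: "p \<in> {1..n}" for p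
    proof (cases "i = Suc p")
      case True
      have kj: "k = Suc i \<longleftrightarrow> j = Suc i \<and> k = j" using c ijk(4) by linarith
      show ?thesis
      proof (cases "k = Suc i")
        case k: True
        then have ji: "j = Suc i" using kj by blast
        then have j: "j = Suc (Suc p)" by (simp only: True)
        have "skew n super (i,p,k) = -1" unfolding sk k using True p ijk(3)[unfolded k] by simp
        moreover have "uX t p j = t (p, i, p)" unfolding uX_def using j True p by simp
        moreover have "R = - t (p, i, p)" unfolding R_def k ji using True p by simp
        ultimately show ?thesis using True by simp
      next
        case False
        then have "skew n super (i,p,k) = 0" "R = 0"
          unfolding sk R_def using True kj by auto
        then show ?thesis by simp
      qed
    next
      case False
      then have "p \<noteq> i - 1" using p by auto
      moreover have "skew n super (i,p,k) = 0 \<or> \<not> p < j"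
        unfolding sk using False c by (cases "p = Suc i") auto
      then have "uX t p j * skew n super (i,p,k) = 0" by (auto simp: uX_def)
      ultimately show ?thesis by simp
    qed
    then have "(\<Sum>p=1..n. uX t p j * skew n super (i,p,k)) = (\<Sum>p=1..n. if p = i - 1 then R else 0)"
      by (rule sum.cong[OF refl])
    also have "\<dots> = (if i - 1 \<in> {1..n} then R else 0)" by simp
    also have "\<dots> = R" using ijk by (auto simp: R_def)
    finally show ?thesis by (simp only: R_def)
  qed
  have 4: "skew n t (i,j,k) = (if j < k then t (i,j,k) else 0)"
    using ijk by (auto simp: skew_def)
  show ?thesis
    using phi_deriv_sum[OF ijk(1-3), of t] c unfolding 1 2 3 4 by (auto split: if_splits)
qed

section \<open>Algebraic independence on closed sets\<close>

fun nmon :: "complex list \<Rightarrow> nat list \<Rightarrow> complex" where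
  "nmon (v # vs) (k # xs) = v ^ k * nmon vs xs"
| "nmon _ _ = 1"

abbreviation mon :: "('b \<Rightarrow> complex) list \<Rightarrow> nat list \<Rightarrow> 'b \<Rightarrow> complex" where
  "mon fs xs c \<equiv> nmon (map (\<lambda>f. f c) fs) xs"

text \<open>Exponents are bounded one by one rather than in total: this makes the count a pure power
  and allows one variable to be split off.\<close>

definition expo :: "nat \<Rightarrow> nat \<Rightarrow> nat list set" where
  "expo e m = {xs. set xs \<subseteq> {..m} \<and> length xs = e}"

text \<open>Algebraic independence of the restrictions of \<open>fs\<close> to Z, with possible
  relations sorted by their exponent bound m.\<close>

definition indep :: "'b set \<Rightarrow> ('b \<Rightarrow> complex) list \<Rightarrow> bool" where
  "indep Z fs \<longleftrightarrow> (\<forall>m a. (\<forall>c\<in>Z. (\<Sum>xs\<in>expo (length fs) m. a xs * mon fs xs c) = 0) \<longrightarrow>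
     (\<forall>xs\<in>expo (length fs) m. a xs = 0))"

lemma finite_expo [simp]: "finite (expo e m)"
  by (simp add: expo_def finite_lists_length_eq)

lemma card_expo: "card (expo e m) = Suc m ^ e"
  by (simp add: expo_def card_lists_length_eq)

lemma expo_0 [simp]: "expo 0 m = {[]}"
  by (auto simp: expo_def)

lemma expo_length: "xs \<in> expo e m \<Longrightarrow> length xs = e"
  by (simp add: expo_def)

lemma Cons_in_expo [simp]: "k # xs \<in> expo (Suc e) m \<longleftrightarrow> k \<le> m \<and> xs \<in> expo e m"
  by (auto simp: expo_def)

lemma expo_Suc: "expo (Suc e) m = (\<lambda>(k, xs). k # xs) ` ({..m} \<times> expo e m)"
proof (intro Set.set_eqI iffI)
  fix xs assume "xs \<in> expo (Suc e) m"
  then show "xs \<in> (\<lambda>(k, xs). k # xs) ` ({..m} \<times> expo e m)"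
    by (cases xs) (auto simp: expo_def)
qed auto

lemma sum_expo_Suc: "(\<Sum>xs\<in>expo (Suc e) m. F xs) = (\<Sum>k\<le>m. \<Sum>xs\<in>expo e m. F (k # xs))"
proof -
  have "inj_on (\<lambda>(k, xs). k # xs) ({..m} \<times> expo e m)" by (auto simp: inj_on_def)
  then show ?thesis by (simp add: expo_Suc sum.reindex sum.cartesian_product case_prod_unfold)
qed

lemma indepD:
  assumes "indep Z fs" "\<And>c. c \<in> Z \<Longrightarrow> (\<Sum>xs\<in>expo (length fs) m. a xs * mon fs xs c) = 0"
    "xs \<in> expo (length fs) m"
  shows "a xs = 0"
  using assms unfolding indep_def by blast

lemma indep_mono: "indep Z fs \<Longrightarrow> Z \<subseteq> Z' \<Longrightarrow> indep Z' fs"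
  unfolding indep_def by (meson subset_iff)

lemma indep_Nil: "Z \<noteq> {} \<Longrightarrow> indep Z []"
  by (auto simp: indep_def)

lemma polyfun_power: "p \<in> polyfun n \<Longrightarrow> (\<lambda>c. p c ^ k) \<in> polyfun n"
  by (induction k) (auto intro: polyfun.intros)

lemma polyfun_mon: "set fs \<subseteq> polyfun n \<Longrightarrow> (\<lambda>c. mon fs xs c) \<in> polyfun n"
proof (induction fs arbitrary: xs)
  case (Cons f fs)
  then show ?case by (cases xs) (auto intro!: polyfun.pconst polyfun.pmul polyfun_power)
qed (simp add: polyfun.pconst)

lemma polyfun_mon_sum: "set fs \<subseteq> polyfun n \<Longrightarrow> (\<lambda>c. \<Sum>xs\<in>E. a xs * mon fs xs c) \<in> polyfun n"
  by (intro polyfun_sum polyfun.pmul polyfun.pconst polyfun_mon)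

lemma zirreducible_mult_zero:
  assumes Z: "zirreducible n Z" "Z \<subseteq> ambient n" and pq: "p \<in> polyfun n" "q \<in> polyfun n"
    and z: "\<And>c. c \<in> Z \<Longrightarrow> p c = 0 \<or> q c = 0"
  shows "(\<forall>c\<in>Z. p c = 0) \<or> (\<forall>c\<in>Z. q c = 0)"
proof -
  have cl: "zclosed n {c \<in> ambient n. p c = 0}" if "p \<in> polyfun n" for p
    unfolding zclosed_def by (rule exI[of _ "{p}"]) (use that in auto)
  have "Z \<subseteq> {c \<in> ambient n. p c = 0} \<union> {c \<in> ambient n. q c = 0}" using z Z(2) by blast
  then have "Z \<subseteq> {c \<in> ambient n. p c = 0} \<or> Z \<subseteq> {c \<in> ambient n. q c = 0}"
    using Z(1) cl[OF pq(1)] cl[OF pq(2)] unfolding zirreducible_def by blast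
  then show ?thesis by blast
qed

text \<open>By induction on k: once the coefficients of lower powers of g vanish, a relation on Z is
  divisible by g^k. Irreducibility of Z cancels this factor, and restriction to Z', where g = 0,
  leaves a relation among \<open>fs\<close> alone.\<close>

lemma indep_Cons:
  assumes Z: "zirreducible n Z" "Z \<subseteq> ambient n" and "Z' \<subseteq> Z"
    and g: "g \<in> polyfun n" "\<And>c. c \<in> Z' \<Longrightarrow> g c = 0" "x \<in> Z" "g x \<noteq> 0"
    and fs: "set fs \<subseteq> polyfun n" "indep Z' fs"
  shows "indep Z (g # fs)"
  unfolding indep_def
proof (intro allI impI)
  fix m a
  let ?E = "expo (length fs) m"
  assume "\<forall>c\<in>Z. (\<Sum>xs\<in>expo (length (g # fs)) m. a xs * mon (g # fs) xs c) = 0"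
  then have zero: "(\<Sum>k\<le>m. \<Sum>xs\<in>?E. a (k # xs) * (g c ^ k * mon fs xs c)) = 0" if "c \<in> Z" for c
    using that by (simp add: sum_expo_Suc)
  have "k \<le> m \<longrightarrow> (\<forall>xs\<in>?E. a (k # xs) = 0)" for k
  proof (induction k rule: less_induct)
    case (less k)
    show ?case
    proof
      assume k: "k \<le> m"
      define S where "S j c = (\<Sum>xs\<in>?E. a (j # xs) * mon fs xs c)" for j c
      define R where "R c = (\<Sum>j\<in>{k..m}. g c ^ (j - k) * S j c)" for c
      have S: "S j \<in> polyfun n" for j
        unfolding S_def by (rule polyfun_mon_sum[OF fs(1)])
      have R: "R \<in> polyfun n"
        unfolding R_def by (intro polyfun_sum polyfun.pmul polyfun_power g(1) S)
      have gR: "g c = 0 \<or> R c = 0" if c: "c \<in> Z" for c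
      proof -
        have "0 = (\<Sum>j\<le>m. g c ^ j * S j c)"
          using zero[OF c] by (simp add: S_def sum_distrib_left mult_ac)
        also have "\<dots> = (\<Sum>j\<in>{k..m}. g c ^ j * S j c)"
        proof (rule sum.mono_neutral_right)
          show "\<forall>j\<in>{..m} - {k..m}. g c ^ j * S j c = 0"
          proof
            fix j assume "j \<in> {..m} - {k..m}"
            then have "j < k" "j \<le> m" by auto
            then have "S j c = 0" unfolding S_def using less.IH[of j] by (intro sum.neutral) auto
            then show "g c ^ j * S j c = 0" by simp
          qed
        qed auto
        also have "\<dots> = g c ^ k * R c"
          unfolding R_def sum_distrib_left
          by (rule sum.cong) (auto simp: mult.assoc[symmetric] power_add[symmetric])
        finally show ?thesis by auto
      qed
      have R0: "\<forall>c\<in>Z. R c = 0"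
        using zirreducible_mult_zero[OF Z g(1) R gR] g(3,4) by blast
      show "\<forall>xs\<in>?E. a (k # xs) = 0"
      proof
        fix xs assume xs: "xs \<in> ?E"
        have "S k c = 0" if c: "c \<in> Z'" for c
        proof -
          have "R c = (\<Sum>j\<in>{k..m}. if j = k then S k c else 0)"
            unfolding R_def by (rule sum.cong) (use g(2)[OF c] in auto)
          then show ?thesis using R0 c assms(3) k by auto
        qed
        then show "a (k # xs) = 0"
          using indepD[OF fs(2) _ xs, of "\<lambda>xs. a (k # xs)"] by (simp add: S_def)
      qed
    qed
  qed
  then show "\<forall>xs\<in>expo (length (g # fs)) m. a xs = 0"
    by (auto simp: expo_Suc)
qed

lemma irr_chain_indep:
  assumes X: "X \<subseteq> ambient n" and ch: "irr_chain n X e Z" and i: "i \<le> e"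
  shows "\<exists>fs. length fs = i \<and> set fs \<subseteq> polyfun n \<and> indep (Z i) fs"
  using i
proof (induction i)
  case 0
  have "Z 0 \<noteq> {}" using ch by (auto simp: irr_chain_def zirreducible_def)
  then show ?case by (intro exI[of _ "[]"]) (simp add: indep_Nil)
next
  case (Suc i)
  then obtain fs where fs: "length fs = i" "set fs \<subseteq> polyfun n" "indep (Z i) fs" by auto
  have "i \<le> e" using Suc.prems by simp
  then have "\<exists>C. zclosed n C \<and> Z i = X \<inter> C" using ch by (simp add: irr_chain_def)
  then obtain C where C: "zclosed n C" "Z i = X \<inter> C" by blast
  have irr: "zirreducible n (Z (Suc i))" and sub: "Z (Suc i) \<subseteq> X" and lt: "Z i \<subset> Z (Suc i)"
    using ch Suc.prems by (auto simp: irr_chain_def)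
  from lt obtain x where x: "x \<in> Z (Suc i)" "x \<notin> Z i" by blast
  then have "x \<in> ambient n" "x \<notin> C" using sub X C by auto
  then obtain g where g: "g \<in> polyfun n" "\<And>y. y \<in> C \<Longrightarrow> g y = 0" "g x \<noteq> 0"
    using zclosed_separate[OF C(1)] by metis
  have "indep (Z (Suc i)) (g # fs)"
    by (rule indep_Cons[OF irr _ _ g(1) _ x(1) g(3) fs(2,3)]) (use sub X lt C g(2) in auto)
  then show ?case using fs g(1) by (intro exI[of _ "g # fs"]) auto
qed

section \<open>Counting monomials\<close>

definition cmon :: "'p list \<Rightarrow> nat list \<Rightarrow> ('p \<Rightarrow> complex) \<Rightarrow> complex" where
  "cmon js xs t = nmon (map t js) xs"

text \<open>The polynomial functions of degree at most m in each of the parameters listed in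
  \<open>js\<close>.\<close>

definition Sp :: "'p list \<Rightarrow> nat \<Rightarrow> (('p \<Rightarrow> complex) \<Rightarrow> complex) set" where
  "Sp js m = fv.span (cmon js ` expo (length js) m)"

lemma nmon_add:
  "length xs = length vs \<Longrightarrow> length ys = length vs \<Longrightarrow> nmon vs xs * nmon vs ys = nmon vs (map2 (+) xs ys)"
proof (induction vs arbitrary: xs ys)
  case (Cons v vs)
  then obtain a xs' b ys' where "xs = a # xs'" "ys = b # ys'" by (metis length_Suc_conv)
  then show ?case using Cons.IH[of xs' ys'] Cons.prems by (simp add: power_add mult_ac)
qed simp

lemma map2_add_expo: "xs \<in> expo e m \<Longrightarrow> ys \<in> expo e m' \<Longrightarrow> map2 (+) xs ys \<in> expo e (m + m')"
  by (auto simp: expo_def subset_iff set_zip in_set_conv_nth) (metis add_mono nth_mem)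

lemma expo_mono: "m \<le> m' \<Longrightarrow> expo e m \<subseteq> expo e m'"
  by (auto simp: expo_def)

lemma Sp_mono: "m \<le> m' \<Longrightarrow> Sp js m \<subseteq> Sp js m'"
  unfolding Sp_def using expo_mono by (intro fv.span_mono image_mono)

lemma Sp_add: "f \<in> Sp js m \<Longrightarrow> g \<in> Sp js m \<Longrightarrow> (\<lambda>x. f x + g x) \<in> Sp js m"
  unfolding Sp_def using fv.span_add[of f _ g] by (simp add: plus_fun_def)

lemma Sp_scale: "f \<in> Sp js m \<Longrightarrow> (\<lambda>x. a * f x) \<in> Sp js m"
  unfolding Sp_def by (rule fv.span_scale)

lemma Sp_mult:
  assumes f: "f \<in> Sp js m" and g: "g \<in> Sp js m'"
  shows "(\<lambda>x. f x * g x) \<in> Sp js (m + m')"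
proof -
  have zero: "(\<lambda>x. 0) \<in> Sp js (m + m')"
    unfolding Sp_def using fv.span_zero by (simp add: zero_fun_def)
  have 1: "(\<lambda>x. cmon js xs x * g x) \<in> Sp js (m + m')" if xs: "xs \<in> expo (length js) m" for xs
    using g unfolding Sp_def[of js m']
  proof (induction rule: fv.span_induct_alt)
    case base
    then show ?case using zero by simp
  next
    case (step c b y)
    then obtain ys where ys: "ys \<in> expo (length js) m'" "b = cmon js ys" by auto
    have "(\<lambda>x. cmon js xs x * b x) = cmon js (map2 (+) xs ys)"
      using nmon_add[of xs "map _ js" ys] expo_length[OF xs] expo_length[OF ys(1)]
      by (auto simp: cmon_def ys(2))
    moreover have "cmon js (map2 (+) xs ys) \<in> Sp js (m + m')"
      unfolding Sp_def using map2_add_expo[OF xs ys(1)] by (intro fv.span_base imageI)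
    ultimately have "(\<lambda>x. c * (cmon js xs x * b x)) \<in> Sp js (m + m')" by (simp add: Sp_scale)
    from Sp_add[OF this step(2)] show ?case by (simp add: algebra_simps)
  qed
  show ?thesis
    using f unfolding Sp_def[of js m]
  proof (induction rule: fv.span_induct_alt)
    case base
    then show ?case using zero by simp
  next
    case (step c b y)
    then obtain xs where xs: "xs \<in> expo (length js) m" "b = cmon js xs" by auto
    from Sp_add[OF Sp_scale[OF 1[OF xs(1)], of c] step(2)] show ?case
      by (simp add: algebra_simps xs(2))
  qed
qed

lemma nmon_replicate_0: "nmon vs (replicate k 0) = 1"
proof (induction vs arbitrary: k)
  case (Cons v vs)
  then show ?case by (cases k) auto
qed simp

lemma Sp_const: "(\<lambda>_. a) \<in> Sp js m"
proof -
  have "cmon js (replicate (length js) 0) \<in> Sp js m"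
    unfolding Sp_def by (intro fv.span_base imageI) (auto simp: expo_def)
  from Sp_scale[OF this, of a] show ?thesis by (simp add: cmon_def nmon_replicate_0)
qed

lemma Sp_var:
  assumes "p \<in> set js"
  shows "(\<lambda>t. t p) \<in> Sp js 1"
proof -
  have "\<exists>xs\<in>expo (length js) 1. \<forall>t. nmon (map t js) xs = t p"
    using assms
  proof (induction js)
    case (Cons q js)
    show ?case
    proof (cases "p = q")
      case True
      have "replicate (length js) 0 \<in> expo (length js) 1" by (auto simp: expo_def)
      then show ?thesis using True
        by (intro bexI[of _ "1 # replicate (length js) 0"]) (auto simp: nmon_replicate_0)
    next
      case False
      then obtain xs where "xs \<in> expo (length js) 1" "\<forall>t. nmon (map t js) xs = t p"
        using Cons by auto
      then show ?thesis by (intro bexI[of _ "0 # xs"]) auto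
    qed
  qed simp
  then obtain xs where xs: "xs \<in> expo (length js) 1" "\<And>t. nmon (map t js) xs = t p" by blast
  then have "cmon js xs = (\<lambda>t. t p)" by (auto simp: cmon_def)
  then show ?thesis unfolding Sp_def using xs(1) by (metis fv.span_base imageI)
qed

lemma Sp_power:
  assumes "f \<in> Sp js D"
  shows "(\<lambda>x. f x ^ k) \<in> Sp js (k * D)"
proof (induction k)
  case (Suc k)
  from Sp_mult[OF assms Suc] show ?case by simp
qed (simp add: Sp_const)

lemma Sp_mon:
  assumes "\<And>f. f \<in> set fs \<Longrightarrow> f \<in> Sp js D" "xs \<in> expo (length fs) m"
  shows "(\<lambda>x. mon fs xs x) \<in> Sp js (length fs * (m * D))"
  using assms
proof (induction fs arbitrary: xs)
  case Nil
  then show ?case by (simp add: Sp_const)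
next
  case (Cons f fs)
  then obtain k ys where xs: "xs = k # ys" "k \<le> m" "ys \<in> expo (length fs) m"
    by (auto simp: expo_Suc)
  have "(\<lambda>x. f x ^ k) \<in> Sp js (m * D)"
    using Sp_power[of f js D k] Cons.prems(1)[of f] Sp_mono[of "k * D" "m * D" js] xs(2) by auto
  from Sp_mult[OF this Cons.IH[OF _ xs(3)]] Cons.prems(1) show ?case by (simp add: xs(1))
qed

text \<open>Independent functions of degree at most \<open>D\<close> in the parameters: compare the number
  \<open>(m+1)^e\<close> of their monomials with the dimension of the space containing them.\<close>

lemma indep_length_le:
  fixes \<psi> :: "('p \<Rightarrow> complex) \<Rightarrow> 'b"
  assumes ind: "indep (range \<psi>) fs" and D: "\<And>f. f \<in> set fs \<Longrightarrow> (\<lambda>t. f (\<psi> t)) \<in> Sp js D"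
  shows "length fs \<le> length js"
proof -
  define e j where "e = length fs" and "j = length js"
  have le: "Suc m ^ e \<le> Suc (e * (m * D)) ^ j" for m
  proof -
    define F where "F xs = (\<lambda>t. mon fs xs (\<psi> t))" for xs
    have z: "a xs = 0" if "\<And>t. (\<Sum>xs\<in>expo e m. a xs * F xs t) = 0" "xs \<in> expo e m" for a xs
      using indepD[OF ind, where m = m and a = a and xs = xs] that unfolding e_def F_def by blast
    \<comment> \<open>Linear independence concerns sets of functions, so different exponents must
      first be seen to give different functions.\<close>
    have inj: "inj_on F (expo e m)"
    proof (rule inj_onI, rule ccontr)
      fix xs ys assume xy: "xs \<in> expo e m" "ys \<in> expo e m" "F xs = F ys" "xs \<noteq> ys"
      define a :: "nat list \<Rightarrow> complex" where "a zs = (if zs = xs then 1 else 0) - (if zs = ys then 1 else 0)" for zs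
      have "(\<Sum>zs\<in>expo e m. a zs * F zs t) = 0" for t
      proof -
        have "(\<Sum>zs\<in>expo e m. a zs * F zs t) =
            (\<Sum>zs\<in>expo e m. (if zs = xs then F xs t else 0) - (if zs = ys then F ys t else 0))"
          by (rule sum.cong) (auto simp: a_def)
        then show ?thesis using xy by (simp add: sum_subtractf)
      qed
      from z[OF this xy(1)] show False using xy(4) by (simp add: a_def)
    qed
    have ind': "\<not> fv.dependent (F ` expo e m)"
    proof
      assume "fv.dependent (F ` expo e m)"
      then obtain u v where v: "v \<in> F ` expo e m" "u v \<noteq> 0"
        and s: "(\<Sum>v\<in>F ` expo e m. (\<lambda>x. u v * v x)) = 0"
        using fv.dependent_finite[of "F ` expo e m"] by auto
      from v obtain xs where xs: "xs \<in> expo e m" "v = F xs" by auto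
      have "(\<Sum>xs\<in>expo e m. u (F xs) * F xs t) = 0" for t
      proof -
        have "(\<Sum>v\<in>F ` expo e m. (\<lambda>x. u v * v x)) t = 0" by (simp only: s zero_fun_apply)
        then show ?thesis using inj by (simp add: sum_fun_apply sum.reindex)
      qed
      from z[of "\<lambda>xs. u (F xs)", OF this xs(1)] show False using v xs by simp
    qed
    have "F ` expo e m \<subseteq> fv.span (cmon js ` expo j (e * (m * D)))"
    proof
      fix f assume "f \<in> F ` expo e m"
      then obtain xs where xs: "xs \<in> expo e m" "f = F xs" by auto
      have "(\<lambda>t. mon (map (\<lambda>f t. f (\<psi> t)) fs) xs t) \<in> Sp js (length (map (\<lambda>f t. f (\<psi> t)) fs) * (m * D))"
        by (rule Sp_mon) (use D xs in \<open>auto simp: e_def\<close>)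
      then show "f \<in> fv.span (cmon js ` expo j (e * (m * D)))"
        by (simp add: xs(2) F_def e_def j_def Sp_def o_def)
    qed
    then have "card (F ` expo e m) \<le> card (cmon js ` expo j (e * (m * D)))"
      by (rule fv.independent_span_bound[OF finite_imageI[OF finite_expo] ind', THEN conjunct2])
    also have "\<dots> \<le> Suc (e * (m * D)) ^ j"
      using card_image_le[of "expo j (e * (m * D))" "cmon js"] by (simp add: card_expo)
    finally show ?thesis by (simp add: card_image[OF inj] card_expo)
  qed
  show ?thesis
  proof (rule ccontr)
    assume "\<not> ?thesis"
    then have ej: "Suc j \<le> e" by (simp add: e_def j_def)
    \<comment> \<open>The count is applied with m = K. Since e K D + 1 is at most (e D + 1)(K + 1),
      the right-hand side is at most K (K + 1)^j, which is less than (K + 1)^(j+1).\<close>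
    define K where "K = Suc (e * D) ^ j"
    have "Suc K ^ Suc j \<le> Suc K ^ e" by (rule power_increasing[OF ej]) simp
    also have "\<dots> \<le> Suc (e * (K * D)) ^ j" by (rule le)
    also have "\<dots> \<le> (Suc (e * D) * Suc K) ^ j" by (rule power_mono) (simp_all add: algebra_simps)
    also have "\<dots> = K * Suc K ^ j" by (simp only: K_def power_mult_distrib)
    finally have "Suc K * Suc K ^ j \<le> K * Suc K ^ j" by simp
    then show False by simp
  qed
qed

section \<open>Coordinate subfamilies of the parametrization\<close>

definition psi :: "nat \<Rightarrow> (nat \<times> nat \<times> nat) list \<Rightarrow> cpoint \<Rightarrow> cpoint" where
  "psi n js t = phi n (\<lambda>p. if p \<in> set js then t p else 0)"

lemma polyfun_psi_degree:
  assumes "q \<in> polyfun n"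
  shows "\<exists>D. (\<lambda>t. q (psi n js t)) \<in> Sp js D"
proof -
  let ?F = "{f. \<exists>D. f \<in> Sp js D}"
  have c: "(\<lambda>_. a) \<in> ?F" for a using Sp_const by blast
  have a: "(\<lambda>x. f x + g x) \<in> ?F" if "f \<in> ?F" "g \<in> ?F" for f g
  proof -
    from that obtain D D' where "f \<in> Sp js D" "g \<in> Sp js D'" by blast
    then have "f \<in> Sp js (max D D')" "g \<in> Sp js (max D D')"
      using Sp_mono[of D "max D D'" js] Sp_mono[of D' "max D D'" js] by auto
    from Sp_add[OF this] show ?thesis by blast
  qed
  have m: "(\<lambda>x. f x * g x) \<in> ?F" if "f \<in> ?F" "g \<in> ?F" for f g
    using that Sp_mult by blast
  have v: "(\<lambda>t. (if p \<in> set js then t p else 0)) \<in> ?F" for p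
    using Sp_var[of p js] c[of 0] by (cases "p \<in> set js") auto
  have "(\<lambda>t. q (psi n js t)) \<in> ?F"
    using assms
  proof induction
    case (pvar p)
    show ?case unfolding psi_def by (rule phi_closed[where F = ?F]) (fact c a m v)+
  qed (use c a m in auto)
  then show ?thesis by blast
qed

lemma indep_psi_length_le:
  assumes "indep (range (psi n js)) fs" "set fs \<subseteq> polyfun n"
  shows "length fs \<le> length js"
proof -
  obtain D where D: "\<And>f. f \<in> set fs \<Longrightarrow> (\<lambda>t. f (psi n js t)) \<in> Sp js (D f)"
    using polyfun_psi_degree[of _ n js] assms(2) by (metis subset_iff)
  have "(\<lambda>t. f (psi n js t)) \<in> Sp js (\<Sum>f\<in>set fs. D f)" if "f \<in> set fs" for f
    using D[OF that] Sp_mono[of "D f" "\<Sum>f\<in>set fs. D f" js] member_le_sum[OF that, of D] by auto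
  then show ?thesis by (rule indep_length_le[OF assms(1)])
qed

lemma monomials_independent:
  assumes "distinct js" "\<And>y. (\<Sum>xs\<in>expo (length js) m. a xs * nmon (map y js) xs) = 0"
    "xs \<in> expo (length js) m"
  shows "a xs = 0"
  using assms
proof (induction js arbitrary: a xs)
  case Nil
  then show ?case by simp
next
  case (Cons p js)
  from Cons.prems(3) obtain k ys where xs: "xs = k # ys" "k \<le> m" "ys \<in> expo (length js) m"
    by (auto simp: expo_Suc)
  have "(\<Sum>ys\<in>expo (length js) m. a (k # ys) * nmon (map y js) ys) = 0" for y
  proof -
    define b where "b k = (\<Sum>ys\<in>expo (length js) m. a (k # ys) * nmon (map y js) ys)" for k
    have "(\<Sum>k\<le>m. b k * z ^ k) = 0" for z
    proof -
      have mp: "map (y(p := z)) js = map y js" using Cons.prems(1) by auto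
      have "(\<Sum>k\<le>m. \<Sum>ys\<in>expo (length js) m. a (k # ys) * (z ^ k * nmon (map y js) ys)) = 0"
        using Cons.prems(2)[of "y(p := z)"]
        by (simp only: length_Cons sum_expo_Suc list.map nmon.simps fun_upd_same mp)
      then show ?thesis unfolding b_def sum_distrib_right by (simp add: mult_ac)
    qed
    then have "b k = 0" using polyfun_eq_0[of b m] xs(2) by blast
    then show ?thesis by (simp add: b_def)
  qed
  then show ?case
    using Cons.IH[of "\<lambda>ys. a (k # ys)" ys] Cons.prems(1) xs by simp
qed

text \<open>If every function vanishes at 0 with slope \<open>l p\<close>, a monomial of total
  degree d behaves like s^d times the same monomial in the slopes. This isolates the lowest
  homogeneous part of a relation.\<close>

lemma nmon_tendsto:
  assumes "\<And>p. p \<in> set js \<Longrightarrow> ((\<lambda>s. f p s / s) \<longlongrightarrow> l p) (at 0)" "length xs = length js"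
  shows "((\<lambda>s. nmon (map (\<lambda>p. f p s) js) xs / s ^ sum_list xs) \<longlongrightarrow> nmon (map l js) xs) (at (0::complex))"
  using assms
proof (induction js arbitrary: xs)
  case Nil
  then show ?case by simp
next
  case (Cons p js)
  then obtain k ys where xs: "xs = k # ys" "length ys = length js" by (cases xs) auto
  have "((\<lambda>s. (f p s / s) ^ k * (nmon (map (\<lambda>p. f p s) js) ys / s ^ sum_list ys)) \<longlongrightarrow>
      l p ^ k * nmon (map l js) ys) (at 0)"
    by (intro tendsto_mult tendsto_power) (use Cons xs in auto)
  then show ?case by (simp add: xs(1) power_add power_divide)
qed

text \<open>The lowest homogeneous part of a relation between the coordinate functions would be a
  relation between their differentials at the origin.\<close>

lemma indep_psi:
  assumes js: "distinct js" "set js \<subseteq> par n"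
  shows "indep (range (psi n js)) (map (\<lambda>p c. c p - phi n (\<lambda>_. 0) p) js)"
  unfolding indep_def
proof (intro allI impI ballI, rule ccontr)
  let ?fs = "map (\<lambda>p c. c p - phi n (\<lambda>_. 0) p) js"
  fix m a xs0
  assume rel: "\<forall>c\<in>range (psi n js). (\<Sum>xs\<in>expo (length ?fs) m. a xs * mon ?fs xs c) = 0"
    and xs0: "xs0 \<in> expo (length ?fs) m" "a xs0 \<noteq> 0"
  let ?E = "expo (length js) m"
  define k0 where "k0 = Min (sum_list ` {xs \<in> ?E. a xs \<noteq> 0})"
  have ne: "{xs \<in> ?E. a xs \<noteq> 0} \<noteq> {}" using xs0 by auto
  have fin: "finite (sum_list ` {xs \<in> ?E. a xs \<noteq> 0})" by simp
  have k0: "k0 \<le> sum_list xs" if "xs \<in> ?E" "a xs \<noteq> 0" for xs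
    unfolding k0_def using that by (intro Min_le fin) auto
  obtain xs1 where xs1: "xs1 \<in> ?E" "a xs1 \<noteq> 0" "sum_list xs1 = k0"
  proof -
    have "k0 \<in> sum_list ` {xs \<in> ?E. a xs \<noteq> 0}"
      unfolding k0_def by (rule Min_in[OF fin]) (use ne in simp)
    then show thesis using that by blast
  qed
  define L where "L t p = (case p of (i,j,k) \<Rightarrow>
     t (i,j,k) + (if j = Suc i \<and> k = j \<and> 2 \<le> i then t (i - 1, i, i - 1) else 0))"
    for t :: cpoint and p
  define a' where "a' xs = (if sum_list xs = k0 then a xs else 0)" for xs
  have homog: "(\<Sum>xs\<in>?E. a' xs * nmon (map (L t) js) xs) = 0" if t: "\<And>p. p \<notin> set js \<Longrightarrow> t p = 0" for t
  proof -
    define f where "f p s = phi n (\<lambda>p. s * t p) p - phi n (\<lambda>_. 0) p" for p s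
    have lim: "((\<lambda>s. f p s / s) \<longlongrightarrow> L t p) (at 0)" if "p \<in> set js" for p
    proof -
      obtain i j k where p: "p = (i,j,k)" by (cases p)
      have "((\<lambda>s. phi n (\<lambda>p. s * t p) p) has_field_derivative L t p) (at 0)"
        using phi_deriv[of i j k n t] that js(2) p by (auto simp: L_def)
      then show ?thesis by (simp add: DERIV_def f_def)
    qed
    have psi: "psi n js (\<lambda>p. s * t p) = phi n (\<lambda>p. s * t p)" for s
      unfolding psi_def by (rule arg_cong[where f = "phi n"]) (use t in auto)
    have zero: "(\<Sum>xs\<in>?E. a xs * nmon (map (\<lambda>p. f p s) js) xs) = 0" for s
    proof -
      have "phi n (\<lambda>p. s * t p) \<in> range (psi n js)" using psi by (metis rangeI)
      from bspec[OF rel this] show ?thesis by (simp add: f_def o_def)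
    qed
    \<comment> \<open>The relation is divided by s^k0. Terms of total degree below k0 have
      coefficient 0, so the truncated subtraction is harmless; terms of higher degree keep a
      positive power of s and disappear in the limit.\<close>
    have "((\<lambda>s. \<Sum>xs\<in>?E. a xs * (nmon (map (\<lambda>p. f p s) js) xs / s ^ sum_list xs) * s ^ (sum_list xs - k0))
        \<longlongrightarrow> (\<Sum>xs\<in>?E. a xs * nmon (map (L t) js) xs * 0 ^ (sum_list xs - k0))) (at 0)"
      by (intro tendsto_sum tendsto_mult tendsto_const tendsto_power tendsto_ident_at nmon_tendsto lim)
         (auto dest: expo_length)
    moreover have "(\<Sum>xs\<in>?E. a xs * (nmon (map (\<lambda>p. f p s) js) xs / s ^ sum_list xs) * s ^ (sum_list xs - k0)) = 0"
      if "s \<noteq> 0" for s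
    proof -
      have "(\<Sum>xs\<in>?E. a xs * (nmon (map (\<lambda>p. f p s) js) xs / s ^ sum_list xs) * s ^ (sum_list xs - k0)) =
          (\<Sum>xs\<in>?E. a xs * nmon (map (\<lambda>p. f p s) js) xs / s ^ k0)"
      proof (rule sum.cong[OF refl])
        fix xs assume "xs \<in> ?E"
        then have "a xs = 0 \<or> s ^ sum_list xs = s ^ (sum_list xs - k0) * s ^ k0"
          using k0 by (metis le_add_diff_inverse2 power_add)
        then show "a xs * (nmon (map (\<lambda>p. f p s) js) xs / s ^ sum_list xs) * s ^ (sum_list xs - k0) =
            a xs * nmon (map (\<lambda>p. f p s) js) xs / s ^ k0"
          using that by auto
      qed
      then show ?thesis using zero[of s] by (simp add: sum_divide_distrib[symmetric])
    qed
    then have "((\<lambda>s. \<Sum>xs\<in>?E. a xs * (nmon (map (\<lambda>p. f p s) js) xs / s ^ sum_list xs) * s ^ (sum_list xs - k0))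
        \<longlongrightarrow> 0) (at 0)"
      by (intro tendsto_eventually) (simp add: eventually_at_filter)
    ultimately have "(\<Sum>xs\<in>?E. a xs * nmon (map (L t) js) xs * 0 ^ (sum_list xs - k0)) = 0"
      by (rule LIM_unique)
    moreover have "(\<Sum>xs\<in>?E. a xs * nmon (map (L t) js) xs * 0 ^ (sum_list xs - k0)) =
        (\<Sum>xs\<in>?E. a' xs * nmon (map (L t) js) xs)"
      by (rule sum.cong[OF refl]) (use k0 in \<open>force simp: a'_def power_0_left\<close>)
    ultimately show ?thesis by simp
  qed
  have "a' xs1 = 0"
  proof (rule monomials_independent[OF js(1) _ xs1(1)])
    fix y :: cpoint
    \<comment> \<open>This t inverts the differential: one substitution suffices, because (i-1, i,
      i-1) receives no correction itself. Parameters outside \<open>js\<close> are frozen at 0 and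
      therefore give no correction either.\<close>
    define t where "t p = (case p of (i,j,k) \<Rightarrow> if p \<in> set js
       then y p - (if j = Suc i \<and> k = j \<and> 2 \<le> i \<and> (i - 1, i, i - 1) \<in> set js then y (i - 1, i, i - 1) else 0)
       else 0)" for p
    have "L t p = y p" if pj: "p \<in> set js" for p
    proof -
      obtain i j k where p: "p = (i,j,k)" by (metis prod_cases3)
      have "t (i - 1, i, i - 1) = (if (i - 1, i, i - 1) \<in> set js then y (i - 1, i, i - 1) else 0)" if "2 \<le> i"
        using that by (auto simp: t_def)
      moreover have "t p = y p - (if j = Suc i \<and> k = j \<and> 2 \<le> i \<and> (i - 1, i, i - 1) \<in> set js
          then y (i - 1, i, i - 1) else 0)"
        using pj by (simp add: t_def p)
      ultimately show ?thesis by (auto simp: L_def p)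
    qed
    then have L: "map (L t) js = map y js" by simp
    have t0: "t p = 0" if "p \<notin> set js" for p using that by (simp add: t_def split: prod.split)
    show "(\<Sum>xs\<in>?E. a' xs * nmon (map y js) xs) = 0"
      unfolding L[symmetric] by (rule homog) (rule t0)
  qed
  then show False using xs1 by (simp add: a'_def)
qed

section \<open>The dimension\<close>

lemma psi_AN: "range (psi n js) \<subseteq> AN n"
  by (auto simp: psi_def phi_AN)

lemma AN_ambient: "AN n \<subseteq> ambient n"
  by (auto simp: AN_def)

lemma psi_ambient: "range (psi n js) \<subseteq> ambient n"
  using psi_AN AN_ambient by blast

lemma zirreducible_psi: "zirreducible n (range (psi n js))"
proof (rule zirreducible_if_connected_by_rcurves[OF _ psi_ambient])
  fix x y assume "x \<in> range (psi n js)" "y \<in> range (psi n js)"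
  then obtain t0 t1 where t: "x = psi n js t0" "y = psi n js t1" by auto
  define r where "r s p = (if p \<in> set js then t0 p + s * (t1 p - t0 p) else 0)" for s p
  define \<gamma> where "\<gamma> s = phi n (r s)" for s
  let ?F = "{f. \<exists>P. \<forall>s. f s = poly P s}"
  have "(\<lambda>s. \<gamma> s p) \<in> ?F" for p
    unfolding \<gamma>_def
  proof (rule phi_closed[where F = ?F])
    show "(\<lambda>_. a) \<in> ?F" for a by (auto intro: exI[of _ "[:a:]"])
    show "(\<lambda>x. f x + g x) \<in> ?F" if "f \<in> ?F" "g \<in> ?F" for f g using that by (auto simp flip: poly_add)
    show "(\<lambda>x. f x * g x) \<in> ?F" if "f \<in> ?F" "g \<in> ?F" for f g using that by (auto simp flip: poly_mult)
    show "(\<lambda>s. r s p) \<in> ?F" for p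
      unfolding r_def mem_Collect_eq
      by (rule exI[of _ "if p \<in> set js then [:t0 p, t1 p - t0 p:] else 0"]) auto
  qed
  then have "rcurve n \<gamma> {}"
    by (intro rcurveI[where d = 1]) auto
  moreover have "\<gamma> s = psi n js (\<lambda>p. t0 p + s * (t1 p - t0 p))" for s
    unfolding \<gamma>_def psi_def by (rule arg_cong[where f = "phi n"]) (simp add: r_def fun_eq_iff)
  ultimately show "\<exists>\<gamma> B. rcurve n \<gamma> B \<and> 0 \<notin> B \<and> 1 \<notin> B \<and> \<gamma> 0 = x \<and> \<gamma> 1 = y \<and>
      (\<forall>s. s \<notin> B \<longrightarrow> \<gamma> s \<in> range (psi n js))"
    by (intro exI[of _ \<gamma>] exI[of _ "{}"]) (auto simp: t)
qed simp

lemma indep_dense: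
  assumes ind: "indep Z fs" and fs: "set fs \<subseteq> polyfun n"
    and dense: "\<And>q c. q \<in> polyfun n \<Longrightarrow> (\<forall>x\<in>S. q x = 0) \<Longrightarrow> c \<in> Z \<Longrightarrow> q c = 0"
  shows "indep S fs"
  unfolding indep_def
proof (intro allI impI ballI)
  fix m a xs
  assume z: "\<forall>c\<in>S. (\<Sum>xs\<in>expo (length fs) m. a xs * mon fs xs c) = 0" and xs: "xs \<in> expo (length fs) m"
  have "(\<Sum>xs\<in>expo (length fs) m. a xs * mon fs xs c) = 0" if "c \<in> Z" for c
    by (rule dense[OF polyfun_mon_sum[OF fs] z that])
  then show "a xs = 0" using indepD[OF ind _ xs] by blast
qed

lemma finite_par [simp]: "finite (par n)"
  by (rule finite_subset[of _ "{..n} \<times> {..n} \<times> {..n}"]) (auto simp: par_def)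

text \<open>Strictness of the chain is itself a count: \<open>Z (Suc i)\<close> carries i + 1
  independent functions by \<open>indep_psi\<close>, whereas functions independent on
  \<open>Z i\<close> remain so on the image of i parameters and number at most i.\<close>

lemma has_dim_AN_card: "has_dim n (AN n) (card (par n))"
proof -
  obtain ps where ps: "set ps = par n" "distinct ps"
    using finite_distinct_list[OF finite_par] by blast
  then have len: "length ps = card (par n)" by (metis distinct_card)
  define Z where "Z i = zclosure n (range (psi n (take i ps)))" for i
  have sub: "Z i \<subseteq> AN n" for i
    unfolding Z_def by (rule zclosure_minimal[OF zclosed_AN psi_AN])
  have mono: "Z i \<subseteq> Z (Suc i)" for i
    unfolding Z_def
  proof (rule zclosure_mono, safe)
    fix t
    have "psi n (take i ps) t = psi n (take (Suc i) ps) (\<lambda>p. if p \<in> set (take i ps) then t p else 0)"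
      using set_take_subset_set_take[of i "Suc i" ps] unfolding psi_def
      by (intro arg_cong[where f = "phi n"] ext) auto
    then show "psi n (take i ps) t \<in> range (psi n (take (Suc i) ps))" by blast
  qed
  have strict: "Z i \<noteq> Z (Suc i)" if i: "i < card (par n)" for i
  proof
    assume eq: "Z i = Z (Suc i)"
    let ?js = "take (Suc i) ps"
    let ?fs = "map (\<lambda>p c. c p - phi n (\<lambda>_. 0) p) ?js"
    have sj: "set ?js \<subseteq> par n" using ps(1) set_take_subset by metis
    have pf: "(\<lambda>c. c p - phi n (\<lambda>_. 0) p) \<in> polyfun n" if "p \<in> set ?js" for p
    proof -
      have "p \<in> box n" using that sj by (auto simp: par_def box_def)
      from polyfun.padd[OF polyfun.pvar[OF this] polyfun.pconst[of "- phi n (\<lambda>_. 0) p"]]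
      show ?thesis by simp
    qed
    then have fs: "set ?fs \<subseteq> polyfun n" by auto
    have "indep (range (psi n ?js)) ?fs"
      by (rule indep_psi) (use ps sj in auto)
    then have "indep (Z (Suc i)) ?fs"
      unfolding Z_def by (rule indep_mono[OF _ zclosure_superset])
    then have "indep (Z i) ?fs" by (simp only: eq)
    then have "indep (range (psi n (take i ps))) ?fs"
      by (rule indep_dense[OF _ fs]) (use zclosure_iff[OF psi_ambient] in \<open>auto simp: Z_def\<close>)
    then have "length ?fs \<le> length (take i ps)"
      by (rule indep_psi_length_le[OF _ fs])
    then show False using i len by simp
  qed
  have "irr_chain n (AN n) (card (par n)) Z"
    unfolding irr_chain_def
  proof (intro conjI allI impI)
    fix i
    show "\<exists>C. zclosed n C \<and> Z i = AN n \<inter> C"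
      using zclosed_zclosure[OF psi_ambient] sub[of i] by (intro exI[of _ "Z i"]) (auto simp: Z_def)
    show "zirreducible n (Z i)"
      unfolding Z_def by (rule zirreducible_zclosure[OF zirreducible_psi])
  next
    fix i assume "i < card (par n)"
    then show "Z i \<subset> Z (Suc i)" using mono strict by blast
  qed
  moreover have "e \<le> card (par n)" if ch: "irr_chain n (AN n) e Z'" for e Z'
  proof -
    obtain fs where fs: "length fs = e" "set fs \<subseteq> polyfun n" "indep (Z' e) fs"
      using irr_chain_indep[OF AN_ambient ch, of e] by auto
    have "Z' e \<subseteq> AN n" using ch by (auto simp: irr_chain_def)
    then have "indep (AN n) fs" by (rule indep_mono[OF fs(3)])
    \<comment> \<open>Density moves independence from the variety to the image, where only
      \<open>card (par n)\<close> parameters are available.\<close>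
    then have "indep (range (psi n ps)) fs"
    proof (rule indep_dense[OF _ fs(2)])
      fix q c assume q: "q \<in> polyfun n" "\<forall>x\<in>range (psi n ps). q x = 0" and c: "c \<in> AN n"
      have "q (phi n t) = 0" if "\<forall>p. p \<notin> par n \<longrightarrow> t p = 0" for t
      proof -
        have "psi n ps t = phi n t"
          unfolding psi_def by (rule arg_cong[where f = "phi n"]) (use that ps in auto)
        then show ?thesis using q(2) by (metis rangeI)
      qed
      then show "q c = 0" by (rule polyfun_vanish_AN[OF q(1) _ c])
    qed
    from indep_psi_length_le[OF this fs(2)] show ?thesis using fs(1) len by simp
  qed
  ultimately show ?thesis unfolding has_dim_def by blast
qed

text \<open>With N = n + 2 this says 6 |par N| = N^3 - N - 6, written without subtraction. From N to
  N + 1 the new triples are those with third index N + 1, of which there are binom(N,2), and the N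
  unipotent parameters with j = N.\<close>

lemma card_par: "6 * card (par (n + 2)) + (n + 2) + 6 = (n + 2) ^ 3"
proof (induction n)
  case 0
  have "par (0 + 2) = {}" by (auto simp: par_def)
  show ?case unfolding \<open>par (0 + 2) = {}\<close> by (simp add: power3_eq_cube)
next
  case (Suc n)
  let ?m = "n + 2"
  let ?A = "(\<lambda>(j,i). (i, j, Suc ?m)) ` (SIGMA j:{1..?m}. {1..<j})"
  let ?B = "(\<lambda>k. (?m - 1, ?m, k)) ` {1..?m}"
  have eq: "par (Suc ?m) = par ?m \<union> (?A \<union> ?B)"
    by (auto simp: par_def image_iff Bex_def le_Suc_eq)
  have dis: "par ?m \<inter> (?A \<union> ?B) = {}" "?A \<inter> ?B = {}"
    by (auto simp: par_def)
  have "card ?A = (\<Sum>j=1..?m. j - 1)"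
    by (subst card_image) (auto simp: inj_on_def)
  moreover have "2 * (\<Sum>j=1..m. j - 1) + m = m * m" for m :: nat
    by (induction m) auto
  ultimately have A: "2 * card ?A + ?m = ?m * ?m" by metis
  have B: "card ?B = ?m" by (subst card_image) (auto simp: inj_on_def)
  have "card (par (Suc ?m)) = card (par ?m) + (card ?A + card ?B)"
    unfolding eq by (subst card_Un_disjoint) (use dis in \<open>auto simp: card_Un_disjoint\<close>)
  then have "6 * card (par (Suc ?m)) + Suc ?m + 6 = (6 * card (par ?m) + ?m + 6) + 3 * (2 * card ?A + ?m) + 3 * ?m + 1"
    using B by simp
  also have "\<dots> = ?m ^ 3 + 3 * (?m * ?m) + 3 * ?m + 1" using Suc A by simp
  also have "\<dots> = (Suc ?m) ^ 3" by (simp add: power3_eq_cube algebra_simps)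
  finally show ?case by simp
qed

lemma has_dim_AN:
  assumes "n \<ge> 2"
  shows "has_dim n (AN n) ((n - 2) * (n^2 + 2*n + 3) div 6)"
proof -
  obtain m where n: "n = m + 2" using assms by (metis add.commute le_Suc_ex)
  have "6 * card (par n) + (n + 6) = m * (n^2 + 2*n + 3) + (n + 6)"
    using card_par[of m] unfolding n by (simp add: power3_eq_cube power2_eq_square algebra_simps)
  then have "(n - 2) * (n^2 + 2*n + 3) div 6 = card (par n)" by (simp add: n)
  then show ?thesis using has_dim_AN_card by simp
qed

section \<open>Algebras generated along the flag\<close>

definition nice :: "nat \<Rightarrow> cpoint \<Rightarrow> bool" where
  "nice n c \<longleftrightarrow> c \<in> tri n \<and>
     (\<forall>i k. 1 \<le> i \<and> Suc (Suc i) \<le> n \<longrightarrow> c (i, Suc i, k) = (if k = Suc (Suc i) then 1 else 0))"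

definition isom :: "nat \<Rightarrow> cpoint \<Rightarrow> cpoint \<Rightarrow> bool" where
  "isom n c c' \<longleftrightarrow> (\<exists>g h. ginv n g h \<and> c' = act n c g h)"

fun gen :: "nat \<Rightarrow> cpoint \<Rightarrow> cvec \<Rightarrow> cvec \<Rightarrow> nat \<Rightarrow> cvec" where
  "gen n c x y 0 = (\<lambda>_. 0)"
| "gen n c x y (Suc 0) = x"
| "gen n c x y (Suc (Suc 0)) = y"
| "gen n c x y (Suc (Suc (Suc i))) = amul n c (gen n c x y (Suc i)) (gen n c x y (Suc (Suc i)))"

lemma nice_tri: "nice n c \<Longrightarrow> c \<in> tri n"
  by (simp add: nice_def)

lemma nice_super:
  "nice n c \<Longrightarrow> 1 \<le> i \<Longrightarrow> Suc (Suc i) \<le> n \<Longrightarrow> c (i, Suc i, k) = (if k = Suc (Suc i) then 1 else 0)"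
  by (simp add: nice_def)

lemma nice_amul_ev:
  assumes "nice n c" "1 \<le> i" "Suc (Suc i) \<le> n"
  shows "amul n c (ev i) (ev (Suc i)) = ev (Suc (Suc i))"
  by (rule ext) (use assms in \<open>simp add: amul_ev nice_super, simp add: ev_def\<close>)

lemma gen_rec: "1 \<le> i \<Longrightarrow> gen n c x y (Suc (Suc i)) = amul n c (gen n c x y i) (gen n c x y (Suc i))"
  by (cases i) auto

lemma gen_1 [simp]: "gen n c x y 1 = x"
  by simp

lemma gen_2 [simp]: "gen n c x y 2 = y"
  by (simp add: numeral_2_eq_2)

lemma gen_3: "gen n c x y 3 = amul n c x y"
  by (simp add: numeral_3_eq_3)

lemma gen_4: "gen n c x y 4 = amul n c y (gen n c x y 3)"
  using gen_rec[of 2 n c x y] by (simp add: eval_nat_numeral)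

lemma gen_vfl: "c \<in> tri n \<Longrightarrow> 3 \<le> i \<Longrightarrow> gen n c x y i \<in> vfl n i"
proof (induction i rule: less_induct)
  case (less i)
  show ?case
  proof (cases "i = 3")
    case True
    then show ?thesis using tri_mul_3[OF less.prems(1)] by (simp add: gen_3)
  next
    case False
    then obtain j where j: "i = Suc (Suc j)" "2 \<le> j"
      using less.prems(2) by (metis One_nat_def Suc_1 Suc_leD Suc_le_mono le_neq_implies_less le_antisym
        not_less_eq_eq numeral_3_eq_3 old.nat.exhaust)
    have "gen n c x y (Suc j) \<in> vfl n (Suc j)" using less.IH[of "Suc j"] less.prems(1) j by auto
    then show ?thesis using gen_rec[of j n c x y] j tri_mul_right[OF less.prems(1)] by simp
  qed
qed

lemma amul_cut:
  assumes c: "c \<in> tri n" and k: "k \<le> Suc n"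
  shows "amul n c x y k = (\<Sum>i\<in>{1..<k}. \<Sum>j\<in>{1..<k}. x i * y j * c (i,j,k))"
proof -
  have "amul n c x y k = (\<Sum>i\<in>{1..<k}. \<Sum>j=1..n. x i * y j * c (i,j,k))"
    unfolding amul_def
    by (rule sum.mono_neutral_right) (use k tri_zero[OF c] in \<open>auto intro!: sum.neutral\<close>)
  also have "\<dots> = (\<Sum>i\<in>{1..<k}. \<Sum>j\<in>{1..<k}. x i * y j * c (i,j,k))"
    by (intro sum.cong refl sum.mono_neutral_right) (use k tri_zero[OF c] in auto)
  finally show ?thesis .
qed

text \<open>Because the coefficient at e_k sees only coordinates below k, two generated bases can be
  compared level by level.\<close>

lemma amul_agree:
  assumes "c \<in> tri n" "k \<le> Suc n" "\<And>i. i < k \<Longrightarrow> x i = x' i" "\<And>i. i < k \<Longrightarrow> y i = y' i"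
  shows "amul n c x y k = amul n c x' y' k"
  unfolding amul_cut[OF assms(1,2)] using assms(3,4) by (intro sum.cong refl) auto

lemma amul_ev_row:
  assumes c: "c \<in> tri n" and z: "z \<in> vfl n b" and "i \<in> {1..n}" "1 \<le> b" "k \<le> Suc n"
  shows "amul n c (ev i) z k = (\<Sum>j\<in>{b..<k}. z j * c (i,j,k))"
proof -
  have "amul n c (ev i) z k = (\<Sum>a=1..n. if a = i then \<Sum>j=1..n. z j * c (i,j,k) else 0)"
    unfolding amul_def by (intro sum.cong refl) (auto simp: ev_def)
  also have "\<dots> = (\<Sum>j=1..n. z j * c (i,j,k))" using assms(3) by simp
  also have "\<dots> = (\<Sum>j\<in>{b..<k}. z j * c (i,j,k))"
    by (rule sum.mono_neutral_right) (use assms vfl_zero[OF z] tri_zero[OF c] in \<open>auto simp: not_le\<close>)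
  finally show ?thesis .
qed

lemma tri_mul_diag:
  assumes c: "c \<in> tri n" and x: "x \<in> vfl n i" and y: "y \<in> vfl n (Suc i)" and i: "1 \<le> i" "Suc i \<le> n"
  shows "amul n c x y (Suc (Suc i)) = x i * y (Suc i) * c (i, Suc i, Suc (Suc i))"
proof -
  have "amul n c x y (Suc (Suc i)) = (\<Sum>a\<in>{1..<Suc (Suc i)}. \<Sum>b\<in>{1..<Suc (Suc i)}.
      if b = Suc i then if a = i then x i * y (Suc i) * c (i, Suc i, Suc (Suc i)) else 0 else 0)"
  proof (subst amul_cut[OF c], use i in simp, intro sum.cong refl)
    fix a b assume "a \<in> {1..<Suc (Suc i)}" "b \<in> {1..<Suc (Suc i)}"
    then show "x a * y b * c (a, b, Suc (Suc i)) =
        (if b = Suc i then if a = i then x i * y (Suc i) * c (i, Suc i, Suc (Suc i)) else 0 else 0)"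
      using vfl_zero[OF x, of a] vfl_zero[OF y, of b] tri_diag[OF c, of "Suc i"]
      by (cases a i rule: linorder_cases; cases "b = Suc i") (auto simp: less_Suc_eq)
  qed
  then show ?thesis using i by simp
qed

section \<open>Leading coefficients of the generated vectors\<close>

lemma sum_below_3: "(\<Sum>i\<in>{1..<3}. F i) = F 1 + (F 2 :: complex)" for F :: "nat \<Rightarrow> complex"
  by (simp add: eval_nat_numeral)

lemma sum_below_4: "(\<Sum>i\<in>{1..<4}. F i) = F 1 + F 2 + (F 3 :: complex)" for F :: "nat \<Rightarrow> complex"
  by (simp add: eval_nat_numeral)

lemma amul_3:
  assumes "c \<in> tri n" "2 \<le> n"
  shows "amul n c x y 3 = (x 1 * y 2 - x 2 * y 1) * c (1,2,3)"
  using amul_cut[OF assms(1), of 3 x y] assms(2) tri_anti[OF assms(1), of 2 1 3]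
    tri_diag[OF assms(1), of 1 3] tri_diag[OF assms(1), of 2 3]
  unfolding sum_below_3 by (simp add: algebra_simps)

lemma amul_4:
  assumes "c \<in> tri n" "3 \<le> n" "z \<in> vfl n 3"
  shows "amul n c y z 4 = (y 1 * c (1,3,4) + y 2 * c (2,3,4)) * z 3"
  using amul_cut[OF assms(1), of 4 y z] assms(2) tri_diag[OF assms(1), of 3 4]
    vfl_zero[OF assms(3), of 1] vfl_zero[OF assms(3), of 2]
  unfolding sum_below_4 by (simp add: algebra_simps)

text \<open>From f_3 on the generated vectors follow the flag and their leading coefficients
  multiply. The vectors x and y enter only at the start: through the determinant of their (e_1,
  e_2)-parts in f_3, and through the coefficient of e_4 in y e_3 in f_4. These are the quantities in
  the conditions D and E below.\<close>

lemma gen_diag: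
  assumes c: "c \<in> tri n" and n: "3 \<le> n" and i: "3 \<le> i" "i \<le> n"
  shows "gen n c x y 3 3 = (x 1 * y 2 - x 2 * y 1) * c (1,2,3)"
    and "gen n c x y 4 4 = (y 1 * c (1,3,4) + y 2 * c (2,3,4)) * gen n c x y 3 3"
    and "Suc (Suc i) \<le> n \<Longrightarrow> gen n c x y (Suc (Suc i)) (Suc (Suc i)) =
       gen n c x y i i * gen n c x y (Suc i) (Suc i) * c (i, Suc i, Suc (Suc i))"
proof -
  show "gen n c x y 3 3 = (x 1 * y 2 - x 2 * y 1) * c (1,2,3)"
    using amul_3[OF c] n by (simp add: gen_3)
  show "gen n c x y 4 4 = (y 1 * c (1,3,4) + y 2 * c (2,3,4)) * gen n c x y 3 3"
    unfolding gen_4 by (rule amul_4[OF c n gen_vfl[OF c order_refl]])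
  show "gen n c x y (Suc (Suc i)) (Suc (Suc i)) =
       gen n c x y i i * gen n c x y (Suc i) (Suc i) * c (i, Suc i, Suc (Suc i))" if "Suc (Suc i) \<le> n"
    using tri_mul_diag[OF c gen_vfl[OF c i(1)] gen_vfl[OF c, of "Suc i"]] i that gen_rec[of i n c x y] by simp
qed

lemma gen_diag_nonzero:
  assumes c: "c \<in> tri n" and sup: "\<And>i. 1 \<le> i \<Longrightarrow> Suc (Suc i) \<le> n \<Longrightarrow> c (i, Suc i, Suc (Suc i)) \<noteq> 0"
    and D: "x 1 * y 2 - x 2 * y 1 \<noteq> 0" and E: "y 1 * c (1,3,4) + y 2 * c (2,3,4) \<noteq> 0"
    and i: "3 \<le> i" "i \<le> n"
  shows "gen n c x y i i \<noteq> 0"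
  using i
proof (induction i rule: less_induct)
  case (less i)
  have n: "3 \<le> n" using less.prems by simp
  have "c (1,2,3) \<noteq> 0" using sup[of 1] n by (simp add: eval_nat_numeral)
  then have 3: "gen n c x y 3 3 \<noteq> 0" using gen_diag(1)[OF c n order_refl n, of x y] D by simp
  consider "i = 3" | "i = 4" | j where "i = Suc (Suc j)" "3 \<le> j"
    using less.prems(1) by (metis Suc_le_D Suc_le_mono le_antisym not_less_eq_eq numeral_3_eq_3 eval_nat_numeral(2) semiring_norm(26) semiring_norm(27))
  then show ?case
  proof cases
    case 1
    then show ?thesis using 3 by simp
  next
    case 2
    then show ?thesis using 3 E gen_diag(2)[OF c n order_refl n, of x y] by simp
  next
    case 3
    then show ?thesis
      using gen_diag(3)[OF c n, of j x y] less.IH[of j] less.IH[of "Suc j"] less.prems sup[of j] by simp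
  qed
qed

lemma gen_diag_one:
  assumes c: "nice n c" and D: "x 1 * y 2 - x 2 * y 1 = 1" and E: "y 1 * c (1,3,4) + y 2 = 1"
    and i: "3 \<le> i" "i \<le> n" and n: "4 \<le> n"
  shows "gen n c x y i i = 1"
  using i
proof (induction i rule: less_induct)
  case (less i)
  have n3: "3 \<le> n" using n by simp
  have c12: "c (1,2,3) = 1" "c (2,3,4) = 1"
    using nice_super[OF c, of 1 3] nice_super[OF c, of 2 4] n by (simp_all add: eval_nat_numeral)
  have 3: "gen n c x y 3 3 = 1" using gen_diag(1)[OF nice_tri[OF c] n3 order_refl n3, of x y] D c12 by simp
  consider "i = 3" | "i = 4" | j where "i = Suc (Suc j)" "3 \<le> j"
    using less.prems(1) by (metis Suc_le_D Suc_le_mono le_antisym not_less_eq_eq numeral_3_eq_3 eval_nat_numeral(2) semiring_norm(26) semiring_norm(27))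
  then show ?case
  proof cases
    case 1
    then show ?thesis using 3 by simp
  next
    case 2
    then show ?thesis using 3 E c12 gen_diag(2)[OF nice_tri[OF c] n3 order_refl n3, of x y] by simp
  next
    case 3
    then show ?thesis
      using gen_diag(3)[OF nice_tri[OF c] n3, of j x y] less.IH[of j] less.IH[of "Suc j"] less.prems
        nice_super[OF c, of j "Suc (Suc j)"] by simp
  qed
qed

text \<open>The matrix with columns f_i is block lower triangular, with a 2 x 2 block in the corner
  since f_1 and f_2 need not respect V_2. Cramer's rule handles the block and induction the
  remaining diagonal.\<close>

lemma flag_kernel:
  assumes f: "\<And>i. 3 \<le> i \<Longrightarrow> i \<le> n \<Longrightarrow> f i \<in> vfl n i \<and> f i i \<noteq> 0" and n: "2 \<le> n"
    and D: "f 1 1 * f 2 2 - f 1 2 * f 2 1 \<noteq> (0::complex)"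
    and v: "\<forall>l\<in>{1..n}. (\<Sum>i=1..n. f i l * v i) = 0"
  shows "\<forall>i\<in>{1..n}. v i = 0"
proof -
  have low: "f 1 l * v 1 + f 2 l * v 2 = 0" if "l \<in> {1,2}" for l
  proof -
    have "(\<Sum>i=1..n. f i l * v i) = (\<Sum>i\<in>{1,2}. f i l * v i)"
    proof (rule sum.mono_neutral_right)
      show "\<forall>i\<in>{1..n} - {1,2}. f i l * v i = 0"
      proof
        fix i assume "i \<in> {1..n} - {1,2}"
        then have "3 \<le> i" "i \<le> n" by auto
        then show "f i l * v i = 0" using f[of i] vfl_zero[of "f i" n i l] that by auto
      qed
    qed (use n in auto)
    then show ?thesis using v that n by auto
  qed
  have e: "f 1 1 * v 1 + f 2 1 * v 2 = 0" "f 1 2 * v 1 + f 2 2 * v 2 = 0" using low by auto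
  have "(f 1 1 * f 2 2 - f 1 2 * f 2 1) * v 1 = f 2 2 * (f 1 1 * v 1 + f 2 1 * v 2) - f 2 1 * (f 1 2 * v 1 + f 2 2 * v 2)"
    "(f 1 1 * f 2 2 - f 1 2 * f 2 1) * v 2 = f 1 1 * (f 1 2 * v 1 + f 2 2 * v 2) - f 1 2 * (f 1 1 * v 1 + f 2 1 * v 2)"
    by (simp_all add: algebra_simps)
  then have v12: "v 1 = 0" "v 2 = 0" using D unfolding e by simp_all
  have "i \<in> {1..n} \<longrightarrow> v i = 0" for i
  proof (induction i rule: less_induct)
    case (less i)
    show ?case
    proof
      assume i: "i \<in> {1..n}"
      show "v i = 0"
      proof (cases "i \<le> 2")
        case True
        then have "i = 1 \<or> i = 2" using i by auto
        then show ?thesis using v12 by auto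
      next
        case False
        have "(\<Sum>r=1..n. f r i * v r) = (\<Sum>r=1..n. if r = i then f i i * v i else 0)"
        proof (rule sum.cong[OF refl])
          fix r assume r: "r \<in> {1..n}"
          show "f r i * v r = (if r = i then f i i * v i else 0)"
            using less.IH[of r] r f[of r] vfl_zero[of "f r" n r i] False
            by (cases r i rule: linorder_cases) auto
        qed
        then have "f i i * v i = 0" using v i by auto
        then show ?thesis using f[of i] i False by auto
      qed
    qed
  qed
  then show ?thesis by blast
qed

text \<open>In the basis generated by \<open>x\<close> and \<open>y\<close> the structure constants satisfy
  \<open>e_i e_(i+1) = e_(i+2)\<close> automatically.\<close>

lemma generated_change:
  assumes c: "c \<in> tri n" and sup: "\<And>i. 1 \<le> i \<Longrightarrow> Suc (Suc i) \<le> n \<Longrightarrow> c (i, Suc i, Suc (Suc i)) \<noteq> 0"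
    and xy: "x \<in> vspace n" "y \<in> vspace n" and n: "4 \<le> n"
    and D: "x 1 * y 2 - x 2 * y 1 \<noteq> 0" and E: "y 1 * c (1,3,4) + y 2 * c (2,3,4) \<noteq> 0"
  shows "\<exists>c'. isom n c c' \<and> nice n c' \<and> (\<forall>i j k. i \<in> {1..n} \<and> 3 \<le> j \<and> j \<le> n \<and> k \<le> n \<longrightarrow>
    amul n c (gen n c x y i) (gen n c x y j) k = (\<Sum>r\<in>{Suc j..k}. c' (i,j,r) * gen n c x y r k))"
proof -
  define f where "f = gen n c x y"
  have f12: "f 1 = x" "f 2 = y" by (auto simp: f_def)
  have f3: "f i \<in> vfl n i \<and> f i i \<noteq> 0" if "3 \<le> i" "i \<le> n" for i
    using gen_vfl[OF c that(1)] gen_diag_nonzero[OF c sup D E that] by (simp add: f_def)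
  have fV: "f i \<in> vspace n" if "i \<in> {1..n}" for i
  proof -
    consider "i = 1" | "i = 2" | "3 \<le> i" using \<open>i \<in> {1..n}\<close> by fastforce
    then show ?thesis
    proof cases
      case 3
      then show ?thesis using f3[of i] that vfl_vspace by auto
    qed (use xy in \<open>simp_all only: f12\<close>)
  qed
  define g where "g = (\<lambda>l i. f i l)"
  obtain h where gh: "ginv n g h"
  proof (rule trivial_kernel_imp_ginv)
    fix v assume v: "\<forall>l\<in>{1..n}. (\<Sum>i=1..n. g l i * v i) = 0"
    have Df: "f 1 1 * f 2 2 - f 1 2 * f 2 1 \<noteq> 0" unfolding f12 by (rule D)
    show "\<forall>i\<in>{1..n}. v i = 0"
      by (rule flag_kernel[OF f3 _ Df]) (use v n in \<open>simp_all add: g_def\<close>)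
  qed
  have gev: "mv n g (ev i) = f i" if "i \<in> {1..n}" for i
    using fV[OF that] unfolding mv_ev[OF that] g_def by (auto simp: vspace_def)
  define c' where "c' = act n c g h"
  have c': "c' \<in> tri n"
    unfolding c'_def
  proof (rule act_tri[OF c gh])
    fix l i assume "l \<in> {1..n}" "i \<in> {1..n}" "l < i" "3 \<le> i"
    then show "g l i = 0" using f3[of i] vfl_zero[of "f i" n i l] by (simp add: g_def)
  qed
  have row: "mv n g (\<lambda>k. c' (i,j,k)) = amul n c (f i) (f j)" if "i \<in> {1..n}" "j \<in> {1..n}" for i j
  proof -
    have "(\<lambda>k. c' (i,j,k)) = amul n c' (ev i) (ev j)"
      by (rule ext) (simp add: amul_ev[OF that])
    also have "\<dots> = mv n h (amul n c (f i) (f j))"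
      unfolding c'_def amul_act gev[OF that(1)] gev[OF that(2)] by (rule refl)
    finally show ?thesis by (simp add: ginv_mv(1)[OF gh] amul_vspace tri_ambient[OF c])
  qed
  have "nice n c'"
    unfolding nice_def
  proof (intro conjI c' allI impI)
    fix i k assume i: "1 \<le> i \<and> Suc (Suc i) \<le> n"
    have cV: "(\<lambda>k. c' (i, Suc i, k)) \<in> vspace n"
      using tri_ambient[OF c'] by (auto simp: vspace_def ambient_def box_def)
    have "mv n g (\<lambda>k. c' (i, Suc i, k)) = f (Suc (Suc i))"
      using row[of i "Suc i"] i gen_rec[of i n c x y] by (simp add: f_def)
    also have "\<dots> = mv n g (ev (Suc (Suc i)))" using gev i by simp
    finally have "mv n h (mv n g (\<lambda>k. c' (i, Suc i, k))) = mv n h (mv n g (ev (Suc (Suc i))))" by simp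
    then have "(\<lambda>k. c' (i, Suc i, k)) = ev (Suc (Suc i))"
      using ginv_mv(2)[OF gh cV] ginv_mv(2)[OF gh ev_vspace[of "Suc (Suc i)" n]] i by simp
    then show "c' (i, Suc i, k) = (if k = Suc (Suc i) then 1 else 0)"
      by (metis ev_def)
  qed
  \<comment> \<open>The coordinate form of f_i f_j = sum_r c'(i,j,r) f_r. Triangularity of c' and
    f_r in V_r confine r to j < r <= k, so the new constants can be read off upwards in k without
    inverting g.\<close>
  moreover have "amul n c (f i) (f j) k = (\<Sum>r\<in>{Suc j..k}. c' (i,j,r) * f r k)"
    if "i \<in> {1..n}" "3 \<le> j" "j \<le> n" "k \<le> n" for i j k
  proof -
    have jj: "j \<in> {1..n}" using that by auto
    have vk: "amul n c (f i) (f j) \<in> vspace n" by (rule amul_vspace[OF tri_ambient[OF c]])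
    show ?thesis
    proof (cases "k = 0")
      case True
      then show ?thesis using vk by (simp add: vspace_def)
    next
      case False
      have "amul n c (f i) (f j) k = (\<Sum>r=1..n. f r k * c' (i,j,r))"
        using row[OF that(1) jj] False that(4) by (auto simp: mv_def g_def fun_eq_iff dest: spec[of _ k])
      also have "\<dots> = (\<Sum>r\<in>{Suc j..k}. f r k * c' (i,j,r))"
      proof (rule sum.mono_neutral_right)
        show "\<forall>r\<in>{1..n} - {Suc j..k}. f r k * c' (i,j,r) = 0"
        proof
          fix r assume r: "r \<in> {1..n} - {Suc j..k}"
          then have "r \<le> j \<or> (3 \<le> r \<and> r \<le> n \<and> k < r)" using that(2) by auto
          then show "f r k * c' (i,j,r) = 0"
            using tri_zero[OF c', of r i j] f3[of r] vfl_zero[of "f r" n r k] by auto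
        qed
      qed (use that in auto)
      finally show ?thesis by (simp add: mult.commute)
    qed
  qed
  moreover have "isom n c c'" unfolding isom_def c'_def using gh by blast
  ultimately show ?thesis unfolding f_def by blast
qed

text \<open>By \<open>gen_diag_one\<close> the normalization D = E = 1 makes all leading
  coefficients from f_3 on equal to 1, so old and new constants can be compared without
  factors.\<close>

lemma nice_change:
  assumes c: "nice n c" and xy: "x \<in> vspace n" "y \<in> vspace n" and n: "4 \<le> n"
    and D: "x 1 * y 2 - x 2 * y 1 = 1" and E: "y 1 * c (1,3,4) + y 2 = 1"
  shows "\<exists>c'. isom n c c' \<and> nice n c' \<and> (\<forall>i j k. i \<in> {1..n} \<and> 3 \<le> j \<and> j \<le> n \<and> k \<le> n \<longrightarrow>
    amul n c (gen n c x y i) (gen n c x y j) k = (\<Sum>r\<in>{Suc j..k}. c' (i,j,r) * gen n c x y r k))"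
proof (rule generated_change[OF nice_tri[OF c] _ xy n])
  have c12: "c (2,3,4) = 1"
    using nice_super[OF c, of 2 4] n by (simp add: eval_nat_numeral)
  show "x 1 * y 2 - x 2 * y 1 \<noteq> 0" "y 1 * c (1,3,4) + y 2 * c (2,3,4) \<noteq> 0"
    unfolding c12 mult_1_right D E by simp_all
qed (use nice_super[OF c] in simp)

section \<open>Normalizing the structure constants\<close>

text \<open>The substitution \<open>e1 + u e_m\<close>, \<open>e2 + v e_m\<close> leaves all structure constants of level at most
  \<open>m\<close> unchanged.\<close>

lemma nice_shift:
  assumes c: "nice n c" and m: "3 \<le> m" "m < n"
  shows "\<exists>c'. isom n c c' \<and> nice n c' \<and>
    (\<forall>i j k. i \<in> {1..n} \<and> 3 \<le> j \<and> j \<le> n \<and> k \<le> m \<longrightarrow> c' (i,j,k) = c (i,j,k)) \<and>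
    (\<forall>b. 3 \<le> b \<and> b < n \<longrightarrow> c' (1,b,Suc b) = c (1,b,Suc b) + u * c (m,b,Suc b) \<and>
       c' (2,b,Suc b) = c (2,b,Suc b) + v * c (m,b,Suc b)) \<and>
    (5 \<le> m \<longrightarrow> c' (1,m-1,Suc m) = c (1,m-1,Suc m) - u \<and> c' (2,m-1,Suc m) = c (2,m-1,Suc m) - v)"
proof -
  note ct = nice_tri[OF c]
  define x where "x = (\<lambda>k. u * ev m k + ev 1 k)"
  define y where "y = (\<lambda>k. v * ev m k + ev 2 k)"
  define f where "f = gen n c x y"
  have n: "4 \<le> n" using m by simp
  have xV: "x \<in> vspace n" and yV: "y \<in> vspace n"
    unfolding x_def y_def using m by (auto intro!: vspace_comb ev_vspace)
  have x12: "x 1 = 1" "x 2 = 0" and y12: "y 1 = 0" "y 2 = 1"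
    using m by (auto simp: x_def y_def ev_def)
  have c12: "c (2,3,4) = 1"
    using nice_super[OF c, of 2 4] n by (simp add: eval_nat_numeral)
  have D: "x 1 * y 2 - x 2 * y 1 = 1" and E: "y 1 * c (1,3,4) + y 2 = 1"
    unfolding x12 y12 by simp_all
  have diag: "f i i = 1" if "3 \<le> i" "i \<le> n" for i
    unfolding f_def by (rule gen_diag_one[OF c D E that n])
  have xag: "x i = ev 1 i" and yag: "y i = ev 2 i" if "i < m" for i
    using that by (auto simp: x_def y_def ev_def)
  have f12: "f 1 = x" "f 2 = y" by (auto simp: f_def)
  have prodev: "amul n c (ev i) (ev (Suc i)) = ev (Suc (Suc i))" if "1 \<le> i" "Suc (Suc i) \<le> n" for i
    by (rule nice_amul_ev[OF c that])
  \<comment> \<open>The vectors x and y agree with e_1 and e_2 only below level m, but a coefficient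
    at level m of a product involves only coordinates below m. So the generated vectors agree with
    the e_i one level further.\<close>
  have agree: "f i k = ev i k" if "3 \<le> i" "i \<le> n" "k \<le> m" for i k
    using that
  proof (induction i arbitrary: k rule: less_induct)
    case (less i)
    then obtain j where j: "i = Suc (Suc j)" "1 \<le> j"
      by (metis One_nat_def Suc_le_D Suc_le_mono numeral_3_eq_3)
    have ag: "f r l = ev r l" if "r \<in> {j, Suc j}" "l < k" for r l
    proof -
      have lm: "l < m" using that less.prems by simp
      consider "r = 1" | "r = 2" | "3 \<le> r" using \<open>r \<in> {j, Suc j}\<close> j by fastforce
      then show ?thesis
      proof cases
        case 3
        then show ?thesis using less.IH[of r l] less.prems that j lm by auto
      qed (simp_all only: f12 xag[OF lm] yag[OF lm])
    qed
    have "f i k = amul n c (f j) (f (Suc j)) k" using gen_rec[OF j(2)] by (simp add: f_def j(1))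
    also have "\<dots> = amul n c (ev j) (ev (Suc j)) k"
      by (rule amul_agree[OF ct]) (use ag less.prems m in auto)
    also have "\<dots> = ev i k" using prodev[OF j(2)] less.prems j by simp
    finally show ?case .
  qed
  obtain c' where iso: "isom n c c'" and nc': "nice n c'"
    and eq: "\<And>i j k. i \<in> {1..n} \<Longrightarrow> 3 \<le> j \<Longrightarrow> j \<le> n \<Longrightarrow> k \<le> n \<Longrightarrow>
      amul n c (f i) (f j) k = (\<Sum>r\<in>{Suc j..k}. c' (i,j,r) * f r k)"
    using nice_change[OF c xV yV n D E] unfolding f_def by blast
  have agall: "f i k = ev i k" if "i \<in> {1..n}" "k < m" for i k
  proof -
    consider "i = 1" | "i = 2" | "3 \<le> i" using \<open>i \<in> {1..n}\<close> by fastforce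
    then show ?thesis
    proof cases
      case 3
      then show ?thesis using agree[of i k] that by auto
    qed (simp_all only: f12 xag[OF that(2)] yag[OF that(2)])
  qed
  have P: "c' (i,j,k) = c (i,j,k)" if "i \<in> {1..n}" "3 \<le> j" "j \<le> n" "k \<le> m" for i j k
  proof (cases "k \<le> j")
    case True
    then show ?thesis using tri_zero[OF ct, of k i j] tri_zero[OF nice_tri[OF nc'], of k i j] by simp
  next
    case False
    have jj: "j \<in> {1..n}" using that by auto
    have "c (i,j,k) = amul n c (ev i) (ev j) k" using amul_ev[OF that(1) jj] by simp
    also have "\<dots> = amul n c (f i) (f j) k"
      by (rule amul_agree[OF ct]) (use agall that m in auto)
    also have "\<dots> = (\<Sum>r\<in>{Suc j..k}. c' (i,j,r) * f r k)"
      by (rule eq) (use that m in auto)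
    also have "\<dots> = (\<Sum>r\<in>{Suc j..k}. if r = k then c' (i,j,k) else 0)"
      by (rule sum.cong[OF refl]) (use agree that m in \<open>auto simp: ev_def\<close>)
    also have "\<dots> = c' (i,j,k)" using False by simp
    finally show ?thesis by simp
  qed
  have amx: "amul n c x z k = u * amul n c (ev m) z k + amul n c (ev 1) z k" for z k
    unfolding x_def by (simp add: amul_comb_left)
  have amy: "amul n c y z k = v * amul n c (ev m) z k + amul n c (ev 2) z k" for z k
    unfolding y_def by (simp add: amul_comb_left)
  have mn: "m \<in> {1..n}" "1 \<in> {1..n}" "2 \<in> {1..n}" using m by auto
  have fv: "f b \<in> vfl n b" if "3 \<le> b" for b unfolding f_def by (rule gen_vfl[OF ct that])
  have A: "c' (1,b,Suc b) = c (1,b,Suc b) + u * c (m,b,Suc b) \<and>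
       c' (2,b,Suc b) = c (2,b,Suc b) + v * c (m,b,Suc b)" if b: "3 \<le> b" "b < n" for b
  proof -
    have r: "amul n c (ev i) (f b) (Suc b) = c (i,b,Suc b)" if "i \<in> {1..n}" for i
      using amul_ev_row[OF ct fv[OF b(1)] that, of "Suc b"] b diag[of b] by simp
    have l: "amul n c (f i) (f b) (Suc b) = c' (i,b,Suc b)" if "i \<in> {1..n}" for i
      using eq[OF that b(1), of "Suc b"] b diag[of "Suc b"] by simp
    show ?thesis
      using l[OF mn(2), unfolded f12] l[OF mn(3), unfolded f12] amx[of "f b" "Suc b"] amy[of "f b" "Suc b"] r[OF mn(1)] r[OF mn(2)] r[OF mn(3)]
      by (simp add: algebra_simps)
  qed
  \<comment> \<open>The summand u e_m contributes u e_m e_(m-1) = -u e_(m+1), and likewise for v.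
    For m >= 5 both factors of f_m = f_(m-2) f_(m-1) are correct up to level m, so f_m has no
    component at e_(m+1) that would disturb this.\<close>
  have Q: "c' (1,m-1,Suc m) = c (1,m-1,Suc m) - u \<and> c' (2,m-1,Suc m) = c (2,m-1,Suc m) - v" if m5: "5 \<le> m"
  proof -
    have m1: "m - 1 \<in> {1..n}" "3 \<le> m - 1" "m - 1 \<le> n" "Suc (m - 1) = m" using m m5 by auto
    obtain j where j: "m = Suc (Suc j)" "3 \<le> j" 
      by (rule that[of "m - 2"]) (use m5 in auto)
    have fm: "f m (Suc m) = 0"
    proof -
      have "f m (Suc m) = amul n c (f j) (f (Suc j)) (Suc m)"
        using gen_rec[of j n c x y] j by (simp add: f_def)
      also have "\<dots> = amul n c (ev j) (ev (Suc j)) (Suc m)"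
        by (rule amul_agree[OF ct]) (use agree j m in auto)
      also have "\<dots> = 0" using prodev[of j] j m by (simp add: ev_def)
      finally show ?thesis .
    qed
    have l: "amul n c (f i) (f (m - 1)) (Suc m) = c' (i,m-1,Suc m)" if "i \<in> {1..n}" for i
    proof -
      have "{Suc (m - 1)..Suc m} = {m, Suc m}" using m1 by auto
      then show ?thesis
        using eq[OF that m1(2,3), of "Suc m"] m diag[of "Suc m"] fm by simp
    qed
    have r: "amul n c (ev i) (f (m - 1)) (Suc m) = c (i,m-1,Suc m)" if "i \<in> {1..n}" for i
    proof -
      have "amul n c (ev i) (f (m - 1)) (Suc m) = amul n c (ev i) (ev (m - 1)) (Suc m)"
        by (rule amul_agree[OF ct]) (use agree m1 m in auto)
      then show ?thesis using amul_ev[OF that m1(1)] by simp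
    qed
    have "c (m,m-1,Suc m) = -1"
      using tri_anti[OF ct, of m "m - 1" "Suc m"] nice_super[OF c, of "m - 1" "Suc m"] m1 m m5 by simp
    then show ?thesis
      using l[OF mn(2), unfolded f12] l[OF mn(3), unfolded f12] amx[of "f (m-1)" "Suc m"] amy[of "f (m-1)" "Suc m"] r[OF mn(1)] r[OF mn(2)] r[OF mn(3)]
      by (simp add: algebra_simps)
  qed
  show ?thesis using iso nc' P A Q by blast
qed

text \<open>The substitution is e_1 - c(1,3,4) e_2, which works because e_2 e_3 = e_4.\<close>

lemma nice_shear:
  assumes c: "nice n c" and n: "4 \<le> n"
  shows "\<exists>c'. isom n c c' \<and> nice n c' \<and> c' (1,3,4) = 0"
proof -
  note ct = nice_tri[OF c]
  define b where "b = - c (1,3,4)"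
  define x where "x = (\<lambda>k. b * ev 2 k + ev 1 k)"
  have xV: "x \<in> vspace n" "ev 2 \<in> vspace n"
    unfolding x_def using n by (auto intro!: vspace_comb ev_vspace)
  have c12: "c (2,3,4) = 1"
    using nice_super[OF c, of 2 4] n by (simp add: eval_nat_numeral)
  have D: "x 1 * ev 2 2 - x 2 * ev 2 1 = 1" and E: "ev 2 1 * c (1,3,4) + ev 2 2 = 1"
    by (simp_all add: x_def ev_def)
  obtain c' where iso: "isom n c c'" and nc': "nice n c'"
    and eq: "\<And>i j k. i \<in> {1..n} \<Longrightarrow> 3 \<le> j \<Longrightarrow> j \<le> n \<Longrightarrow> k \<le> n \<Longrightarrow>
      amul n c (gen n c x (ev 2) i) (gen n c x (ev 2) j) k = (\<Sum>r\<in>{Suc j..k}. c' (i,j,r) * gen n c x (ev 2) r k)"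
    using nice_change[OF c xV n D E] by blast
  have d: "gen n c x (ev 2) 3 3 = 1" "gen n c x (ev 2) 4 4 = 1"
    using gen_diag_one[OF c D E, of 3] gen_diag_one[OF c D E, of 4] n by auto
  have "c' (1,3,4) = amul n c x (gen n c x (ev 2) 3) 4"
    using eq[of 1 3 4] n d by (simp add: eval_nat_numeral)
  also have "\<dots> = (x 1 * c (1,3,4) + x 2 * c (2,3,4)) * 1"
    using amul_4[OF ct _ gen_vfl[OF ct order_refl], of x x "ev 2"] d n by simp
  also have "\<dots> = 0" by (simp add: x_def ev_def b_def c12)
  finally show ?thesis using iso nc' by blast
qed

text \<open>The substitution is \<open>e2 + p e1\<close>; it moves \<open>c (1,3,6)\<close> by \<open>- p c(1,3,5)^2 c(3,5,6)\<close>.\<close>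

lemma nice_kill_136:
  assumes c: "nice n c" and n: "6 \<le> n"
    and z: "c (1,3,4) = 0" "c (1,4,5) = 0" "c (2,4,5) = 0" "c (1,5,6) = 0" "c (2,5,6) = 0"
      "c (1,4,6) = 0" "c (2,4,6) = 0" and nz: "c (1,3,5) \<noteq> 0" "c (3,5,6) \<noteq> 0"
  shows "\<exists>c'. isom n c c' \<and> nice n c' \<and> c' (1,3,4) = 0 \<and> c' (1,4,5) = 0 \<and> c' (2,4,5) = 0 \<and>
    c' (1,5,6) = 0 \<and> c' (2,5,6) = 0 \<and> c' (1,4,6) = 0 \<and> c' (2,4,6) = 0 \<and> c' (1,3,6) = 0 \<and>
    c' (1,3,5) \<noteq> 0 \<and> c' (3,5,6) \<noteq> 0"
proof -
  note ct = nice_tri[OF c]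
  have n4: "4 \<le> n" using n by simp
  define p where "p = c (1,3,6) / (c (1,3,5) ^ 2 * c (3,5,6))"
  have p: "p * c (1,3,5) ^ 2 * c (3,5,6) = c (1,3,6)" using nz by (simp add: p_def)
  define y where "y = (\<lambda>k. p * ev 1 k + ev 2 k)"
  have yV: "ev 1 \<in> vspace n" "y \<in> vspace n"
    unfolding y_def using n by (auto intro!: vspace_comb ev_vspace)
  have D: "ev 1 1 * y 2 - ev 1 2 * y 1 = 1" and E: "y 1 * c (1,3,4) + y 2 = 1"
    unfolding z by (simp_all add: y_def ev_def)
  define f where "f = gen n c (ev 1) y"
  obtain c' where iso: "isom n c c'" and nc': "nice n c'"
    and eq: "\<And>i j k. i \<in> {1..n} \<Longrightarrow> 3 \<le> j \<Longrightarrow> j \<le> n \<Longrightarrow> k \<le> n \<Longrightarrow>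
      amul n c (f i) (f j) k = (\<Sum>r\<in>{Suc j..k}. c' (i,j,r) * f r k)"
    using nice_change[OF c yV n4 D E] unfolding f_def by blast
  have d: "f i i = 1" if "3 \<le> i" "i \<le> n" for i
    unfolding f_def by (rule gen_diag_one[OF c D E that]) (use n in simp)
  have fv: "f i \<in> vfl n i" if "3 \<le> i" for i unfolding f_def by (rule gen_vfl[OF ct that])
  have mem: "1 \<in> {1..n}" "2 \<in> {1..n}" "3 \<in> {1..n}" "4 \<in> {1..n}" using n by auto
  have S45: "(\<Sum>r\<in>{4..5}. F r) = F 4 + F 5" and S46: "(\<Sum>r\<in>{4..6}. F r) = F 4 + F 5 + F 6"
    and S56: "(\<Sum>r\<in>{5..6}. F r) = F 5 + F 6" and R46: "(\<Sum>r\<in>{4..<6}. F r) = F 4 + F 5"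
    and R45: "(\<Sum>r\<in>{4..<5}. F r) = F 4" and R56: "(\<Sum>r\<in>{5..<6}. F r) = F 5"
    for F :: "nat \<Rightarrow> complex"
    by (simp_all add: eval_nat_numeral)
  have y: "amul n c y w k = p * amul n c (ev 1) w k + amul n c (ev 2) w k" for w k
    unfolding y_def by (simp add: amul_comb_left)
  have f1: "f 1 = ev 1" and f2: "f 2 = y" by (simp_all add: f_def)
  have f3: "f 3 = ev 3"
  proof -
    have "f 3 = amul n c (ev 1) y" by (simp add: f_def gen_3)
    also have "\<dots> = (\<lambda>k. p * c (1,1,k) + amul n c (ev 1) (ev (Suc 1)) k)"
      unfolding y_def amul_comb_right using amul_ev[OF mem(1,1)] by (simp add: eval_nat_numeral)
    also have "\<dots> = ev 3"
      using nice_amul_ev[OF c, of 1] n tri_diag[OF ct] by (simp add: eval_nat_numeral)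
    finally show ?thesis .
  qed
  \<comment> \<open>The new f_4 = e_4 + p e_1 e_3 acquires p c(1,3,5) e_5, and then f_5 = e_3 f_4
    acquires p c(1,3,5) c(3,5,6) e_6. Rewriting e_1 e_3 in the new basis subtracts c(1,3,5) times
    this last coefficient from c(1,3,6).\<close>
  have f4: "f 4 k = p * c (1,3,k) + ev 4 k" for k
  proof -
    have "amul n c (ev 2) (ev 3) = ev 4"
      using nice_amul_ev[OF c, of 2] n by (simp add: eval_nat_numeral)
    moreover have "f 4 = amul n c y (f 3)" by (simp only: f_def gen_4)
    ultimately show ?thesis using amul_ev[OF mem(1,3), of c k] y[of "ev 3" k] by (simp only: f3)
  qed
  have f45: "f 4 5 = p * c (1,3,5)" unfolding f4 by (simp add: ev_def)
  have c346: "c (3,4,6) = 0" using nice_super[OF c, of 3 6] n by (simp add: eval_nat_numeral)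
  have f56: "f 5 6 = p * c (1,3,5) * c (3,5,6)"
  proof -
    have "f 5 = amul n c (f 3) (f 4)"
      using gen_rec[of 3 n c "ev 1" y] by (simp add: f_def eval_nat_numeral)
    then have "f 5 6 = amul n c (ev 3) (f 4) 6" by (simp add: f3)
    also have "\<dots> = f 4 4 * c (3,4,6) + f 4 5 * c (3,5,6)"
      using amul_ev_row[OF ct fv[of 4] mem(3), of 6] n by (simp add: R46)
    finally show ?thesis by (simp add: c346 f45)
  qed
  have dd: "f 4 4 = 1" "f 5 5 = 1" "f 6 6 = 1" using d n by auto
  have r45: "amul n c (ev i) (f 4) 5 = c (i,4,5)" if "i \<in> {1..n}" for i
    using amul_ev_row[OF ct fv[of 4] that, of 5] n by (simp add: R45 dd)
  have r46: "amul n c (ev i) (f 4) 6 = c (i,4,6) + f 4 5 * c (i,5,6)" if "i \<in> {1..n}" for i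
    using amul_ev_row[OF ct fv[of 4] that, of 6] n by (simp add: R46 dd)
  have r56: "amul n c (ev i) (f 5) 6 = c (i,5,6)" if "i \<in> {1..n}" for i
    using amul_ev_row[OF ct fv[of 5] that, of 6] n by (simp add: R56 dd)
  have r3: "amul n c (f 1) (f 3) k = c (1,3,k)" for k
    unfolding f1 f3 by (rule amul_ev[OF mem(1,3)])
  have l34: "amul n c (f i) (f 3) 4 = c' (i,3,4)" if "i \<in> {1..n}" for i
    using eq[OF that, of 3 4] n by (simp add: dd)
  have l35: "amul n c (f i) (f 3) 5 = c' (i,3,4) * f 4 5 + c' (i,3,5)" if "i \<in> {1..n}" for i
    using eq[OF that, of 3 5] n by (simp add: dd S45)
  have l36: "amul n c (f i) (f 3) 6 = c' (i,3,4) * f 4 6 + c' (i,3,5) * f 5 6 + c' (i,3,6)" if "i \<in> {1..n}" for i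
    using eq[OF that, of 3 6] n by (simp add: dd S46)
  have l45: "amul n c (f i) (f 4) 5 = c' (i,4,5)" if "i \<in> {1..n}" for i
    using eq[OF that, of 4 5] n by (simp add: dd)
  have l46: "amul n c (f i) (f 4) 6 = c' (i,4,5) * f 5 6 + c' (i,4,6)" if "i \<in> {1..n}" for i
    using eq[OF that, of 4 6] n by (simp add: dd S56)
  have l56: "amul n c (f i) (f 5) 6 = c' (i,5,6)" if "i \<in> {1..n}" for i
    using eq[OF that, of 5 6] n by (simp add: dd)
  have c34: "c' (1,3,4) = 0" using l34[OF mem(1)] unfolding r3 z by simp
  have c35: "c' (1,3,5) = c (1,3,5)" using l35[OF mem(1)] unfolding r3 c34 by simp
  have c36: "c' (1,3,6) = 0"
    using l36[OF mem(1)] p unfolding r3 c34 c35 f56 by (simp add: power2_eq_square mult_ac)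
  have c145: "c' (1,4,5) = 0" using l45[OF mem(1)] unfolding f1 r45[OF mem(1)] z by simp
  have c146: "c' (1,4,6) = 0" using l46[OF mem(1)] unfolding f1 r46[OF mem(1)] z c145 by simp
  have c245: "c' (2,4,5) = 0" using l45[OF mem(2)] unfolding f2 y r45[OF mem(1)] r45[OF mem(2)] z by simp
  have c246: "c' (2,4,6) = 0"
    using l46[OF mem(2)] unfolding f2 y r46[OF mem(1)] r46[OF mem(2)] z c245 by simp
  have c156: "c' (1,5,6) = 0" using l56[OF mem(1)] unfolding f1 r56[OF mem(1)] z by simp
  have c256: "c' (2,5,6) = 0" using l56[OF mem(2)] unfolding f2 y r56[OF mem(1)] r56[OF mem(2)] z by simp
  have c356: "c' (3,5,6) = c (3,5,6)" using l56[OF mem(3)] unfolding f3 r56[OF mem(3)] by simp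
  show ?thesis
    using iso nc' c34 c35 c36 c145 c146 c245 c246 c156 c256 c356 nz by (intro exI[of _ c']) simp
qed

text \<open>The factors of the diagonal change of basis forced by f_(i+2) = f_i f_(i+1): monomials
  in a and q with Fibonacci exponents. Index 0 is a dummy.\<close>

fun scal :: "complex \<Rightarrow> complex \<Rightarrow> nat \<Rightarrow> complex" where
  "scal a q 0 = 1"
| "scal a q (Suc 0) = a"
| "scal a q (Suc (Suc 0)) = q"
| "scal a q (Suc (Suc (Suc i))) = scal a q (Suc i) * scal a q (Suc (Suc i))"

lemma scal_rec: "1 \<le> i \<Longrightarrow> scal a q (Suc (Suc i)) = scal a q i * scal a q (Suc i)"
  by (cases i) auto

lemma scal_nonzero: "a \<noteq> 0 \<Longrightarrow> q \<noteq> 0 \<Longrightarrow> scal a q i \<noteq> 0"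
  by (induction a q i rule: scal.induct) auto

lemma amul_scale: "amul n c (\<lambda>k. a * x k) (\<lambda>k. b * y k) k = a * b * amul n c x y k"
  by (simp add: amul_def sum_distrib_left mult_ac)

lemma nice_scale:
  assumes c: "nice n c" and n: "4 \<le> n" and aq: "a \<noteq> 0" "q \<noteq> 0"
  shows "\<exists>c'. isom n c c' \<and> nice n c' \<and> (\<forall>i j k. i \<in> {1..n} \<and> 3 \<le> j \<and> j \<le> n \<and> k \<le> n \<longrightarrow>
    c' (i,j,k) * scal a q k = scal a q i * scal a q j * c (i,j,k))"
proof -
  note ct = nice_tri[OF c]
  define x y where "x = (\<lambda>k. a * ev 1 k)" and "y = (\<lambda>k. q * ev 2 k)"
  have "ev 1 \<in> vspace n" "ev 2 \<in> vspace n" using n by (auto intro: ev_vspace)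
  then have V: "x \<in> vspace n" "y \<in> vspace n" by (auto simp: x_def y_def vspace_def)
  have c12: "c (2,3,4) = 1"
    using nice_super[OF c, of 2 4] n by (simp add: eval_nat_numeral)
  have D: "x 1 * y 2 - x 2 * y 1 \<noteq> 0" using aq by (simp add: x_def y_def ev_def)
  have E: "y 1 * c (1,3,4) + y 2 * c (2,3,4) \<noteq> 0" unfolding c12 using aq by (simp add: y_def ev_def)
  define f where "f = gen n c x y"
  have f: "f i = (\<lambda>k. scal a q i * ev i k)" if "1 \<le> i" "i \<le> n" for i
    using that
  proof (induction i rule: less_induct)
    case (less i)
    consider "i = 1" | "i = 2" | j where "i = Suc (Suc j)" "1 \<le> j"
      using less.prems(1) by (metis One_nat_def Suc_1 Suc_le_D le_SucE not_less_eq_eq zero_less_one nat.exhaust le0)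
    then show ?case
    proof cases
      case 1
      then show ?thesis by (simp add: f_def x_def)
    next
      case 2
      then show ?thesis by (simp add: f_def y_def numeral_2_eq_2)
    next
      case 3
      have "f i = amul n c (f j) (f (Suc j))" using gen_rec[OF 3(2)] by (simp add: f_def 3(1))
      also have "\<dots> = (\<lambda>k. scal a q j * scal a q (Suc j) * amul n c (ev j) (ev (Suc j)) k)"
      proof -
        have "f j = (\<lambda>k. scal a q j * ev j k)" "f (Suc j) = (\<lambda>k. scal a q (Suc j) * ev (Suc j) k)"
          using less.IH[of j] less.IH[of "Suc j"] 3 less.prems by auto
        then show ?thesis by (simp only: amul_scale[abs_def])
      qed
      finally show ?thesis
        using nice_amul_ev[OF c 3(2)] less.prems 3(1) scal_rec[OF 3(2), of a q] by simp
    qed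
  qed
  obtain c' where iso: "isom n c c'" and nc': "nice n c'"
    and eq: "\<And>i j k. i \<in> {1..n} \<Longrightarrow> 3 \<le> j \<Longrightarrow> j \<le> n \<Longrightarrow> k \<le> n \<Longrightarrow>
      amul n c (f i) (f j) k = (\<Sum>r\<in>{Suc j..k}. c' (i,j,r) * f r k)"
  proof -
    have "c (i, Suc i, Suc (Suc i)) \<noteq> 0" if "1 \<le> i" "Suc (Suc i) \<le> n" for i
      using nice_super[OF c that] by simp
    from generated_change[OF ct this V n D E] show thesis using that unfolding f_def by blast
  qed
  have "c' (i,j,k) * scal a q k = scal a q i * scal a q j * c (i,j,k)"
    if "i \<in> {1..n}" "3 \<le> j" "j \<le> n" "k \<le> n" for i j k
  proof (cases "k \<le> j")
    case True
    then show ?thesis using tri_zero[OF ct, of k i j] tri_zero[OF nice_tri[OF nc'], of k i j] by simp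
  next
    case False
    have jj: "j \<in> {1..n}" using that by auto
    have "scal a q i * scal a q j * c (i,j,k) = amul n c (f i) (f j) k"
      using f[of i] f[of j] that jj by (simp add: amul_scale amul_ev)
    also have "\<dots> = (\<Sum>r\<in>{Suc j..k}. c' (i,j,r) * f r k)" by (rule eq[OF that])
    also have "\<dots> = (\<Sum>r\<in>{Suc j..k}. if r = k then c' (i,j,k) * scal a q k else 0)"
      by (rule sum.cong[OF refl]) (use f that in \<open>auto simp: ev_def\<close>)
    also have "\<dots> = c' (i,j,k) * scal a q k" using False by simp
    finally show ?thesis by simp
  qed
  then show ?thesis using iso nc' by blast
qed

section \<open>The family is generic\<close>

lemma nice_perturb:
  assumes "nice n c" "v \<in> tri n" "\<And>i k. v (i, Suc i, k) = 0"
  shows "nice n (\<lambda>t. c t + s * v t)"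
  using assms tri_comb[of c n v s] by (simp add: nice_def)

lemma Tfam_tri: "Tfam n \<subseteq> tri n"
  by (auto simp: Tfam_def tri_iff)

lemma isom_pull:
  assumes stable: "\<And>c g h. c \<in> C \<Longrightarrow> ginv n g h \<Longrightarrow> act n c g h \<in> C"
    and "c \<in> ambient n" "isom n c c'" "c' \<in> C"
  shows "c \<in> C"
proof -
  obtain g h where gh: "ginv n g h" "c' = act n c g h" using assms(3) by (auto simp: isom_def)
  have "act n c' h g \<in> C" by (rule stable[OF assms(4) ginv_sym[OF gh(1)]])
  then show ?thesis using act_inverse[OF assms(2) gh(1)] gh(2) by simp
qed

lemma AN_subset_if_contains_Tfam:
  assumes n: "6 \<le> n" and cl: "zclosed n C" and T: "Tfam n \<subseteq> C"
    and stable: "\<And>c g h. c \<in> C \<Longrightarrow> ginv n g h \<Longrightarrow> act n c g h \<in> C"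
  shows "AN n \<subseteq> C"
proof -
  have pull: "c \<in> C" if "c \<in> tri n" "isom n c c'" "c' \<in> C" for c c'
    by (rule isom_pull[OF stable tri_ambient[OF that(1)] that(2,3)])
  define base where "base c \<longleftrightarrow> nice n c \<and> c (1,3,4) = 0 \<and> c (1,4,5) = 0 \<and> c (2,4,5) = 0 \<and>
     c (1,5,6) = 0 \<and> c (2,5,6) = 0" for c
  define G where "G m c \<longleftrightarrow> base c \<and> c (1,3,6) = 0 \<and> c (1,3,5) \<noteq> 0 \<and> c (3,5,6) \<noteq> 0 \<and>
     (\<forall>i. 4 \<le> i \<and> Suc (Suc i) \<le> m \<longrightarrow> c (1,i,Suc (Suc i)) = 0 \<and> c (2,i,Suc (Suc i)) = 0)" for m c
  have mem: "1 \<in> {1..n}" "2 \<in> {1..n}" "3 \<in> {1..n}" and n4: "4 \<le> n" using n by auto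

  \<comment> \<open>The normalizations are undone one at a time, the last one first; a non-vanishing condition is
    dropped by closedness along a line.\<close>

  have 9: "c \<in> C" if G: "G n c" and c467: "7 \<le> n \<Longrightarrow> c (4,6,7) \<noteq> 0" for c
  proof -
    have c: "nice n c" using G by (simp add: G_def base_def)
    \<comment> \<open>Scaling divides c(3,5,6) by scal_4 / scal_3 = q and c(4,6,7) by scal_5 /
      scal_4 = scal_3 = a q, which dictates both values. For n = 6 only the first condition is
      present and a = 1 will do.\<close>
    define q a where "q = c (3,5,6)" and "a = (if 7 \<le> n then c (4,6,7) / q else 1)"
    have q: "q \<noteq> 0" using G by (simp add: q_def G_def)
    have a: "a \<noteq> 0" using q c467 by (simp add: a_def)
    obtain c' where iso: "isom n c c'" and nc': "nice n c'"
      and sc: "\<And>i j k. i \<in> {1..n} \<Longrightarrow> 3 \<le> j \<Longrightarrow> j \<le> n \<Longrightarrow> k \<le> n \<Longrightarrow>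
        c' (i,j,k) * scal a q k = scal a q i * scal a q j * c (i,j,k)"
      using nice_scale[OF c n4 a q] by blast
    have z: "c' (i,j,k) = 0 \<longleftrightarrow> c (i,j,k) = 0" if "i \<in> {1..n}" "3 \<le> j" "j \<le> n" "k \<le> n" for i j k
      using sc[OF that] scal_nonzero[OF a q, of k] scal_nonzero[OF a q, of i] scal_nonzero[OF a q, of j]
      by (metis mult_eq_0_iff)
    have s3: "scal a q 3 = a * q" and s4: "scal a q 4 = q * scal a q 3" and s5: "scal a q 5 = scal a q 3 * scal a q 4"
      and s6: "scal a q 6 = scal a q 4 * scal a q 5" and s7: "scal a q 7 = scal a q 5 * scal a q 6"
      by (simp_all add: eval_nat_numeral)
    have c356: "c' (3,5,6) = 1"
    proof -
      have "c' (3,5,6) * scal a q 6 = scal a q 3 * scal a q 5 * c (3,5,6)"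
        by (rule sc) (use n in auto)
      also have "\<dots> = 1 * scal a q 6" by (simp only: q_def[symmetric] s6 s4 mult_1 mult_ac)
      finally show ?thesis using scal_nonzero[OF a q, of 6] by (metis mult_right_cancel)
    qed
    have c467': "c' (4,6,7) = 1" if n7: "7 \<le> n"
    proof -
      have "c' (4,6,7) * scal a q 7 = scal a q 4 * scal a q 6 * c (4,6,7)"
        by (rule sc) (use n7 in auto)
      also have "c (4,6,7) = a * q" using n7 q by (simp add: a_def)
      also have "scal a q 4 * scal a q 6 * (a * q) = 1 * scal a q 7" by (simp add: s7 s5 s3)
      finally show ?thesis using scal_nonzero[OF a q, of 7] by (metis mult_right_cancel)
    qed
    have low: "c' (1,i,Suc (Suc i)) = 0 \<and> c' (2,i,Suc (Suc i)) = 0" if "4 \<le> i" "i \<le> n - 2" for i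
      using G z[OF mem(1), of i "Suc (Suc i)"] z[OF mem(2), of i "Suc (Suc i)"] that n by (simp add: G_def)
    have spec: "c' (1,3,4) = 0" "c' (1,4,5) = 0" "c' (2,4,5) = 0" "c' (1,5,6) = 0" "c' (2,5,6) = 0"
      "c' (1,3,6) = 0" "c' (1,3,5) \<noteq> 0"
      using G z[OF mem(1), of 3 4] z[OF mem(1), of 4 5] z[OF mem(2), of 4 5] z[OF mem(1), of 5 6]
        z[OF mem(2), of 5 6] z[OF mem(1), of 3 6] z[OF mem(1), of 3 5] n
      unfolding G_def base_def by auto
    have t: "c' \<in> ambient n \<and> anticomm n c' \<and> (\<forall>i j k. k \<le> max i j \<longrightarrow> c' (i,j,k) = 0)"
      using nice_tri[OF nc'] tri_iff by blast
    have sup: "\<forall>i k. 1 \<le> i \<and> i \<le> n - 2 \<longrightarrow> c' (i, i + 1, k) = (if k = i + 2 then 1 else 0)"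
      using nice_super[OF nc'] n by auto
    have "c' \<in> Tfam n"
      unfolding Tfam_def mem_Collect_eq
      by (intro conjI) (use t sup low spec c356 c467' in auto)
    then show "c \<in> C" using pull[OF nice_tri[OF c] iso] T by blast
  qed

  have 8: "c \<in> C" if G: "G n c" for c
  proof (cases "7 \<le> n")
    case True
    \<comment> \<open>The constant (4,6,7) occurs in no condition of \<open>G\<close> and is not of
      the form (i, i+1, k), so the line stays inside \<open>G n\<close>.\<close>
    define v where "v = skew n (\<lambda>p. if p = (4,6,7) then 1 else 0)"
    have c: "nice n c" using G by (simp add: G_def base_def)
    have vt: "v \<in> tri n" by (simp add: v_def)
    have v0: "v (i,j,k) = 0" if "\<not> (i = 4 \<and> j = 6 \<and> k = 7)" "\<not> (i = 6 \<and> j = 4 \<and> k = 7)" for i j k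
      using that by (auto simp: v_def skew_def)
    have v1: "v (4,6,7) = 1" using True by (simp add: v_def skew_def)
    show ?thesis
    proof (rule zclosed_line[OF cl tri_ambient[OF nice_tri[OF c]], of "{- c (4,6,7)}" v])
      fix s assume s: "s \<notin> {- c (4,6,7)}"
      have "nice n (\<lambda>t. c t + s * v t)"
        by (rule nice_perturb[OF c vt], rule v0) auto
      then have "G n (\<lambda>t. c t + s * v t)" using G v0 by (simp add: G_def base_def)
      moreover have "c (4,6,7) + s * v (4,6,7) \<noteq> 0" using s by (auto simp: v1 add_eq_0_iff)
      ultimately show "(\<lambda>t. c t + s * v t) \<in> C" by (rule 9)
    qed simp
  qed (use 9 G in blast)

  \<comment> \<open>The induction descends from m = n, where membership in C is known. The shift by
    e_m keeps all levels up to m, hence everything secured so far, and clears the constants at (1,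
    m-1, m+1) and (2, m-1, m+1).\<close>
  have 7: "c \<in> C" if "m \<le> n" "6 \<le> m" "G m c" for m c
    using that
  proof (induction m arbitrary: c rule: inc_induct)
    case base
    then show ?case using 8 by blast
  next
    case (step m)
    have c: "nice n c" using step.prems by (simp add: G_def base_def)
    obtain c' where c': "isom n c c'" "nice n c'"
      and P: "\<And>i j k. i \<in> {1..n} \<Longrightarrow> 3 \<le> j \<Longrightarrow> j \<le> n \<Longrightarrow> k \<le> m \<Longrightarrow> c' (i,j,k) = c (i,j,k)"
      and Q: "5 \<le> m \<Longrightarrow> c' (1,m-1,Suc m) = 0 \<and> c' (2,m-1,Suc m) = 0"
      using nice_shift[OF c, of m "c (1,m-1,Suc m)" "c (2,m-1,Suc m)"] step by auto
    have "G (Suc m) c'"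
      unfolding G_def base_def
    proof (intro conjI allI impI c'(2))
      show "c' (1,3,4) = 0" "c' (1,4,5) = 0" "c' (2,4,5) = 0" "c' (1,5,6) = 0" "c' (2,5,6) = 0"
        "c' (1,3,6) = 0" "c' (1,3,5) \<noteq> 0" "c' (3,5,6) \<noteq> 0"
        using step.prems n P[OF mem(1)] P[OF mem(2)] P[OF mem(3)] by (simp_all add: G_def base_def)
      fix i assume i: "4 \<le> i \<and> Suc (Suc i) \<le> Suc m"
      have "c' (1,i,Suc (Suc i)) = 0 \<and> c' (2,i,Suc (Suc i)) = 0"
      proof (cases "Suc (Suc i) \<le> m")
        case True
        then show ?thesis using step.prems step.hyps i P[OF mem(1), of i "Suc (Suc i)"] P[OF mem(2), of i "Suc (Suc i)"]
          by (simp add: G_def)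
      next
        case False
        then have "m = Suc i" using i by simp
        then show ?thesis using Q i by simp
      qed
      then show "c' (1,i,Suc (Suc i)) = 0" "c' (2,i,Suc (Suc i)) = 0" by auto
    qed
    then have "c' \<in> C" using step by simp
    then show ?case by (rule pull[OF nice_tri[OF c] c'(1)])
  qed

  have 6: "c \<in> C" if b: "base c" and z: "c (1,4,6) = 0" "c (2,4,6) = 0" and nz: "c (1,3,5) \<noteq> 0" "c (3,5,6) \<noteq> 0" for c
  proof -
    have c: "nice n c" and zz: "c (1,3,4) = 0" "c (1,4,5) = 0" "c (2,4,5) = 0" "c (1,5,6) = 0" "c (2,5,6) = 0"
      using b unfolding base_def by blast+
    obtain c' where c': "isom n c c'" "nice n c'" and r: "c' (1,3,4) = 0 \<and> c' (1,4,5) = 0 \<and> c' (2,4,5) = 0 \<and>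
      c' (1,5,6) = 0 \<and> c' (2,5,6) = 0 \<and> c' (1,4,6) = 0 \<and> c' (2,4,6) = 0 \<and> c' (1,3,6) = 0 \<and>
      c' (1,3,5) \<noteq> 0 \<and> c' (3,5,6) \<noteq> 0"
      using nice_kill_136[OF c n zz z nz] by blast
    have "c' (1,i,Suc (Suc i)) = 0 \<and> c' (2,i,Suc (Suc i)) = 0" if "4 \<le> i" "Suc (Suc i) \<le> 6" for i
    proof -
      have "i = 4" using that by simp
      then show ?thesis using r by simp
    qed
    then have "G 6 c'" unfolding G_def base_def using c'(2) r by blast
    then have "c' \<in> C" by (rule 7[OF n order_refl])
    then show ?thesis by (rule pull[OF nice_tri[OF c] c'(1)])
  qed

  have 5: "c \<in> C" if b: "base c" and z: "c (1,4,6) = 0" "c (2,4,6) = 0" for c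
  proof -
    \<comment> \<open>The two constants that must not vanish are moved together; neither occurs in
      the equations held so far, and excluding two values of s makes both nonzero.\<close>
    define v where "v = skew n (\<lambda>p. if p = (1,3,5) \<or> p = (3,5,6) then 1 else 0)"
    have c: "nice n c" using b by (simp add: base_def)
    have vt: "v \<in> tri n" by (simp add: v_def)
    have v0: "v (i,j,k) = 0" if "(i,j,k) \<notin> {(1,3,5), (3,1,5), (3,5,6), (5,3,6)}" for i j k
      using that by (auto simp: v_def skew_def)
    have v1: "v (1,3,5) = 1" "v (3,5,6) = 1" using n by (simp_all add: v_def skew_def)
    show ?thesis
    proof (rule zclosed_line[OF cl tri_ambient[OF nice_tri[OF c]], of "{- c (1,3,5), - c (3,5,6)}" v])
      fix s assume s: "s \<notin> {- c (1,3,5), - c (3,5,6)}"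
      have "nice n (\<lambda>t. c t + s * v t)"
        by (rule nice_perturb[OF c vt], rule v0) auto
      then have b': "base (\<lambda>t. c t + s * v t)" using b v0 by (simp add: base_def)
      have "c (1,3,5) + s * v (1,3,5) \<noteq> 0" "c (3,5,6) + s * v (3,5,6) \<noteq> 0"
        using s unfolding v1 by (auto simp: add_eq_0_iff)
      then show "(\<lambda>t. c t + s * v t) \<in> C"
        by (intro 6[OF b']) (use z v0 in simp_all)
    qed simp
  qed

  have 4: "c \<in> C" if b: "base c" for c
  proof -
    have c: "nice n c" using b by (simp add: base_def)
    obtain c' where c': "isom n c c'" "nice n c'"
      and P: "\<And>i j k. i \<in> {1..n} \<Longrightarrow> 3 \<le> j \<Longrightarrow> j \<le> n \<Longrightarrow> k \<le> 5 \<Longrightarrow> c' (i,j,k) = c (i,j,k)"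
      and A: "\<And>b. 3 \<le> b \<Longrightarrow> b < n \<Longrightarrow> c' (1,b,Suc b) = c (1,b,Suc b) + c (1,4,6) * c (5,b,Suc b) \<and>
         c' (2,b,Suc b) = c (2,b,Suc b) + c (2,4,6) * c (5,b,Suc b)"
      and Q: "c' (1,4,6) = 0 \<and> c' (2,4,6) = 0"
      using nice_shift[OF c, of 5 "c (1,4,6)" "c (2,4,6)"] n by auto
    \<comment> \<open>Level 6 is above m = 5, but c(1,5,6) and c(2,5,6) change only by multiples of
      c(5,5,6) = 0.\<close>
    have "base c'"
      unfolding base_def
      using c'(2) b P[OF mem(1)] P[OF mem(2)] A[of 5] tri_diag[OF nice_tri[OF c], of 5 6] n
      by (simp add: base_def)
    then have "c' \<in> C" using 5 Q by blast
    then show ?thesis by (rule pull[OF nice_tri[OF c] c'(1)])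
  qed

  \<comment> \<open>Here with m = 4, and in the next step with m = 3, row 1 changes at (m+1, m+2) by
    u c(m, m+1, m+2) = u, which clears the constant, and at (m, m+1) by u c(m, m, m+1) = 0; row 2
    behaves likewise with v.\<close>
  have 3: "c \<in> C" if c: "nice n c" and z: "c (1,3,4) = 0" "c (1,4,5) = 0" "c (2,4,5) = 0" for c
  proof -
    obtain c' where c': "isom n c c'" "nice n c'"
      and P: "\<And>i j k. i \<in> {1..n} \<Longrightarrow> 3 \<le> j \<Longrightarrow> j \<le> n \<Longrightarrow> k \<le> 4 \<Longrightarrow> c' (i,j,k) = c (i,j,k)"
      and A: "\<And>b. 3 \<le> b \<Longrightarrow> b < n \<Longrightarrow> c' (1,b,Suc b) = c (1,b,Suc b) + (- c (1,5,6)) * c (4,b,Suc b) \<and>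
         c' (2,b,Suc b) = c (2,b,Suc b) + (- c (2,5,6)) * c (4,b,Suc b)"
      using nice_shift[OF c, of 4 "- c (1,5,6)" "- c (2,5,6)"] n by auto
    have c456: "c (4,5,6) = 1" using nice_super[OF c, of 4 6] n by simp
    have "c' (1,3,4) = 0" using P[OF mem(1), of 3 4] z n by simp
    moreover have "c' (1,4,5) = 0" "c' (2,4,5) = 0"
      using A[of 4] z n tri_diag[OF nice_tri[OF c], of 4 5] by simp_all
    moreover have "c' (1,5,6) = 0" "c' (2,5,6) = 0" using A[of 5] c456 n by simp_all
    ultimately have "base c'" unfolding base_def using c'(2) by blast
    then have "c' \<in> C" by (rule 4)
    then show ?thesis by (rule pull[OF nice_tri[OF c] c'(1)])
  qed

  have 2: "c \<in> C" if c: "nice n c" and z: "c (1,3,4) = 0" for c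
  proof -
    obtain c' where c': "isom n c c'" "nice n c'"
      and A: "\<And>b. 3 \<le> b \<Longrightarrow> b < n \<Longrightarrow> c' (1,b,Suc b) = c (1,b,Suc b) + (- c (1,4,5)) * c (3,b,Suc b) \<and>
         c' (2,b,Suc b) = c (2,b,Suc b) + (- c (2,4,5)) * c (3,b,Suc b)"
      using nice_shift[OF c, of 3 "- c (1,4,5)" "- c (2,4,5)"] n by auto
    have c345: "c (3,4,5) = 1" using nice_super[OF c, of 3 5] n by simp
    have "c' (1,3,4) = 0"
      using A[of 3] z n tri_diag[OF nice_tri[OF c], of 3 4] by simp
    moreover have "c' (1,4,5) = 0" "c' (2,4,5) = 0" using A[of 4] c345 n by simp_all
    ultimately have "c' \<in> C" using 3 c'(2) by blast
    then show ?thesis by (rule pull[OF nice_tri[OF c] c'(1)])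
  qed

  have 1: "c \<in> C" if c: "nice n c" for c
  proof -
    obtain c' where "isom n c c'" "nice n c'" "c' (1,3,4) = 0"
      using nice_shear[OF c n4] by blast
    then show ?thesis using pull[OF nice_tri[OF c]] 2 by blast
  qed

  have 0: "c \<in> C" if c: "c \<in> tri n" for c
  proof -
    \<comment> \<open>Adding s times \<open>super\<close> makes every c(i, i+1, i+2) nonzero for
      almost all s. Then e_1 and e_2 themselves generate a basis, since D = 1 and E is the constant
      at (2,3,4).\<close>
    define v where "v = skew n super"
    define B where "B = (\<lambda>i. - c (i, Suc i, Suc (Suc i))) ` {..n}"
    show ?thesis
    proof (rule zclosed_line[OF cl tri_ambient[OF c], of B v])
      fix s assume s: "s \<notin> B"
      define d where "d = (\<lambda>t. c t + s * v t)"
      have d: "d \<in> tri n" unfolding d_def v_def by (rule tri_comb[OF c skew_tri])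
      have sup: "d (i, Suc i, Suc (Suc i)) \<noteq> 0" if "1 \<le> i" "Suc (Suc i) \<le> n" for i
      proof -
        have "v (i, Suc i, Suc (Suc i)) = 1" using that by (simp add: v_def skew_def super_def)
        moreover have "s \<noteq> - c (i, Suc i, Suc (Suc i))" using s that by (auto simp: B_def)
        ultimately show ?thesis by (auto simp: d_def add_eq_0_iff)
      qed
      have "d (2,3,4) \<noteq> 0" using sup[of 2] n by (simp add: eval_nat_numeral)
      moreover have "ev 1 \<in> vspace n" "ev 2 \<in> vspace n" using n by (auto intro: ev_vspace)
      ultimately obtain c' where "isom n d c'" "nice n c'"
        using generated_change[OF d sup, of "ev 1" "ev 2"] n by (auto simp: ev_def)
      then show "(\<lambda>t. c t + s * v t) \<in> C"
        using pull[OF d] 1 unfolding d_def by blast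
    qed (simp add: B_def)
  qed
  show ?thesis unfolding AN_eq using 0 stable by blast
qed

theorem theoremC:
  shows "(\<forall>n\<ge>6. zclosure n (\<Union>c\<in>Tfam n. orbit n c) = AN n) \<and>
         (\<forall>n\<ge>2. zirreducible n (AN n) \<and>
                 has_dim n (AN n) ((n - 2) * (n^2 + 2*n + 3) div 6))"
proof (intro conjI allI impI)
  fix n :: nat assume n: "6 \<le> n"
  let ?S = "\<Union>c\<in>Tfam n. orbit n c"
  have sub: "?S \<subseteq> AN n"
    unfolding orbit_eq using Tfam_tri tri_subset_AN AN_act by blast
  have "zclosure n ?S \<subseteq> AN n" by (rule zclosure_minimal[OF zclosed_AN sub])
  moreover have "AN n \<subseteq> zclosure n ?S"
  proof (rule AN_subset_if_contains_Tfam[OF n])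
    have amb: "?S \<subseteq> ambient n" using sub AN_ambient by blast
    then show "zclosed n (zclosure n ?S)" by (rule zclosed_zclosure)
    have "Tfam n \<subseteq> ?S"
    proof
      fix c assume c: "c \<in> Tfam n"
      let ?d = "\<lambda>i j. (if i = j then 1 else 0) :: complex"
      have "act n c ?d ?d = c"
        by (rule act_id) (use c Tfam_tri tri_ambient in auto)
      then have "c \<in> orbit n c" unfolding orbit_eq using ginv_id[of n] by force
      then show "c \<in> ?S" using c by blast
    qed
    then show "Tfam n \<subseteq> zclosure n ?S" using zclosure_superset by blast
    fix c g h assume c: "c \<in> zclosure n ?S" and gh: "ginv n g h"
    show "act n c g h \<in> zclosure n ?S"
    proof (rule zclosure_act[OF amb _ c])
      fix x assume "x \<in> ?S"
      then obtain t g' h' where t: "t \<in> Tfam n" "ginv n g' h'" "x = act n t g' h'"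
        unfolding orbit_eq by blast
      have "act n x g h = act n t (mm n g' g) (mm n h h')" by (simp add: t(3) act_act)
      moreover have "ginv n (mm n g' g) (mm n h h')" by (rule ginv_mm[OF t(2) gh])
      ultimately show "act n x g h \<in> ?S" using t(1) unfolding orbit_eq by blast
    qed
  qed
  ultimately show "zclosure n ?S = AN n" by (rule subset_antisym)
qed (simp_all add: zirreducible_AN has_dim_AN)

end
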